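(* Let $-\infty\le a<b\le\infty$ and $n\in\mathbb N$. Let $J\in\mathbb C^{n\times n}$ be invertible with $J^*=-J$, and let $q,w\in\mathcal D'^0((a,b))^{n\times n}$ with $q$ Hermitian, $w$ non-negative, $w\neq0$, and $2J\pm\Delta_q(x)$ invertible for every $x\in(a,b)$. Let $T$ be a self-adjoint restriction of the maximal relation $T_{\max}$ of $Ju'+qu=wf$. Then for every $x\in(a,b)$ and every $\lambda\in\rho(T)$ there exists a matrix-valued function $G(x,\cdot,\lambda)$ (with values in $\mathbb C^{n\times n}$) such that the columns of $G(x,\cdot,\lambda)^*$ are in $L^2(w)$ and $$(E_\lambda f)(x)=\int G(x,\cdot,\lambda)wf\qquad\text{for all } f\in L^2(w).$$
   Context: $\mathcal D'^0((a,b))$ is the space of distributions of order $0$ on $(a,b)$, i.e. set functions that are complex measures on each compact subinterval. Each $q\in\mathcal D'^0((a,b))$ has an antiderivative $Q$ of locally bounded variation with $q=dQ$. For $u$ of locally bounded variation, $u^\pm$ are its right-/left-continuous versions, and $u$ is balanced if $u=u^\#:=(u^++u^-)/2$; $BV^\#_{loc}((a,b))$ is the set of balanced functions of locally bounded variation. $\Delta_q(x)=Q^+(x)-Q^-(x)$ (entrywise for matrices). $qf$ is the distribution $\phi\mapsto\int\phi f\,dQ$. $q$ is Hermitian if $q^*=q$ and $w$ is non-negative if $\alpha^*w\alpha$ is a non-negative distribution for each $\alpha\in\mathbb C^n$. With $\tilde W$ the Radon--Nikodym derivative of $w$ with respect to $\operatorname{tr}w$, $\mathcal L^2(w)$ is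 the space of $f:(a,b)\to\mathbb C^n$ with $\int f^*\tilde Wf\,\operatorname{tr}w<\infty$, with semi-inner product $\langle f,g\rangle=\int f^*\tilde Wg\,\operatorname{tr}w$, and $L^2(w)$ is the Hilbert space of classes modulo elements of norm zero. $\int Gwf$ means $\int G\tilde Wf\,\operatorname{tr}w$. $\mathcal T_{\max}=\{(u,f)\in\mathcal L^2(w)\times\mathcal L^2(w):u\in BV^\#_{loc}((a,b))^n,\ Ju'+qu=wf\}$, $T_{\max}=\{([u],[f]):(u,f)\in\mathcal T_{\max}\}$. A restriction of $T_{\max}$ is a linear subspace $T\subset T_{\max}$; it is self-adjoint if $T=T^*=\{(v,g)\in L^2(w)\times L^2(w):\langle g,u\rangle=\langle v,f\rangle\ \forall(u,f)\in T\}$. $\rho(T)$ is the set of $\lambda\in\mathbb C$ with $\ker(T-\lambda)=\{0\}$ and $\operatorname{ran}(T-\lambda)=L^2(w)$; for such $\lambda$, $R_\lambda=(T-\lambda)^{-1}$ is a bounded everywhere defined operator. Fix $x_0\in(a,b)$ at which antiderivatives of $q$ and $w$ are continuous. Put $\mathcal L_0=\{u\in BV^\#_{loc}((a,b))^n:Ju'+qu=0,\ wu=0\}$ and $N_0=\{u(x_0):u\in\mathcal L_0\}\subset\mathbb C^n$. For each $([u],[f])\in T_{\max}$ there is a unique balanced representative $v\in[u]$ with $Jv'+qv=wf$ and $v(x_0)\in N_0^\perp$; put $E([u],[f])=v$. For $\lambda\in\rho(T)$ and $f\in L^2(w)$, $E_\lambda f:=E(R_\lambda f,\lambda R_\lambda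 f+f)$. *)

theory Defs
  imports "HOL-Analysis.Analysis"
begin

section \<open>Vectors and matrices over the complex numbers\<close>

definition cinner :: "complex^'n \<Rightarrow> complex^'n \<Rightarrow> complex" where
  "cinner x y = (\<Sum>i\<in>UNIV. cnj (x $ i) * y $ i)"

definition cadj :: "complex^'n^'n \<Rightarrow> complex^'n^'n" where
  "cadj A = (\<chi> i j. cnj (A $ j $ i))"

definition corth :: "(complex^'n) set \<Rightarrow> (complex^'n) set" where
  "corth S = {y. \<forall>x\<in>S. cinner x y = 0}"

section \<open>Distributions of order 0\<close>

text \<open>Throughout, \<open>a\<close> and \<open>b\<close> are extended reals and the underlying interval is
  \<^term>\<open>einterval a b\<close>. Functions on this interval are total functions on \<^typ>\<open>real\<close> whose
  values outside of it are irrelevant.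

  A distribution of order 0, with values in a normed space (here: vectors or matrices, so that
  all entries are treated simultaneously), is a set function which is a complex measure
  on the Borel subsets of each compact subinterval. Its values on other sets are irrelevant.\<close>

definition rc_borel :: "ereal \<Rightarrow> ereal \<Rightarrow> real set set" where
  "rc_borel a b = {A \<in> sets borel. \<exists>c d. A \<subseteq> {c..d} \<and> {c..d} \<subseteq> einterval a b}"

definition dist0 :: "ereal \<Rightarrow> ereal \<Rightarrow> (real set \<Rightarrow> 'v::real_normed_vector) \<Rightarrow> bool" where
  "dist0 a b q \<longleftrightarrow>
     (\<forall>c d. {c..d} \<subseteq> einterval a b \<longrightarrow>
        (\<forall>A :: nat \<Rightarrow> real set. (\<forall>i. A i \<in> sets borel \<and> A i \<subseteq> {c..d}) \<longrightarrow> disjoint_family A \<longrightarrow>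
           (\<lambda>i. q (A i)) sums q (\<Union>i. A i)))"

definition hermitian_dist :: "ereal \<Rightarrow> ereal \<Rightarrow> (real set \<Rightarrow> complex^'n^'n) \<Rightarrow> bool" where
  "hermitian_dist a b q \<longleftrightarrow> (\<forall>A\<in>rc_borel a b. cadj (q A) = q A)"

definition nonneg_dist :: "ereal \<Rightarrow> ereal \<Rightarrow> (real set \<Rightarrow> complex^'n^'n) \<Rightarrow> bool" where
  "nonneg_dist a b w \<longleftrightarrow> (\<forall>\<alpha>. \<forall>A\<in>rc_borel a b. cinner \<alpha> (w A *v \<alpha>) \<in> \<real>\<^sub>\<ge>\<^sub>0)"

definition nonzero_dist :: "ereal \<Rightarrow> ereal \<Rightarrow> (real set \<Rightarrow> 'v::real_normed_vector) \<Rightarrow> bool" where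
  "nonzero_dist a b w \<longleftrightarrow> (\<exists>A\<in>rc_borel a b. w A \<noteq> 0)"

section \<open>Functions of locally bounded variation and antiderivatives\<close>

definition bv_loc :: "ereal \<Rightarrow> ereal \<Rightarrow> (real \<Rightarrow> 'v::real_normed_vector) \<Rightarrow> bool" where
  "bv_loc a b u \<longleftrightarrow>
     (\<forall>c d. {c..d} \<subseteq> einterval a b \<longrightarrow>
        (\<exists>B. \<forall>t N. incseq t \<longrightarrow> range t \<subseteq> {c..d} \<longrightarrow>
           (\<Sum>i<N. norm (u (t (Suc i)) - u (t i))) \<le> B))"

definition rc_version :: "(real \<Rightarrow> 'v::real_normed_vector) \<Rightarrow> real \<Rightarrow> 'v" where
  "rc_version u x = Lim (at_right x) u"

definition lc_version :: "(real \<Rightarrow> 'v::real_normed_vector) \<Rightarrow> real \<Rightarrow> 'v" where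
  "lc_version u x = Lim (at_left x) u"

definition bv_bal :: "ereal \<Rightarrow> ereal \<Rightarrow> (real \<Rightarrow> 'v::real_normed_vector) \<Rightarrow> bool" where
  "bv_bal a b u \<longleftrightarrow>
     bv_loc a b u \<and>
     (\<forall>x\<in>einterval a b. u x = (1/2) *\<^sub>R (rc_version u x + lc_version u x))"

text \<open>\<open>q = dQ\<close>: on compact intervals \<open>q\<close> is the Lebesgue--Stieltjes measure generated by \<open>Q\<close>.
  Since distributions of order 0 are identified with set functions, this also says \<open>Q' = q\<close>.\<close>

definition antiderivative ::
  "ereal \<Rightarrow> ereal \<Rightarrow> (real set \<Rightarrow> 'v::real_normed_vector) \<Rightarrow> (real \<Rightarrow> 'v) \<Rightarrow> bool" where
  "antiderivative a b q Q \<longleftrightarrow>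
     bv_loc a b Q \<and>
     (\<forall>c d. c \<le> d \<longrightarrow> {c..d} \<subseteq> einterval a b \<longrightarrow> q {c..d} = rc_version Q d - lc_version Q c)"

definition jump :: "ereal \<Rightarrow> ereal \<Rightarrow> (real set \<Rightarrow> 'v::real_normed_vector) \<Rightarrow> real \<Rightarrow> 'v" where
  "jump a b q x =
     (let Q = (SOME Q. antiderivative a b q Q) in rc_version Q x - lc_version Q x)"

section \<open>Products of distributions and functions\<close>

text \<open>The total variation measure of \<open>q\<close>. Finite disjoint families of relatively compact Borel
  sets suffice, since \<open>q\<close> is countably additive.\<close>

definition total_variation ::
  "ereal \<Rightarrow> ereal \<Rightarrow> (real set \<Rightarrow> 'v::real_normed_vector) \<Rightarrow> real measure" where
  "total_variation a b q =
     measure_of (einterval a b) (sets (restrict_space borel (einterval a b)))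
       (\<lambda>A. SUP P \<in> {P. finite P \<and> disjoint P \<and> P \<subseteq> rc_borel a b \<and> \<Union>P \<subseteq> A}.
              \<Sum>B\<in>P. ennreal (norm (q B)))"

text \<open>For non-negative \<open>w\<close>, the extension of the set function \<open>tr w\<close> to a Borel measure on the
  whole interval.\<close>

definition tr_measure :: "ereal \<Rightarrow> ereal \<Rightarrow> (real set \<Rightarrow> complex^'n^'n) \<Rightarrow> real measure" where
  "tr_measure a b w =
     measure_of (einterval a b) (sets (restrict_space borel (einterval a b)))
       (\<lambda>A. SUP (c, d) \<in> {(c, d). {c..d} \<subseteq> einterval a b}.
              ennreal (Re (trace (w (A \<inter> {c..d})))))"

definition rn_density ::
  "ereal \<Rightarrow> ereal \<Rightarrow> real measure \<Rightarrow> (real set \<Rightarrow> complex^'n^'n) \<Rightarrow> real \<Rightarrow> complex^'n^'n" where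
  "rn_density a b M q =
     (SOME h. h \<in> borel_measurable M \<and>
        (\<forall>A\<in>rc_borel a b. set_integrable M A h \<and> q A = (LINT x:A|M. h x)))"

text \<open>The integral of \<open>f\<close> against the matrix measure \<open>q = dQ\<close> is defined through the polar
  decomposition of \<open>q\<close>; \<open>qf\<close> is the set function sending \<open>A\<close> to the integral over \<open>A\<close>.\<close>

definition q_times ::
  "ereal \<Rightarrow> ereal \<Rightarrow> (real set \<Rightarrow> complex^'n^'n) \<Rightarrow> (real \<Rightarrow> complex^'n) \<Rightarrow> real set \<Rightarrow> complex^'n"
  where
  "q_times a b q f A =
     (LINT x:A|total_variation a b q. rn_density a b (total_variation a b q) q x *v f x)"

definition w_density ::
  "ereal \<Rightarrow> ereal \<Rightarrow> (real set \<Rightarrow> complex^'n^'n) \<Rightarrow> real \<Rightarrow> complex^'n^'n" where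
  "w_density a b w = rn_density a b (tr_measure a b w) w"

definition w_times ::
  "ereal \<Rightarrow> ereal \<Rightarrow> (real set \<Rightarrow> complex^'n^'n) \<Rightarrow> (real \<Rightarrow> complex^'n) \<Rightarrow> real set \<Rightarrow> complex^'n"
  where
  "w_times a b w f A = (LINT x:A|tr_measure a b w. w_density a b w x *v f x)"

text \<open>\<open>Ju' + qu = r\<close> as an identity between distributions of order 0; \<open>p\<close> is \<open>u'\<close>, that is,
  the distribution with antiderivative \<open>u\<close>.\<close>

definition solves ::
  "ereal \<Rightarrow> ereal \<Rightarrow> complex^'n^'n \<Rightarrow> (real set \<Rightarrow> complex^'n^'n) \<Rightarrow>
   (real \<Rightarrow> complex^'n) \<Rightarrow> (real set \<Rightarrow> complex^'n) \<Rightarrow> bool" where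
  "solves a b J q u r \<longleftrightarrow>
     (\<exists>p. dist0 a b p \<and> antiderivative a b p u \<and>
        (\<forall>A\<in>rc_borel a b. J *v p A + q_times a b q u A = r A))"

section \<open>The space \<open>L\<^sup>2(w)\<close>\<close>

definition pre_L2 :: "ereal \<Rightarrow> ereal \<Rightarrow> (real set \<Rightarrow> complex^'n^'n) \<Rightarrow> (real \<Rightarrow> complex^'n) set" where
  "pre_L2 a b w =
     {f \<in> borel_measurable (tr_measure a b w).
        (\<integral>\<^sup>+x. ennreal (Re (cinner (f x) (w_density a b w x *v f x))) \<partial>tr_measure a b w) < \<infinity>}"

definition pre_inner ::
  "ereal \<Rightarrow> ereal \<Rightarrow> (real set \<Rightarrow> complex^'n^'n) \<Rightarrow>
   (real \<Rightarrow> complex^'n) \<Rightarrow> (real \<Rightarrow> complex^'n) \<Rightarrow> complex" where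
  "pre_inner a b w f g = (LINT x|tr_measure a b w. cinner (f x) (w_density a b w x *v g x))"

definition cls ::
  "ereal \<Rightarrow> ereal \<Rightarrow> (real set \<Rightarrow> complex^'n^'n) \<Rightarrow> (real \<Rightarrow> complex^'n) \<Rightarrow> (real \<Rightarrow> complex^'n) set"
  where
  "cls a b w f =
     {g \<in> pre_L2 a b w. pre_inner a b w (\<lambda>x. g x - f x) (\<lambda>x. g x - f x) = 0}"

definition L2 :: "ereal \<Rightarrow> ereal \<Rightarrow> (real set \<Rightarrow> complex^'n^'n) \<Rightarrow> (real \<Rightarrow> complex^'n) set set" where
  "L2 a b w = cls a b w ` pre_L2 a b w"

text \<open>The Hilbert space operations on classes, through arbitrary representatives.\<close>

definition rep :: "(real \<Rightarrow> complex^'n) set \<Rightarrow> real \<Rightarrow> complex^'n" where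
  "rep F = (SOME f. f \<in> F)"

definition L2_zero :: "ereal \<Rightarrow> ereal \<Rightarrow> (real set \<Rightarrow> complex^'n^'n) \<Rightarrow> (real \<Rightarrow> complex^'n) set" where
  "L2_zero a b w = cls a b w (\<lambda>x. 0)"

definition L2_add ::
  "ereal \<Rightarrow> ereal \<Rightarrow> (real set \<Rightarrow> complex^'n^'n) \<Rightarrow>
   (real \<Rightarrow> complex^'n) set \<Rightarrow> (real \<Rightarrow> complex^'n) set \<Rightarrow> (real \<Rightarrow> complex^'n) set" where
  "L2_add a b w F G = cls a b w (\<lambda>x. rep F x + rep G x)"

definition L2_scale ::
  "ereal \<Rightarrow> ereal \<Rightarrow> (real set \<Rightarrow> complex^'n^'n) \<Rightarrow>
   complex \<Rightarrow> (real \<Rightarrow> complex^'n) set \<Rightarrow> (real \<Rightarrow> complex^'n) set" where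
  "L2_scale a b w c F = cls a b w (\<lambda>x. c *s rep F x)"

definition L2_inner ::
  "ereal \<Rightarrow> ereal \<Rightarrow> (real set \<Rightarrow> complex^'n^'n) \<Rightarrow>
   (real \<Rightarrow> complex^'n) set \<Rightarrow> (real \<Rightarrow> complex^'n) set \<Rightarrow> complex" where
  "L2_inner a b w F G = pre_inner a b w (rep F) (rep G)"

section \<open>Linear relations\<close>

type_synonym 'n class_rel = "((real \<Rightarrow> complex^'n) set \<times> (real \<Rightarrow> complex^'n) set) set"

definition pre_T_max ::
  "ereal \<Rightarrow> ereal \<Rightarrow> complex^'n^'n \<Rightarrow> (real set \<Rightarrow> complex^'n^'n) \<Rightarrow> (real set \<Rightarrow> complex^'n^'n) \<Rightarrow>
   ((real \<Rightarrow> complex^'n) \<times> (real \<Rightarrow> complex^'n)) set" where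
  "pre_T_max a b J q w =
     {(u, f). u \<in> pre_L2 a b w \<and> f \<in> pre_L2 a b w \<and> bv_bal a b u \<and>
        solves a b J q u (w_times a b w f)}"

definition T_max ::
  "ereal \<Rightarrow> ereal \<Rightarrow> complex^'n^'n \<Rightarrow> (real set \<Rightarrow> complex^'n^'n) \<Rightarrow> (real set \<Rightarrow> complex^'n^'n) \<Rightarrow>
   'n class_rel" where
  "T_max a b J q w = {(cls a b w u, cls a b w f) | u f. (u, f) \<in> pre_T_max a b J q w}"

definition linear_relation ::
  "ereal \<Rightarrow> ereal \<Rightarrow> (real set \<Rightarrow> complex^'n^'n) \<Rightarrow> 'n class_rel \<Rightarrow> bool" where
  "linear_relation a b w T \<longleftrightarrow>
     T \<subseteq> L2 a b w \<times> L2 a b w \<and>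
     (L2_zero a b w, L2_zero a b w) \<in> T \<and>
     (\<forall>(U, F)\<in>T. \<forall>(V, G)\<in>T. (L2_add a b w U V, L2_add a b w F G) \<in> T) \<and>
     (\<forall>c. \<forall>(U, F)\<in>T. (L2_scale a b w c U, L2_scale a b w c F) \<in> T)"

definition rel_adjoint ::
  "ereal \<Rightarrow> ereal \<Rightarrow> (real set \<Rightarrow> complex^'n^'n) \<Rightarrow> 'n class_rel \<Rightarrow> 'n class_rel" where
  "rel_adjoint a b w T =
     {(V, G). V \<in> L2 a b w \<and> G \<in> L2 a b w \<and>
        (\<forall>(U, F)\<in>T. L2_inner a b w G U = L2_inner a b w V F)}"

definition self_adjoint_restriction ::
  "ereal \<Rightarrow> ereal \<Rightarrow> complex^'n^'n \<Rightarrow> (real set \<Rightarrow> complex^'n^'n) \<Rightarrow> (real set \<Rightarrow> complex^'n^'n) \<Rightarrow>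
   'n class_rel \<Rightarrow> bool" where
  "self_adjoint_restriction a b J q w T \<longleftrightarrow>
     linear_relation a b w T \<and> T \<subseteq> T_max a b J q w \<and> T = rel_adjoint a b w T"

text \<open>The relation \<open>T - z\<close>.\<close>

definition rel_shift ::
  "ereal \<Rightarrow> ereal \<Rightarrow> (real set \<Rightarrow> complex^'n^'n) \<Rightarrow> 'n class_rel \<Rightarrow> complex \<Rightarrow> 'n class_rel" where
  "rel_shift a b w T z = {(U, L2_add a b w F (L2_scale a b w (- z) U)) | U F. (U, F) \<in> T}"

definition resolvent_set ::
  "ereal \<Rightarrow> ereal \<Rightarrow> (real set \<Rightarrow> complex^'n^'n) \<Rightarrow> 'n class_rel \<Rightarrow> complex set" where
  "resolvent_set a b w T =
     {z. {U. (U, L2_zero a b w) \<in> rel_shift a b w T z} = {L2_zero a b w} \<and>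
         Range (rel_shift a b w T z) = L2 a b w}"

definition resolvent ::
  "ereal \<Rightarrow> ereal \<Rightarrow> (real set \<Rightarrow> complex^'n^'n) \<Rightarrow> 'n class_rel \<Rightarrow> complex \<Rightarrow>
   (real \<Rightarrow> complex^'n) set \<Rightarrow> (real \<Rightarrow> complex^'n) set" where
  "resolvent a b w T z F = (THE U. (U, F) \<in> rel_shift a b w T z)"

section \<open>The evaluation operator\<close>

definition sol_null ::
  "ereal \<Rightarrow> ereal \<Rightarrow> complex^'n^'n \<Rightarrow> (real set \<Rightarrow> complex^'n^'n) \<Rightarrow> (real set \<Rightarrow> complex^'n^'n) \<Rightarrow>
   (real \<Rightarrow> complex^'n) set" where
  "sol_null a b J q w =
     {u. bv_bal a b u \<and> solves a b J q u (\<lambda>A. 0) \<and> (\<forall>A\<in>rc_borel a b. w_times a b w u A = 0)}"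

definition init_null ::
  "ereal \<Rightarrow> ereal \<Rightarrow> complex^'n^'n \<Rightarrow> (real set \<Rightarrow> complex^'n^'n) \<Rightarrow> (real set \<Rightarrow> complex^'n^'n) \<Rightarrow>
   real \<Rightarrow> (complex^'n) set" where
  "init_null a b J q w x0 = {u x0 | u. u \<in> sol_null a b J q w}"

text \<open>Since functions on the interval are represented by total functions, the representative is
  normalized to vanish outside the interval in order to be unique.\<close>

definition eval_E ::
  "ereal \<Rightarrow> ereal \<Rightarrow> complex^'n^'n \<Rightarrow> (real set \<Rightarrow> complex^'n^'n) \<Rightarrow> (real set \<Rightarrow> complex^'n^'n) \<Rightarrow>
   real \<Rightarrow> (real \<Rightarrow> complex^'n) set \<Rightarrow> (real \<Rightarrow> complex^'n) set \<Rightarrow> real \<Rightarrow> complex^'n" where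
  "eval_E a b J q w x0 U F =
     (THE v. v \<in> U \<and> bv_bal a b v \<and> (\<exists>f\<in>F. solves a b J q v (w_times a b w f)) \<and>
        v x0 \<in> corth (init_null a b J q w x0) \<and> (\<forall>x. x \<notin> einterval a b \<longrightarrow> v x = 0))"

definition eval_E_res ::
  "ereal \<Rightarrow> ereal \<Rightarrow> complex^'n^'n \<Rightarrow> (real set \<Rightarrow> complex^'n^'n) \<Rightarrow> (real set \<Rightarrow> complex^'n^'n) \<Rightarrow>
   real \<Rightarrow> 'n class_rel \<Rightarrow> complex \<Rightarrow> (real \<Rightarrow> complex^'n) set \<Rightarrow> real \<Rightarrow> complex^'n" where
  "eval_E_res a b J q w x0 T z F =
     eval_E a b J q w x0 (resolvent a b w T z F)
       (L2_add a b w (L2_scale a b w z (resolvent a b w T z F)) F)"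

end

theory Submission
  imports Defs "HOL-Library.Function_Algebras"
begin

text \<open>For fixed \<open>x\<close> and \<open>z\<close>, the map \<open>f \<mapsto> (E\<^sub>z f)(x)\<close> is linear from \<open>L\<^sup>2(w)\<close> to \<open>\<complex>\<^sup>n\<close>. If it is bounded, the
  Riesz representation theorem gives for each component a representing element of \<open>L\<^sup>2(w)\<close>, and the conjugates
  of these elements are the rows of \<open>G(x, \<cdot>, z)\<close>. The proof therefore consists in showing that \<open>L\<^sup>2(w)\<close> is
  complete (\<open>wspace_complete\<close>) and that the map is bounded. The latter combines two bounds.

  The first one bounds the resolvent. For non-real \<open>z\<close> it is the usual consequence of symmetry. For real \<open>z\<close>
  the resolvent is a symmetric operator that is defined everywhere, and the Hellinger--Toeplitz theorem applies
  (\<open>resolvent_bounded\<close>).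

  The second one bounds the evaluation \<open>u \<mapsto> u(x)\<close> of solutions of \<open>Ju' + qu = wf\<close> with \<open>u(x\<^sub>0) \<in> N\<^sub>0\<^sup>\<bottom>\<close> by
  the norms of \<open>u\<close> and \<open>f\<close> (\<open>evaluation_bound\<close>). On a compact interval the values of a solution at any two
  points bound each other, up to the size of the right-hand side (\<open>sol_bound\<close>). Locally this is a Gronwall
  argument: the coefficient \<open>q\<close> has small mass on a small punctured neighbourhood of a point, and across
  the point itself the value can be transported in both directions because \<open>2J \<plusminus> \<Delta>\<^sub>q\<close> is invertible. It
  remains to bound the value at \<open>x\<^sub>0\<close>, by compactness. A sequence of solutions with \<open>|u\<^sub>k(x\<^sub>0)| = 1\<close> and with \<open>u\<^sub>k\<close>
  and \<open>f\<^sub>k\<close> tending to zero in norm has a subsequence that converges pointwise, and its limit solves the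
  homogeneous equation and is annihilated by \<open>w\<close>. The value of the limit at \<open>x\<^sub>0\<close> then lies in \<open>N\<^sub>0\<close> and in \<open>N\<^sub>0\<^sup>\<bottom>\<close>
  and has norm one, which is impossible (\<open>evaluation_bound_at_x0\<close>).

  The measures behind these arguments have to be constructed first: the total variation of \<open>q\<close> and the
  measure \<open>tr w\<close> are defined by suprema, and their being measures, their finiteness on compact sets
  (\<open>tv_finite\<close>) and the existence of densities (\<open>density_exists\<close>) are theorems. A solution is then handled through
  one formula for its increments (\<open>bal_prim\<close>), in which no one-sided limits occur.\<close>

section \<open>Semi-inner product spaces\<close>

text \<open>Vectors of norm zero are allowed, and limits are only determined up to them. A space of
  functions with a weighted \<open>L\<^sup>2\<close> form is then a Hilbert space without passing to classes, and pointwise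
  arguments stay available for its elements.\<close>

locale semi_inner_space = vector_space scale
  for scale :: "complex \<Rightarrow> 'v::ab_group_add \<Rightarrow> 'v" +
  fixes V :: "'v set" and ip :: "'v \<Rightarrow> 'v \<Rightarrow> complex"
  assumes subspace_V: "subspace V"
    and ip_add_right: "x \<in> V \<Longrightarrow> y \<in> V \<Longrightarrow> z \<in> V \<Longrightarrow> ip x (y + z) = ip x y + ip x z"
    and ip_scale_right: "x \<in> V \<Longrightarrow> y \<in> V \<Longrightarrow> ip x (scale c y) = c * ip x y"
    and ip_commute: "x \<in> V \<Longrightarrow> y \<in> V \<Longrightarrow> ip y x = cnj (ip x y)"
    and ip_nonneg: "x \<in> V \<Longrightarrow> 0 \<le> Re (ip x x)"
begin

definition nrm :: "'v \<Rightarrow> real" where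
  "nrm x = sqrt (Re (ip x x))"

lemma V_closed [simp, intro]:
  "0 \<in> V" "x \<in> V \<Longrightarrow> y \<in> V \<Longrightarrow> x + y \<in> V" "x \<in> V \<Longrightarrow> y \<in> V \<Longrightarrow> x - y \<in> V"
  "x \<in> V \<Longrightarrow> scale c x \<in> V"
  using subspace_V by (auto intro: subspace_0 subspace_add subspace_diff subspace_scale)

lemma ip_diff_right:
  assumes "x \<in> V" "y \<in> V" "z \<in> V"
  shows "ip x (y - z) = ip x y - ip x z"
  using ip_add_right[of x "y - z" z] assms by simp

lemma ip_add_left:
  assumes "x \<in> V" "y \<in> V" "z \<in> V"
  shows "ip (x + y) z = ip x z + ip y z"
  using ip_commute[of z "x + y"] ip_commute[of z x] ip_commute[of z y] ip_add_right[of z x y] assms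
  by simp

lemma ip_diff_left:
  assumes "x \<in> V" "y \<in> V" "z \<in> V"
  shows "ip (x - y) z = ip x z - ip y z"
  using ip_commute[of z "x - y"] ip_commute[of z x] ip_commute[of z y] ip_diff_right[of z x y] assms
  by simp

lemma ip_scale_left:
  assumes "x \<in> V" "z \<in> V"
  shows "ip (scale c x) z = cnj c * ip x z"
  using ip_commute[of z "scale c x"] ip_commute[of z x] ip_scale_right[of z x c] assms
  by simp

lemma ip_self_real: "x \<in> V \<Longrightarrow> ip x x = of_real ((nrm x)\<^sup>2)"
  using ip_commute[of x x] ip_nonneg[of x] by (auto simp: complex_eq_iff nrm_def)

lemma nrm_sq: "x \<in> V \<Longrightarrow> (nrm x)\<^sup>2 = Re (ip x x)"
  using ip_nonneg[of x] by (simp add: nrm_def)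

lemma nrm_nonneg [simp]: "x \<in> V \<Longrightarrow> 0 \<le> nrm x"
  by (simp add: nrm_def ip_nonneg)

lemma nrm_add_sq:
  assumes "x \<in> V" "y \<in> V"
  shows "(nrm (x + y))\<^sup>2 = (nrm x)\<^sup>2 + 2 * Re (ip x y) + (nrm y)\<^sup>2"
proof -
  have "ip (x + y) (x + y) = ip x x + ip x y + ip y x + ip y y"
    using assms by (simp add: ip_add_right ip_add_left)
  then show ?thesis
    using assms ip_commute[of x y] by (simp add: nrm_sq)
qed

lemma nrm_scale: "x \<in> V \<Longrightarrow> nrm (scale c x) = cmod c * nrm x"
proof -
  assume x: "x \<in> V"
  have "(nrm (scale c x))\<^sup>2 = Re ((c * cnj c) * ip x x)"
    using x by (simp add: nrm_sq ip_scale_left ip_scale_right mult.commute mult.left_commute)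
  also have "\<dots> = (cmod c * nrm x)\<^sup>2"
    using x by (simp add: ip_self_real complex_norm_square[symmetric] power_mult_distrib flip: of_real_power of_real_mult)
  finally show ?thesis
    using x by (simp add: power2_eq_iff_nonneg)
qed

lemma nrm_diff_sq:
  assumes "x \<in> V" "y \<in> V"
  shows "(nrm (x - y))\<^sup>2 = (nrm x)\<^sup>2 - 2 * Re (ip x y) + (nrm y)\<^sup>2"
  using nrm_add_sq[OF assms(1) V_closed(4)[OF assms(2), of "-1"]] assms
    nrm_scale[of y "-1"] ip_scale_right[of x y "-1"]
  by simp

lemma Cauchy_Schwarz:
  assumes "x \<in> V" "y \<in> V"
  shows "cmod (ip x y) \<le> nrm x * nrm y"
proof -
  define B where "B = (cmod (ip x y))\<^sup>2"
  have *: "0 \<le> (nrm x)\<^sup>2 - 2 * s * B + s\<^sup>2 * B * (nrm y)\<^sup>2" for s :: real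
  proof -
    define t where "t = complex_of_real (-s) * cnj (ip x y)"
    have "Re (t * ip x y) = - s * B"
      unfolding B_def cmod_power2 t_def by (simp add: power2_eq_square algebra_simps)
    moreover have "(cmod t * nrm y)\<^sup>2 = s\<^sup>2 * B * (nrm y)\<^sup>2"
      by (simp add: t_def norm_mult power_mult_distrib B_def)
    ultimately have "(nrm (x + scale t y))\<^sup>2 = (nrm x)\<^sup>2 - 2 * s * B + s\<^sup>2 * B * (nrm y)\<^sup>2"
      using nrm_add_sq[of x "scale t y"] assms by (simp add: ip_scale_right nrm_scale)
    then show ?thesis
      by (metis zero_le_power2)
  qed
  have "B \<le> (nrm x * nrm y)\<^sup>2"
  proof (cases "nrm y = 0")
    case True
    show ?thesis
    proof (rule ccontr)
      assume "\<not> ?thesis"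
      then have B: "B > 0" using True by simp
      define X where "X = (nrm x)\<^sup>2"
      define s where "s = (X + 1) / B"
      have X: "X \<ge> 0" by (simp add: X_def)
      have sB: "s * B = X + 1" using B by (simp add: s_def)
      have "0 \<le> X - 2 * (s * B)"
        using *[of s] True by (simp add: X_def mult.assoc)
      then show False
        unfolding sB using X by (simp add: algebra_simps)
    qed
  next
    case False
    define Y where "Y = (nrm y)\<^sup>2"
    have Y: "Y > 0" using False by (simp add: Y_def)
    have "(1 / Y)\<^sup>2 * B * Y = B / Y"
      using Y by (simp add: power2_eq_square)
    then have "0 \<le> (nrm x)\<^sup>2 - B / Y"
      using *[of "1 / Y"] by (simp add: Y_def[symmetric])
    then have "B \<le> (nrm x)\<^sup>2 * Y"
      using Y by (simp add: divide_le_eq)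
    then show ?thesis
      by (simp add: Y_def power_mult_distrib)
  qed
  then show ?thesis
    unfolding B_def by (rule power2_le_imp_le) (use assms in auto)
qed

lemma nrm_triangle:
  assumes "x \<in> V" "y \<in> V"
  shows "nrm (x + y) \<le> nrm x + nrm y"
proof (rule power2_le_imp_le)
  have "Re (ip x y) \<le> nrm x * nrm y"
    using Cauchy_Schwarz[OF assms] complex_Re_le_cmod order_trans by blast
  then show "(nrm (x + y))\<^sup>2 \<le> (nrm x + nrm y)\<^sup>2"
    using nrm_add_sq[OF assms] by (simp add: power2_eq_square algebra_simps)
qed (use assms in auto)

lemma nrm_minus_commute: "x \<in> V \<Longrightarrow> y \<in> V \<Longrightarrow> nrm (x - y) = nrm (y - x)"
  using nrm_scale[of "x - y" "-1"] by simp

lemma nrm_zero [simp]: "nrm 0 = 0"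
  using nrm_scale[of 0 0] by simp

lemma nrm_triangle_diff:
  assumes "x \<in> V" "y \<in> V" "z \<in> V"
  shows "nrm (x - z) \<le> nrm (x - y) + nrm (y - z)"
  using nrm_triangle[of "x - y" "y - z"] assms by simp

lemma ip_tendsto_right:
  assumes "h \<in> V" "x \<in> V" "\<And>k::nat. X k \<in> V" "(\<lambda>k. nrm (X k - x)) \<longlonglongrightarrow> 0"
  shows "(\<lambda>k. ip h (X k)) \<longlonglongrightarrow> ip h x"
proof -
  have "(\<lambda>k. ip h (X k - x)) \<longlonglongrightarrow> 0"
  proof (rule Lim_null_comparison)
    show "\<forall>\<^sub>F k in sequentially. cmod (ip h (X k - x)) \<le> nrm h * nrm (X k - x)"
      by (rule always_eventually) (use Cauchy_Schwarz assms in blast)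
    show "(\<lambda>k. nrm h * nrm (X k - x)) \<longlonglongrightarrow> 0"
      by (rule tendsto_mult_right_zero) (rule assms)
  qed
  then have "(\<lambda>k. ip h (X k - x) + ip h x) \<longlonglongrightarrow> 0 + ip h x"
    by (intro tendsto_intros)
  then show ?thesis
    using assms by (simp add: ip_diff_right)
qed

end

locale semi_hilbert = semi_inner_space +
  assumes complete:
    "\<lbrakk>\<And>k::nat. X k \<in> V; \<And>e. e > 0 \<Longrightarrow> \<exists>N. \<forall>m\<ge>N. \<forall>k\<ge>N. nrm (X m - X k) < e\<rbrakk>
       \<Longrightarrow> \<exists>x\<in>V. (\<lambda>k. nrm (X k - x)) \<longlonglongrightarrow> 0"
begin

text \<open>The representing vector is the minimizer of \<open>\<parallel>x\<parallel>\<^sup>2 - 2 Re \<phi>(x)\<close>, a functional that is bounded below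
  because \<open>\<phi>\<close> is bounded; at a minimizer all directional derivatives vanish.\<close>

theorem Riesz_representation:
  assumes add: "\<And>x y. x \<in> V \<Longrightarrow> y \<in> V \<Longrightarrow> \<phi> (x + y) = \<phi> x + \<phi> y"
    and scale: "\<And>c x. x \<in> V \<Longrightarrow> \<phi> (scale c x) = c * \<phi> x"
    and bound: "\<And>x. x \<in> V \<Longrightarrow> cmod (\<phi> x) \<le> C * nrm x"
  shows "\<exists>g\<in>V. \<forall>x\<in>V. \<phi> x = ip g x"
proof -
  define F where "F x = (nrm x)\<^sup>2 - 2 * Re (\<phi> x)" for x
  have F_lower: "- (C\<^sup>2) \<le> F x" if "x \<in> V" for x
  proof -
    have "Re (\<phi> x) \<le> C * nrm x"
      using bound[OF that] complex_Re_le_cmod order_trans by blast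
    moreover have "0 \<le> (nrm x - C)\<^sup>2" by simp
    ultimately show ?thesis
      unfolding F_def by (simp add: power2_eq_square algebra_simps)
  qed
  define m where "m = Inf (F ` V)"
  have bdd: "bdd_below (F ` V)"
    using F_lower by (auto intro!: bdd_belowI2)
  have m_le: "m \<le> F x" if "x \<in> V" for x
    unfolding m_def using bdd that by (intro cInf_lower) auto
  have "\<exists>x\<in>V. F x < m + 1 / real (Suc k)" for k
  proof -
    have "\<exists>y\<in>F ` V. y < m + 1 / real (Suc k)"
      unfolding m_def by (rule cInf_lessD) (auto intro: V_closed)
    then show ?thesis by auto
  qed
  then obtain X where X: "\<And>k. X k \<in> V" "\<And>k. F (X k) < m + 1 / real (Suc k)"
    by metis
  \<comment> \<open>The parallelogram law turns an almost minimal pair into a pair at small distance.\<close>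
  have par: "(nrm (x - y))\<^sup>2 \<le> 2 * F x + 2 * F y - 4 * m" if "x \<in> V" "y \<in> V" for x y
  proof -
    let ?z = "scale (1/2) (x + y)"
    have z: "?z \<in> V" using that by auto
    have "F ?z = (nrm (x + y))\<^sup>2 / 4 - Re (\<phi> x) - Re (\<phi> y)"
      unfolding F_def using that by (simp add: nrm_scale scale add power_divide norm_divide add_divide_distrib diff_divide_distrib)
    then have "(nrm (x - y))\<^sup>2 = 2 * F x + 2 * F y - 4 * F ?z"
      unfolding F_def using nrm_add_sq[OF that] nrm_diff_sq[OF that] by (simp add: field_simps)
    then show ?thesis
      using m_le[OF z] by simp
  qed
  have "\<exists>N. \<forall>j\<ge>N. \<forall>k\<ge>N. nrm (X j - X k) < e" if "e > 0" for e
  proof -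
    have "e\<^sup>2 > 0" using that by simp
    then obtain N where N: "inverse (real (Suc N)) < e\<^sup>2 / 4"
      using reals_Archimedean[of "e\<^sup>2 / 4"] by auto
    have "nrm (X j - X k) < e" if "j \<ge> N" "k \<ge> N" for j k
    proof -
      have "1 / real (Suc j) \<le> inverse (real (Suc N))" "1 / real (Suc k) \<le> inverse (real (Suc N))"
        using that by (auto simp: field_simps)
      then have "(nrm (X j - X k))\<^sup>2 < e\<^sup>2"
        using par[OF X(1)[of j] X(1)[of k]] X(2)[of j] X(2)[of k] N by linarith
      then show ?thesis
        by (rule power2_less_imp_less) (use \<open>e > 0\<close> in auto)
    qed
    then show ?thesis by blast
  qed
  then obtain g where g: "g \<in> V" "(\<lambda>k. nrm (X k - g)) \<longlonglongrightarrow> 0"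
    using complete[of X] X(1) by blast
  have "Re (\<phi> h) = Re (ip g h)" if h: "h \<in> V" for h
  proof -
    have ineq: "0 \<le> 2 * t * (Re (ip g h) - Re (\<phi> h)) + t\<^sup>2 * (nrm h)\<^sup>2" for t :: real
    proof -
      let ?t = "complex_of_real t"
      have "F (X k + scale ?t h) = F (X k) + 2 * t * (Re (ip (X k) h) - Re (\<phi> h)) + t\<^sup>2 * (nrm h)\<^sup>2" for k
        unfolding F_def using X(1)[of k] h
        by (simp add: nrm_add_sq nrm_scale power_mult_distrib ip_scale_right add scale algebra_simps)
      then have 1: "- (1 / real (Suc k)) \<le> 2 * t * (Re (ip (X k) h) - Re (\<phi> h)) + t\<^sup>2 * (nrm h)\<^sup>2" for k
        using m_le[of "X k + scale ?t h"] X(1)[of k] X(2)[of k] h by fastforce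
      have "(\<lambda>k. ip h (X k)) \<longlonglongrightarrow> ip h g"
        by (rule ip_tendsto_right) (use g X h in auto)
      then have 2: "(\<lambda>k. cnj (ip h (X k))) \<longlonglongrightarrow> cnj (ip h g)"
        by (intro tendsto_intros)
      have 3: "(\<lambda>k. ip (X k) h) \<longlonglongrightarrow> ip g h"
        using 2 ip_commute[OF h g(1)] ip_commute[OF h X(1)] by simp
      have 4: "(\<lambda>k. - (1 / real (Suc k))) \<longlonglongrightarrow> - 0"
        by (intro tendsto_intros) (use LIMSEQ_inverse_real_of_nat in \<open>simp add: inverse_eq_divide\<close>)
      have "(\<lambda>k. 2 * t * (Re (ip (X k) h) - Re (\<phi> h)) + t\<^sup>2 * (nrm h)\<^sup>2) \<longlonglongrightarrow>
         2 * t * (Re (ip g h) - Re (\<phi> h)) + t\<^sup>2 * (nrm h)\<^sup>2"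
        by (intro tendsto_intros 3)
      from LIMSEQ_le[OF 4 this] 1 show ?thesis by auto
    qed
    \<comment> \<open>The choice of \<open>t\<close> below makes a non-zero linear term dominate.\<close>
    define d where "d = Re (ip g h) - Re (\<phi> h)"
    define B where "B = (nrm h)\<^sup>2 + 1"
    have B: "B > 0" "(nrm h)\<^sup>2 \<le> B" unfolding B_def by (auto intro: add_nonneg_pos)
    have "0 \<le> 2 * (- d / B) * d + (- d / B)\<^sup>2 * (nrm h)\<^sup>2"
      using ineq[of "- d / B"] unfolding d_def .
    also have "\<dots> \<le> 2 * (- d / B) * d + (- d / B)\<^sup>2 * B"
      using B by (intro add_left_mono mult_left_mono) auto
    also have "\<dots> = - (d\<^sup>2 / B)"
      using B by (simp add: power2_eq_square field_simps)
    finally have "d\<^sup>2 / B \<le> 0" by simp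
    then have "d = 0" using B by (simp add: divide_le_0_iff)
    then show ?thesis by (simp add: d_def)
  qed note re = this
  have "\<phi> h = ip g h" if h: "h \<in> V" for h
  proof (rule complex_eqI)
    show "Re (\<phi> h) = Re (ip g h)" using re h .
    have "Re (\<phi> (scale (- \<i>) h)) = Re (ip g (scale (- \<i>) h))"
      by (rule re) (use h in blast)
    then show "Im (\<phi> h) = Im (ip g h)"
      using scale[OF h, of "-\<i>"] ip_scale_right[OF g(1) h, of "-\<i>"] by simp
  qed
  then show ?thesis using g by auto
qed

text \<open>A gliding hump. If \<open>\<parallel>h\<^sub>k\<parallel> > 4\<^sup>k\<close>, then from \<open>x\<^sub>k\<close> one moves by a multiple \<open>\<plusminus>y\<^sub>k\<close> of \<open>h\<^sub>k\<close> with
  \<open>\<parallel>y\<^sub>k\<parallel> = 3\<^sup>-\<^sup>k\<close>; one of the two signs gives a point where the pairing with \<open>h\<^sub>k\<close> is at least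
  \<open>3\<^sup>-\<^sup>k \<parallel>h\<^sub>k\<parallel>\<close>. All later moves together have length at most \<open>3\<^sup>-\<^sup>k / 2\<close>, so half of this value survives
  in the limit, and it is unbounded in \<open>k\<close>.\<close>

theorem uniform_boundedness:
  assumes H: "H \<subseteq> V" and pw: "\<And>g. g \<in> V \<Longrightarrow> \<exists>B. \<forall>h\<in>H. cmod (ip h g) \<le> B"
  shows "\<exists>C. \<forall>h\<in>H. nrm h \<le> C"
proof (rule ccontr)
  assume "\<not> ?thesis"
  then have "\<exists>h\<in>H. 4 ^ k < nrm h" for k :: nat
    by (meson not_le)
  then obtain h where h: "\<And>k. h k \<in> H" "\<And>k::nat. 4 ^ k < nrm (h k)"
    by metis
  have hV: "h k \<in> V" for k using h(1) H by auto
  have hpos: "nrm (h k) > 0" for k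
    using h(2)[of k] by (smt (verit) zero_less_power)
  define r :: "nat \<Rightarrow> real" where "r k = (1/3) ^ k" for k
  define y where "y k = scale (of_real (r k / nrm (h k))) (h k)" for k
  have yV: "y k \<in> V" for k unfolding y_def using hV by auto
  have ny: "nrm (y k) = r k" for k
    unfolding y_def using hpos[of k] hV by (simp add: nrm_scale r_def norm_divide norm_power)
  have ipy: "ip (h k) (y k) = of_real (r k * nrm (h k))" for k
    unfolding y_def using hpos[of k] hV[of k]
    by (simp add: ip_scale_right ip_self_real power2_eq_square)
  define x where "x = rec_nat 0 (\<lambda>k z. if r k * nrm (h k) \<le> cmod (ip (h k) (z + y k)) then z + y k else z - y k)"
  have x_Suc: "x (Suc k) = (if r k * nrm (h k) \<le> cmod (ip (h k) (x k + y k)) then x k + y k else x k - y k)" for k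
    unfolding x_def by simp
  have xV: "x k \<in> V" for k
  proof (induction k)
    case 0 show ?case by (simp add: x_def)
  next
    case (Suc k) then show ?case unfolding x_Suc using yV[of k] by auto
  qed
  have step: "nrm (x (Suc k) - x k) = r k" for k
    using ny[of k] nrm_scale[OF yV[of k], of "-1"] by (simp add: x_Suc)
  have big: "r k * nrm (h k) \<le> cmod (ip (h k) (x (Suc k)))" for k
  proof (cases "r k * nrm (h k) \<le> cmod (ip (h k) (x k + y k))")
    case True then show ?thesis by (simp add: x_Suc)
  next
    case False
    have "2 * of_real (r k * nrm (h k)) = ip (h k) (x k + y k) - ip (h k) (x k - y k)"
      using hV xV yV by (simp add: ip_add_right ip_diff_right ipy)
    then have "cmod (2 * of_real (r k * nrm (h k))) \<le> cmod (ip (h k) (x k + y k)) + cmod (ip (h k) (x k - y k))"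
      by (metis norm_triangle_ineq4)
    moreover have "cmod (2 * of_real (r k * nrm (h k))) = 2 * (r k * nrm (h k))"
      using hpos[of k] by (simp add: norm_mult norm_power r_def)
    ultimately show ?thesis using False by (simp add: x_Suc)
  qed
  have tail: "nrm (x (k + j) - x k) \<le> (3/2) * (r k - r (k + j))" for k j
  proof (induction j)
    case 0 show ?case by simp
  next
    case (Suc j)
    have "nrm (x (k + Suc j) - x k) \<le> nrm (x (Suc (k + j)) - x (k + j)) + nrm (x (k + j) - x k)"
      using nrm_triangle_diff[of "x (k + Suc j)" "x (k + j)" "x k"] xV by simp
    also have "\<dots> \<le> r (k + j) + (3/2) * (r k - r (k + j))"
      using Suc step by simp
    also have "\<dots> = (3/2) * (r k - r (k + Suc j))"
      by (simp add: r_def algebra_simps)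
    finally show ?case .
  qed
  have tail': "nrm (x m - x k) \<le> (3/2) * r k" if "k \<le> m" for k m
  proof -
    have "0 \<le> r m" by (simp add: r_def)
    then show ?thesis
      using tail[of k "m - k"] that by simp
  qed
  have r0: "r \<longlonglongrightarrow> 0"
    unfolding r_def by (rule LIMSEQ_power_zero) simp
  have "\<exists>N. \<forall>j\<ge>N. \<forall>k\<ge>N. nrm (x j - x k) < e" if "e > 0" for e
  proof -
    from that have "e / 3 > 0" by simp
    then obtain N where N: "r N < e / 3"
      using order_tendstoD(2)[OF r0] by (meson eventually_sequentially order_refl)
    have "nrm (x j - x k) < e" if "j \<ge> N" "k \<ge> N" for j k
      using nrm_triangle_diff[OF xV[of j] xV[of N] xV[of k]] tail'[of N j] tail'[of N k] that N
        nrm_minus_commute[OF xV xV, of N k] by linarith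
    then show ?thesis by blast
  qed
  then obtain z where z: "z \<in> V" "(\<lambda>k. nrm (x k - z)) \<longlonglongrightarrow> 0"
    using complete[of x] xV by blast
  have near: "nrm (x k - z) \<le> (3/2) * r k" for k
  proof -
    have "(\<lambda>m. (3/2) * r k + nrm (x m - z)) \<longlonglongrightarrow> (3/2) * r k + 0"
      by (intro tendsto_intros z)
    moreover have "\<forall>\<^sub>F m in sequentially. nrm (x k - z) \<le> (3/2) * r k + nrm (x m - z)"
      using eventually_ge_at_top[of k]
    proof eventually_elim
      case (elim m)
      show ?case
        using nrm_triangle_diff[of "x k" "x m" z] xV z(1) tail'[OF elim] nrm_minus_commute[OF xV xV, of k m]
        by simp
    qed
    ultimately show ?thesis
      using tendsto_lowerbound[of _ "(3/2) * r k + 0" sequentially "nrm (x k - z)"] by simp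
  qed
  obtain B where B: "\<And>k. cmod (ip (h k) z) \<le> B"
    using pw[OF z(1)] h(1) by blast
  have "(4/3) ^ k / 2 \<le> B" for k
  proof -
    have "ip (h k) (x (Suc k)) = ip (h k) z + ip (h k) (x (Suc k) - z)"
      using hV xV z by (simp add: ip_diff_right)
    then have "r k * nrm (h k) \<le> cmod (ip (h k) z) + cmod (ip (h k) (x (Suc k) - z))"
      using big[of k] norm_triangle_ineq by (metis order_trans)
    also have "\<dots> \<le> B + nrm (h k) * ((3/2) * r (Suc k))"
    proof (rule add_mono)
      have "cmod (ip (h k) (x (Suc k) - z)) \<le> nrm (h k) * nrm (x (Suc k) - z)"
        using hV xV z by (intro Cauchy_Schwarz) auto
      also have "\<dots> \<le> nrm (h k) * ((3/2) * r (Suc k))"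
        using near hpos[of k] by (intro mult_left_mono) auto
      finally show "cmod (ip (h k) (x (Suc k) - z)) \<le> nrm (h k) * ((3/2) * r (Suc k))" .
    qed (rule B)
    also have "\<dots> = B + r k * nrm (h k) / 2"
      by (simp add: r_def)
    finally have "r k * nrm (h k) / 2 \<le> B" by simp
    moreover have "(4/3) ^ k = r k * 4 ^ k"
      by (simp add: r_def power_divide)
    moreover have "r k * 4 ^ k \<le> r k * nrm (h k)"
      using h(2)[of k] by (intro mult_left_mono) (auto simp: r_def)
    ultimately show ?thesis by linarith
  qed
  moreover obtain k where "2 * B < (4/3) ^ k"
    using real_arch_pow[of "4/3" "2 * B"] by auto
  ultimately show False
    by (metis (no_types) not_le mult.commute divide_le_eq_numeral1(1))
qed

text \<open>By symmetry, the images of the unit vectors form a pointwise bounded family of functionals.\<close>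

theorem Hellinger_Toeplitz:
  assumes R: "\<And>f. f \<in> V \<Longrightarrow> R f \<in> V"
    and sym: "\<And>f g. f \<in> V \<Longrightarrow> g \<in> V \<Longrightarrow> ip (R f) g = ip f (R g)"
  shows "\<exists>C. \<forall>f\<in>V. nrm (R f) \<le> C * nrm f"
proof -
  define H where "H = {scale (of_real (1 / nrm f)) (R f) | f. f \<in> V \<and> nrm f > 0}"
  have HV: "H \<subseteq> V"
    unfolding H_def using R by auto
  have pw: "\<exists>B. \<forall>h\<in>H. cmod (ip h g) \<le> B" if g: "g \<in> V" for g
  proof -
    have "cmod (ip h g) \<le> nrm (R g)" if "h \<in> H" for h
    proof -
      obtain f where f: "f \<in> V" "nrm f > 0" "h = scale (of_real (1 / nrm f)) (R f)"
        using \<open>h \<in> H\<close> unfolding H_def by auto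
      have "cmod (ip h g) = cmod (ip f (R g)) / nrm f"
        using f g R by (simp add: ip_scale_left sym norm_divide)
      also have "\<dots> \<le> nrm (R g)"
        using f Cauchy_Schwarz[OF f(1) R[OF g]] by (simp add: divide_le_eq mult.commute)
      finally show ?thesis .
    qed
    then show ?thesis by blast
  qed
  from uniform_boundedness[OF HV pw] obtain C where "\<forall>h\<in>H. nrm h \<le> C" ..
  then have C: "nrm h \<le> C" if "h \<in> H" for h using that by simp
  have "nrm (R f) \<le> C * nrm f" if f: "f \<in> V" for f
  proof (cases "nrm f = 0")
    case True
    have "(nrm (R f))\<^sup>2 = Re (ip f (R (R f)))"
      using f R by (simp add: nrm_sq sym)
    also have "\<dots> \<le> cmod (ip f (R (R f)))" by (rule complex_Re_le_cmod)
    also have "\<dots> \<le> nrm f * nrm (R (R f))"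
      using Cauchy_Schwarz f R by blast
    finally show ?thesis using True by simp
  next
    case False
    then have pos: "nrm f > 0" using f by (simp add: less_le)
    then have "nrm (scale (of_real (1 / nrm f)) (R f)) \<le> C"
      using f by (intro C) (auto simp: H_def)
    then show ?thesis
      using pos R[OF f] by (simp add: nrm_scale norm_divide field_simps)
  qed
  then show ?thesis by blast
qed

end

section \<open>Positive semidefinite matrices\<close>

lemma cinner_add_right: "cinner x (y + z) = cinner x y + cinner x z"
  by (simp add: cinner_def algebra_simps sum.distrib)

lemma cinner_add_left: "cinner (x + y) z = cinner x z + cinner y z"
  by (simp add: cinner_def algebra_simps sum.distrib)

lemma cinner_diff_right: "cinner x (y - z) = cinner x y - cinner x z"
  by (simp add: cinner_def algebra_simps sum_subtractf)

lemma cinner_diff_left: "cinner (x - y) z = cinner x z - cinner y z"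
  by (simp add: cinner_def algebra_simps sum_subtractf)

lemma cinner_scale_right: "cinner x (c *s y) = c * cinner x y"
  by (simp add: cinner_def algebra_simps sum_distrib_left)

lemma cinner_scale_left: "cinner (c *s x) y = cnj c * cinner x y"
  by (simp add: cinner_def algebra_simps sum_distrib_left)

lemma cinner_commute: "cinner y x = cnj (cinner x y)"
  by (simp add: cinner_def mult.commute)

lemma cinner_zero [simp]: "cinner 0 x = 0" "cinner x 0 = 0"
  by (simp_all add: cinner_def)

lemma inner_eq_cinner: "x \<bullet> y = Re (cinner x y)"
  by (simp add: inner_vec_def cinner_def inner_complex_def)

lemma norm_sq_cinner: "(norm x)\<^sup>2 = Re (cinner x x)"
  by (simp add: power2_norm_eq_inner inner_eq_cinner)

lemma scaleR_eq_scale: "r *\<^sub>R x = complex_of_real r *s (x :: complex^'n)"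
  by (simp add: vec_eq_iff) (simp add: scaleR_conv_of_real)

lemma vec_norm_scale: "norm (c *s x) = cmod c * norm (x :: complex^'n)"
proof -
  have "(norm (c *s x))\<^sup>2 = Re ((c * cnj c) * cinner x x)"
    by (simp add: norm_sq_cinner cinner_scale_left cinner_scale_right mult_ac)
  also have "c * cnj c = of_real ((cmod c)\<^sup>2)"
    by (rule complex_norm_square[symmetric])
  also have "Re (of_real ((cmod c)\<^sup>2) * cinner x x) = (cmod c)\<^sup>2 * Re (cinner x x)"
    by (simp only: Re_complex_of_real Im_complex_of_real times_complex.simps mult_zero_left diff_zero)
  also have "\<dots> = (cmod c * norm x)\<^sup>2"
    by (simp add: power_mult_distrib norm_sq_cinner)
  finally show ?thesis by (simp add: power2_eq_iff_nonneg)
qed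

lemma norm_matrix_vector_le: "norm (A *v x) \<le> norm A * norm (x :: complex^'n)"
proof -
  have "norm ((A *v x) $ i) \<le> norm (A $ i) * norm x" for i
  proof -
    have "norm ((A *v x) $ i) \<le> (\<Sum>j\<in>UNIV. \<bar>norm (A $ i $ j)\<bar> * \<bar>norm (x $ j)\<bar>)"
      unfolding matrix_vector_mult_def by (auto intro!: sum_norm_le simp: norm_mult)
    also have "\<dots> \<le> norm (A $ i) * norm x"
      unfolding norm_vec_def by (rule L2_set_mult_ineq)
    finally show ?thesis .
  qed
  then have "norm (A *v x) \<le> L2_set (\<lambda>i. norm (A $ i) * norm x) UNIV"
    unfolding norm_vec_def[of "A *v x"] by (intro L2_set_mono) auto
  also have "\<dots> = norm A * norm x"
    unfolding norm_vec_def[of A] by (simp add: L2_set_left_distrib)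
  finally show ?thesis .
qed

lemma bounded_bilinear_matrix_vector:
  "bounded_bilinear ((*v) :: complex^'n^'m \<Rightarrow> complex^'n \<Rightarrow> complex^'m)"
proof
  show "\<exists>K. \<forall>(A :: complex^'n^'m) x. norm (A *v x) \<le> norm A * norm x * K"
    using norm_matrix_vector_le by (intro exI[of _ 1]) auto
qed (auto simp: matrix_vector_mult_def vec_eq_iff sum.distrib scaleR_sum_right distrib_left distrib_right)

lemma cmod_cinner_le: "cmod (cinner x y) \<le> norm x * norm y"
proof -
  have "cmod (cinner x y) \<le> (\<Sum>j\<in>UNIV. \<bar>norm (x $ j)\<bar> * \<bar>norm (y $ j)\<bar>)"
    unfolding cinner_def by (auto intro!: sum_norm_le simp: norm_mult)
  also have "\<dots> \<le> norm x * norm y"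
    unfolding norm_vec_def by (rule L2_set_mult_ineq)
  finally show ?thesis .
qed

lemma bounded_bilinear_cinner:
  "bounded_bilinear (cinner :: complex^'n \<Rightarrow> complex^'n \<Rightarrow> complex)"
proof
  show "\<exists>K. \<forall>(x :: complex^'n) y. norm (cinner x y) \<le> norm x * norm y * K"
    using cmod_cinner_le by (intro exI[of _ 1]) auto
qed (auto simp: cinner_add_left cinner_add_right scaleR_eq_scale cinner_scale_left
       cinner_scale_right scaleR_conv_of_real)

lemmas tendsto_cinner = bounded_bilinear.tendsto[OF bounded_bilinear_cinner]
lemmas tendsto_matrix_vector = bounded_bilinear.tendsto[OF bounded_bilinear_matrix_vector]

lemma borel_measurable_matrix_vector [measurable (raw)]:
  fixes A :: "'a \<Rightarrow> complex^'n^'m"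
  assumes "A \<in> borel_measurable M" "f \<in> borel_measurable M"
  shows "(\<lambda>x. A x *v f x) \<in> borel_measurable M"
  by (rule borel_measurable_continuous_Pair[OF assms])
     (intro bounded_bilinear.continuous_on[OF bounded_bilinear_matrix_vector] continuous_intros)

lemma borel_measurable_cinner [measurable (raw)]:
  fixes f :: "'a \<Rightarrow> complex^'n"
  assumes "f \<in> borel_measurable M" "g \<in> borel_measurable M"
  shows "(\<lambda>x. cinner (f x) (g x)) \<in> borel_measurable M"
  by (rule borel_measurable_continuous_Pair[OF assms])
     (intro bounded_bilinear.continuous_on[OF bounded_bilinear_cinner] continuous_intros)

lemma borel_measurable_vec_scale [measurable (raw)]:
  fixes f :: "'a \<Rightarrow> complex^'n"
  assumes f: "f \<in> borel_measurable M"
  shows "(\<lambda>x. c *s f x) \<in> borel_measurable M"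
proof -
  have "(\<lambda>x. (\<chi> i j. if i = j then c else 0) *v f x) \<in> borel_measurable M"
    using f by measurable
  moreover have "(\<chi> i j. if i = j then c else 0) *v f x = c *s f x" for x
    by (simp add: matrix_vector_mult_def vec_eq_iff if_distrib[of "\<lambda>z. z * _"] cong: if_cong)
  ultimately show ?thesis by simp
qed

definition psd :: "complex^'n^'n \<Rightarrow> bool" where
  "psd A \<longleftrightarrow> (\<forall>v. cinner v (A *v v) \<in> \<real>\<^sub>\<ge>\<^sub>0)"

lemma psd_Re_nonneg: "psd A \<Longrightarrow> 0 \<le> Re (cinner v (A *v v))"
  by (auto simp: psd_def complex_nonneg_Reals_iff)

text \<open>By polarization, a form with real diagonal is Hermitian.\<close>

lemma psd_commute:
  assumes "psd A"
  shows "cinner y (A *v x) = cnj (cinner x (A *v y))"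
proof -
  have im: "Im (cinner v (A *v v)) = 0" for v
    using assms by (auto simp: psd_def complex_nonneg_Reals_iff)
  show ?thesis
    using im[of "x + y"] im[of "x + \<i> *s y"] im[of x] im[of y]
    by (auto simp: complex_eq_iff cinner_add_left cinner_add_right cinner_scale_left
        cinner_scale_right matrix_vector_right_distrib vector_scalar_commute)
qed

lemma psd_semi_inner_space:
  assumes "psd A"
  shows "semi_inner_space (*s) UNIV (\<lambda>x y. cinner x (A *v y))"
  by (intro semi_inner_space.intro vec.vector_space_axioms semi_inner_space_axioms.intro)
     (use assms in \<open>auto simp: cinner_add_right cinner_scale_right matrix_vector_right_distrib
       vector_scalar_commute intro: psd_commute psd_Re_nonneg vec.subspace_UNIV\<close>)

definition pos_contraction :: "complex^'n^'n \<Rightarrow> bool" where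
  "pos_contraction A \<longleftrightarrow> psd A \<and> (\<forall>v. Re (cinner v (A *v v)) \<le> (norm v)\<^sup>2)"

lemma psd_Cauchy_Schwarz:
  assumes "psd A"
  shows "cmod (cinner x (A *v y)) \<le> sqrt (Re (cinner x (A *v x))) * sqrt (Re (cinner y (A *v y)))"
proof -
  interpret semi_inner_space "(*s)" UNIV "\<lambda>x y. cinner x (A *v y)"
    by (rule psd_semi_inner_space[OF assms])
  show ?thesis
    using Cauchy_Schwarz[of x y] by (simp add: nrm_def)
qed

lemma cinner_axis_left: "cinner (axis i 1) x = x $ i"
proof -
  have "cinner (axis i 1) x = (\<Sum>j\<in>UNIV. if j = i then x $ j else 0)"
    unfolding cinner_def by (intro sum.cong) (auto simp: axis_def)
  then show ?thesis by simp
qed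

lemma matrix_vector_axis: "(A *v axis j (1::complex)) $ i = A $ i $ j"
  by (simp add: matrix_vector_mult_def axis_def if_distrib[where f = "\<lambda>z. c * z" for c] cong: if_cong)

lemma psd_diag_nonneg: "psd A \<Longrightarrow> 0 \<le> Re (A $ i $ i)"
  using psd_Re_nonneg[of A "axis i 1"] by (simp add: cinner_axis_left matrix_vector_axis)

lemma psd_entry_le:
  assumes "psd A"
  shows "cmod (A $ i $ j) \<le> sqrt (Re (A $ i $ i)) * sqrt (Re (A $ j $ j))"
  using psd_Cauchy_Schwarz[OF assms, of "axis i 1" "axis j 1"]
  by (simp add: cinner_axis_left matrix_vector_axis)

lemma psd_trace_nonneg: "psd A \<Longrightarrow> 0 \<le> Re (trace A)"
  by (simp add: trace_def psd_diag_nonneg sum_nonneg)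

lemma psd_entry_le_trace:
  assumes "psd A"
  shows "cmod (A $ i $ j) \<le> Re (trace A)"
proof -
  have le: "Re (A $ k $ k) \<le> Re (trace A)" for k
    unfolding trace_def Re_sum by (rule member_le_sum) (auto simp: psd_diag_nonneg assms)
  have "sqrt (Re (A $ i $ i)) * sqrt (Re (A $ j $ j)) \<le> sqrt (Re (trace A)) * sqrt (Re (trace A))"
    using le by (intro mult_mono) (auto simp: psd_diag_nonneg psd_trace_nonneg assms)
  then show ?thesis
    using psd_entry_le[OF assms, of i j] psd_trace_nonneg[OF assms] by simp
qed

text \<open>Each entry is at most the geometric mean of two diagonal entries, and the square roots of the
  diagonal form a vector of norm at most one.\<close>

lemma psd_trace_contraction:
  fixes A :: "complex^'n^'n"
  assumes psd: "psd A" and tr: "Re (trace A) \<le> 1"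
  shows "pos_contraction A"
  unfolding pos_contraction_def
proof (intro conjI allI psd)
  fix v :: "complex^'n"
  let ?s = "\<lambda>i. sqrt (Re (A $ i $ i))"
  have "Re (cinner v (A *v v)) \<le> cmod (cinner v (A *v v))" by (rule complex_Re_le_cmod)
  also have "\<dots> \<le> (\<Sum>i\<in>UNIV. \<Sum>j\<in>UNIV. cmod (v $ i) * (cmod (A $ i $ j) * cmod (v $ j)))"
    unfolding cinner_def matrix_vector_mult_def sum_distrib_left
    by (auto intro!: sum_norm_le simp: norm_mult sum_distrib_left)
  also have "\<dots> \<le> (\<Sum>i\<in>UNIV. \<Sum>j\<in>UNIV. cmod (v $ i) * ((?s i * ?s j) * cmod (v $ j)))"
    by (intro sum_mono mult_left_mono mult_right_mono psd_entry_le psd) auto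
  also have "\<dots> = (\<Sum>i\<in>UNIV. \<bar>cmod (v $ i)\<bar> * \<bar>?s i\<bar>)\<^sup>2"
    by (simp add: power2_eq_square sum_product psd_diag_nonneg psd mult_ac)
  also have "\<dots> \<le> (norm v * L2_set ?s UNIV)\<^sup>2"
    unfolding norm_vec_def by (intro power_mono L2_set_mult_ineq) (auto intro: sum_nonneg)
  also have "\<dots> = (norm v)\<^sup>2 * Re (trace A)"
    by (simp add: power_mult_distrib L2_set_def psd_diag_nonneg psd trace_def sum_nonneg)
  also have "\<dots> \<le> (norm v)\<^sup>2"
    using tr by (simp add: mult_left_le)
  finally show "Re (cinner v (A *v v)) \<le> (norm v)\<^sup>2" .
qed

text \<open>The Cauchy--Schwarz inequality for the form of \<open>A\<close>, applied to the pair \<open>A x\<close> and \<open>x\<close>.\<close>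

lemma pos_contraction_norm_sq_le:
  assumes "pos_contraction A"
  shows "(norm (A *v x))\<^sup>2 \<le> Re (cinner x (A *v x))"
proof -
  have psd: "psd A" using assms by (simp add: pos_contraction_def)
  define y where "y = A *v x"
  define s where "s = Re (cinner x (A *v x))"
  have s: "0 \<le> s" using psd_Re_nonneg[OF psd] by (simp add: s_def)
  have "(norm y)\<^sup>2 = Re (cinner y (A *v x))"
    by (simp add: norm_sq_cinner y_def)
  also have "\<dots> \<le> cmod (cinner y (A *v x))" by (rule complex_Re_le_cmod)
  also have "\<dots> \<le> sqrt (Re (cinner y (A *v y))) * sqrt s"
    unfolding s_def by (rule psd_Cauchy_Schwarz[OF psd])
  also have "\<dots> \<le> norm y * sqrt s"
    using assms s
    by (intro mult_right_mono real_le_lsqrt) (auto simp: pos_contraction_def)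
  finally have "norm y * norm y \<le> norm y * sqrt s" by (simp add: power2_eq_square)
  then have "norm y \<le> sqrt s"
    using s by (cases "norm y = 0") (auto simp: mult_le_cancel_left)
  then have "(norm y)\<^sup>2 \<le> (sqrt s)\<^sup>2" by (intro power_mono) auto
  then show ?thesis using s by (simp add: y_def s_def)
qed

text \<open>Richardson's iteration for \<open>A x = y\<close>. For a singular positive contraction it selects one solution by a limit of
  polynomials in \<open>A\<close>, so that this solution depends measurably on \<open>A\<close> and \<open>y\<close>.\<close>

fun richardson :: "complex^'n^'n \<Rightarrow> complex^'n \<Rightarrow> nat \<Rightarrow> complex^'n" where
  "richardson A y 0 = 0"
| "richardson A y (Suc m) = richardson A y m + (y - A *v richardson A y m)"

lemma pos_contraction_complement:
  assumes "pos_contraction A"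
  shows "pos_contraction (mat 1 - A)"
proof -
  have "cinner v ((mat 1 - A) *v v) = cinner v v - cinner v (A *v v)" for v
    by (simp add: matrix_vector_mult_diff_rdistrib cinner_diff_right)
  moreover have "Im (cinner v v) = 0" for v :: "complex^'n"
    using cinner_commute[of v v] by (simp add: complex_eq_iff)
  ultimately show ?thesis
    using assms by (auto simp: pos_contraction_def psd_def complex_nonneg_Reals_iff norm_sq_cinner)
qed

text \<open>The numbers \<open>\<langle>v, S\<^sup>k v\<rangle>\<close> decrease to a limit, and \<open>\<parallel>S\<^sup>j v - S\<^sup>k v\<parallel>\<^sup>2\<close> is a second difference of them.\<close>

lemma convergent_powers_pos_contraction:
  assumes S: "pos_contraction S"
  shows "convergent (\<lambda>k. (((*v) S) ^^ k) v)"
proof -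
  define e where "e k = (((*v) S) ^^ k) v" for k
  have e_Suc: "e (Suc k) = S *v e k" for k by (simp add: e_def)
  have psd: "psd S" using S by (simp add: pos_contraction_def)
  have adj: "cinner (S *v x) y = cinner x (S *v y)" for x y
    using psd_commute[OF psd, of x y] cinner_commute[of "S *v x" y] by simp
  define s where "s k = Re (cinner v (e k))" for k
  have move: "cinner (e j) (e k) = cinner v (e (j + k))" for j k
  proof (induction j arbitrary: k)
    case 0 show ?case by (simp add: e_def)
  next
    case (Suc j)
    have "cinner (e (Suc j)) (e k) = cinner (e j) (e (Suc k))"
      by (simp add: e_Suc adj)
    then show ?case by (simp add: Suc)
  qed
  have even: "s (2 * k) = (norm (e k))\<^sup>2" for k
    by (simp add: s_def norm_sq_cinner move mult_2)
  have odd: "s (Suc (2 * k)) = Re (cinner (e k) (S *v e k))" for k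
    by (simp add: s_def e_Suc[symmetric] move mult_2)
  have "s (Suc k) \<le> s k" for k
  proof (cases "even k")
    case True
    then obtain j where "k = 2 * j" by blast
    then show ?thesis using S by (simp add: even odd pos_contraction_def)
  next
    case False
    then obtain j where k: "k = Suc (2 * j)" by (metis oddE Suc_eq_plus1)
    have "s (Suc k) = (norm (S *v e j))\<^sup>2"
      using even[of "Suc j"] by (simp add: k e_Suc)
    then show ?thesis
      using pos_contraction_norm_sq_le[OF S, of "e j"] by (simp add: k odd)
  qed
  then have dec: "decseq s" by (simp add: decseq_Suc_iff)
  have "0 \<le> s k" for k
  proof (cases "even k")
    case True
    then obtain j where "k = 2 * j" by blast
    then show ?thesis by (simp add: even)
  next
    case False
    then obtain j where "k = Suc (2 * j)" by (metis oddE Suc_eq_plus1)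
    then show ?thesis by (simp add: odd psd_Re_nonneg[OF psd])
  qed
  then obtain L where L: "s \<longlonglongrightarrow> L" "\<And>k. L \<le> s k"
    using decseq_convergent[OF dec, of 0] by auto
  have diff: "(norm (e j - e k))\<^sup>2 = s (2 * j) - 2 * s (j + k) + s (2 * k)" for j k
  proof -
    have "Re (cinner (e k) (e j)) = s (j + k)" "Re (cinner (e j) (e k)) = s (j + k)"
      by (simp_all add: s_def move add.commute)
    then show ?thesis
      by (simp add: norm_sq_cinner cinner_diff_left cinner_diff_right even)
  qed
  have "Cauchy e"
  proof (rule metric_CauchyI)
    fix r :: real assume r: "r > 0"
    then have "r\<^sup>2 / 4 > 0" by simp
    then have "L < L + r\<^sup>2 / 4" by linarith
    then obtain N where N: "s N < L + r\<^sup>2 / 4"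
      using order_tendstoD(2)[OF L(1)] by (meson eventually_sequentially order_refl)
    have "dist (e j) (e k) < r" if "j \<ge> N" "k \<ge> N" for j k
    proof -
      have "s (2 * j) \<le> s N" "s (2 * k) \<le> s N"
        using that dec by (auto simp: decseq_def)
      then have "(norm (e j - e k))\<^sup>2 < r\<^sup>2"
        unfolding diff using L(2)[of "j + k"] N \<open>r\<^sup>2 / 4 > 0\<close> by linarith
      then show ?thesis
        using r by (simp add: dist_norm power2_less_imp_less)
    qed
    then show "\<exists>N. \<forall>j\<ge>N. \<forall>k\<ge>N. dist (e j) (e k) < r" by blast
  qed
  then show ?thesis
    unfolding e_def[symmetric] by (simp add: Cauchy_convergent_iff)
qed

lemma richardson_solves:
  assumes A: "pos_contraction A" and y: "y \<in> range ((*v) A)"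
  shows "A *v lim (richardson A y) = y"
proof -
  obtain v where v: "y = A *v v" using y by auto
  let ?S = "mat 1 - A"
  define e where "e k = (((*v) ?S) ^^ k) v" for k
  have e_Suc: "e (Suc k) = e k - A *v e k" for k
    by (simp add: e_def matrix_vector_mult_diff_rdistrib)
  have T: "richardson A y k = v - e k" for k
  proof (induction k)
    case 0 show ?case by (simp add: e_def)
  next
    case (Suc k)
    then show ?case
      by (simp add: e_Suc v matrix_vector_mult_diff_distrib)
  qed
  obtain l where l: "e \<longlonglongrightarrow> l"
    using convergent_powers_pos_contraction[OF pos_contraction_complement[OF A], of v]
    unfolding e_def[abs_def] convergent_def by blast
  have "(\<lambda>k. e k - e (Suc k)) \<longlonglongrightarrow> l - l"
    by (intro tendsto_diff l LIMSEQ_Suc)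
  then have "(\<lambda>k. A *v e k) \<longlonglongrightarrow> 0" by (simp add: e_Suc)
  moreover have "(\<lambda>k. A *v e k) \<longlonglongrightarrow> A *v l"
    by (intro tendsto_matrix_vector l tendsto_const)
  ultimately have Al: "A *v l = 0" using LIMSEQ_unique by blast
  have "richardson A y \<longlonglongrightarrow> v - l"
    unfolding T[abs_def] by (intro tendsto_intros l)
  then have "lim (richardson A y) = v - l" by (rule limI)
  then show ?thesis by (simp add: matrix_vector_mult_diff_distrib Al v)
qed

lemma closed_range_matrix: "closed (range ((*v) (A :: complex^'n^'n)))"
  by (intro closed_subspace linear_subspace_image matrix_vector_mul_linear subspace_UNIV)

section \<open>The Hilbert space of a matrix weight\<close>

text \<open>The weight may be singular at every point, with a kernel that varies from point to point; elements of
  norm zero are the functions that the weight annihilates almost everywhere.\<close>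

locale weighted_L2 =
  fixes M :: "'a measure" and W :: "'a \<Rightarrow> complex^'n^'n"
  assumes W_measurable [measurable]: "W \<in> borel_measurable M"
    and W_contraction: "AE x in M. pos_contraction (W x)"
begin

definition wsq :: "('a \<Rightarrow> complex^'n) \<Rightarrow> 'a \<Rightarrow> real" where
  "wsq f x = Re (cinner (f x) (W x *v f x))"

definition wspace :: "('a \<Rightarrow> complex^'n) set" where
  "wspace = {f \<in> borel_measurable M. (\<integral>\<^sup>+x. ennreal (wsq f x) \<partial>M) < \<infinity>}"

definition wip :: "('a \<Rightarrow> complex^'n) \<Rightarrow> ('a \<Rightarrow> complex^'n) \<Rightarrow> complex" where
  "wip f g = (LINT x|M. cinner (f x) (W x *v g x))"

lemma wsq_measurable [measurable (raw)]:
  assumes [measurable]: "f \<in> borel_measurable M"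
  shows "wsq f \<in> borel_measurable M"
  unfolding wsq_def[abs_def] by measurable

lemma wsq_nonneg_AE: "AE x in M. 0 \<le> wsq f x"
  using W_contraction
  by eventually_elim (auto simp: wsq_def pos_contraction_def intro: psd_Re_nonneg)

lemma wspace_measurable [measurable_dest]: "f \<in> wspace \<Longrightarrow> f \<in> borel_measurable M"
  by (simp add: wspace_def)

lemma wsq_integrable: "f \<in> wspace \<Longrightarrow> integrable M (wsq f)"
  by (rule integrableI_nonneg) (auto simp: wspace_def wsq_nonneg_AE)

lemma wspaceI:
  assumes "f \<in> borel_measurable M" "integrable M g" "AE x in M. wsq f x \<le> g x"
  shows "f \<in> wspace"
proof -
  have "(\<integral>\<^sup>+x. ennreal (wsq f x) \<partial>M) \<le> (\<integral>\<^sup>+x. ennreal (norm (g x)) \<partial>M)"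
  proof (rule nn_integral_mono_AE)
    show "AE x in M. ennreal (wsq f x) \<le> ennreal (norm (g x))"
      using assms(3) by eventually_elim (auto intro!: ennreal_leI)
  qed
  also have "\<dots> < \<infinity>"
    using assms(2) by (simp add: integrable_iff_bounded)
  finally show ?thesis using assms(1) by (simp add: wspace_def)
qed

lemma wip_integrable:
  assumes f: "f \<in> wspace" and g: "g \<in> wspace"
  shows "integrable M (\<lambda>x. cinner (f x) (W x *v g x))"
proof (rule Bochner_Integration.integrable_bound)
  show "integrable M (\<lambda>x. wsq f x + wsq g x)"
    by (intro Bochner_Integration.integrable_add wsq_integrable f g)
  show "(\<lambda>x. cinner (f x) (W x *v g x)) \<in> borel_measurable M"
    using f g by measurable
  show "AE x in M. norm (cinner (f x) (W x *v g x)) \<le> norm (wsq f x + wsq g x)"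
    using W_contraction
  proof eventually_elim
    case (elim x)
    then have psd: "psd (W x)" by (simp add: pos_contraction_def)
    define s t where "s = sqrt (wsq f x)" and "t = sqrt (wsq g x)"
    have nn: "0 \<le> wsq f x" "0 \<le> wsq g x"
      using psd_Re_nonneg[OF psd] by (auto simp: wsq_def)
    have "cmod (cinner (f x) (W x *v g x)) \<le> s * t"
      using psd_Cauchy_Schwarz[OF psd] by (simp add: s_def t_def wsq_def)
    also have "\<dots> \<le> s\<^sup>2 + t\<^sup>2"
      using sum_squares_bound[of s t] mult_nonneg_nonneg[of s t] nn by (simp add: s_def t_def)
    finally show ?case
      using nn by (simp add: s_def t_def)
  qed
qed

lemma wsq_add_le_AE: "AE x in M. wsq (f + g) x \<le> 2 * wsq f x + 2 * wsq g x"
  using W_contraction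
proof eventually_elim
  case (elim x)
  then have psd: "psd (W x)" by (simp add: pos_contraction_def)
  have "0 \<le> Re (cinner (f x - g x) (W x *v (f x - g x)))"
    by (rule psd_Re_nonneg[OF psd])
  then show ?case
    by (simp add: wsq_def cinner_add_left cinner_add_right cinner_diff_left cinner_diff_right
        matrix_vector_right_distrib matrix_vector_mult_diff_distrib)
qed

lemma wspace_add: "f \<in> wspace \<Longrightarrow> g \<in> wspace \<Longrightarrow> f + g \<in> wspace"
  by (rule wspaceI[where g = "\<lambda>x. 2 * wsq f x + 2 * wsq g x"])
     (auto simp: plus_fun_def[of f g] wsq_integrable wsq_add_le_AE[of f g, unfolded plus_fun_def])

lemma wsq_scale: "wsq (\<lambda>x. c *s f x) y = (cmod c)\<^sup>2 * wsq f y"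
proof -
  have "cinner (c *s f y) (W y *v (c *s f y)) = (c * cnj c) * cinner (f y) (W y *v f y)"
    by (simp add: cinner_scale_left cinner_scale_right vector_scalar_commute mult_ac)
  then have "wsq (\<lambda>x. c *s f x) y = Re (of_real ((cmod c)\<^sup>2) * cinner (f y) (W y *v f y))"
    by (simp only: wsq_def complex_norm_square)
  also have "\<dots> = (cmod c)\<^sup>2 * wsq f y"
    by (simp only: Re_complex_of_real Im_complex_of_real times_complex.simps mult_zero_left diff_zero wsq_def)
  finally show ?thesis .
qed

lemma wspace_scale: "f \<in> wspace \<Longrightarrow> (\<lambda>x. c *s f x) \<in> wspace"
  by (rule wspaceI[where g = "\<lambda>x. (cmod c)\<^sup>2 * wsq f x"])
     (auto simp: wsq_scale wsq_integrable)

lemma wspace_zero: "0 \<in> wspace"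
  by (simp add: wspace_def wsq_def zero_fun_def)

lemma vector_space_functions:
  "vector_space (\<lambda>(c :: complex) (f :: 'a \<Rightarrow> complex^'n) x. c *s f x)"
  by unfold_locales (auto simp: fun_eq_iff vec_eq_iff algebra_simps)

sublocale semi_inner_space "\<lambda>c f x. c *s f x" wspace wip
proof (intro semi_inner_space.intro vector_space_functions semi_inner_space_axioms.intro)
  interpret vector_space "\<lambda>(c :: complex) (f :: 'a \<Rightarrow> complex^'n) x. c *s f x"
    by (rule vector_space_functions)
  show "subspace wspace"
    by (simp add: subspace_def wspace_add wspace_scale wspace_zero)
  show "wip f (g + h) = wip f g + wip f h" if "f \<in> wspace" "g \<in> wspace" "h \<in> wspace" for f g h
    using that by (simp add: wip_def matrix_vector_right_distrib cinner_add_right wip_integrable)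
  show "wip f (\<lambda>x. c *s g x) = c * wip f g" for f g c
    by (simp add: wip_def vector_scalar_commute cinner_scale_right)
  show "wip g f = cnj (wip f g)" if "f \<in> wspace" "g \<in> wspace" for f g
  proof -
    have "wip g f = (LINT x|M. cnj (cinner (f x) (W x *v g x)))"
      unfolding wip_def
    proof (rule integral_cong_AE)
      have [measurable]: "f \<in> borel_measurable M" "g \<in> borel_measurable M"
        using that by (auto dest: wspace_measurable)
      show "(\<lambda>x. cinner (g x) (W x *v f x)) \<in> borel_measurable M"
        "(\<lambda>x. cnj (cinner (f x) (W x *v g x))) \<in> borel_measurable M"
        unfolding cinner_commute[symmetric, of "f _"] by measurable
      show "AE x in M. cinner (g x) (W x *v f x) = cnj (cinner (f x) (W x *v g x))"
        using W_contraction
        by eventually_elim (auto simp: pos_contraction_def intro: psd_commute)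
    qed
    then show ?thesis by (simp add: wip_def)
  qed
  show "0 \<le> Re (wip f f)" if "f \<in> wspace" for f
  proof -
    have "Re (wip f f) = (LINT x|M. wsq f x)"
      unfolding wip_def wsq_def using wip_integrable[OF that that] by simp
    then show ?thesis using wsq_nonneg_AE by (simp add: integral_nonneg_AE)
  qed
qed

lemma nrm_sq_integral: "f \<in> wspace \<Longrightarrow> (nrm f)\<^sup>2 = (LINT x|M. wsq f x)"
  using wip_integrable[of f f] by (simp add: nrm_sq wip_def wsq_def)

lemma nrm_sq_nn_integral: "f \<in> wspace \<Longrightarrow> (\<integral>\<^sup>+x. ennreal (wsq f x) \<partial>M) = ennreal ((nrm f)\<^sup>2)"
  by (simp add: nrm_sq_integral nn_integral_eq_integral wsq_integrable wsq_nonneg_AE)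

lemma nrm_eq_0_iff_AE:
  assumes f: "f \<in> wspace"
  shows "nrm f = 0 \<longleftrightarrow> (AE x in M. W x *v f x = 0)"
proof -
  have "nrm f = 0 \<longleftrightarrow> (nrm f)\<^sup>2 = 0" by simp
  also have "\<dots> \<longleftrightarrow> (AE x in M. wsq f x = 0)"
    unfolding nrm_sq_integral[OF f]
    by (rule integral_nonneg_eq_0_iff_AE[OF wsq_integrable[OF f] wsq_nonneg_AE])
  also have "\<dots> \<longleftrightarrow> (AE x in M. W x *v f x = 0)"
  proof
    assume "AE x in M. wsq f x = 0"
    with W_contraction show "AE x in M. W x *v f x = 0"
    proof eventually_elim
      case (elim x)
      then show ?case
        using pos_contraction_norm_sq_le[of "W x" "f x"] by (simp add: wsq_def)
    qed
  next
    assume "AE x in M. W x *v f x = 0"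
    then show "AE x in M. wsq f x = 0"
      by eventually_elim (simp add: wsq_def)
  qed
  finally show ?thesis .
qed

text \<open>Since \<open>W\<close> may be singular, a Cauchy sequence \<open>g\<^sub>k\<close> need not converge anywhere. Along a fast subsequence,
  however, \<open>W g\<^sub>k\<close> converges almost everywhere, and the limit \<open>y\<close> lies in the range of \<open>W\<close> because this
  range is finite-dimensional. Richardson's iteration solves \<open>W f = y\<close> measurably, and Fatou's lemma gives
  convergence to \<open>f\<close> in norm.\<close>

lemma wspace_complete:
  assumes X: "\<And>k::nat. X k \<in> wspace"
    and Cauchy: "\<And>e. e > 0 \<Longrightarrow> \<exists>N. \<forall>m\<ge>N. \<forall>k\<ge>N. nrm (X m - X k) < e"
  shows "\<exists>f\<in>wspace. (\<lambda>k. nrm (X k - f)) \<longlonglongrightarrow> 0"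
proof -
  define \<delta> :: "nat \<Rightarrow> real" where "\<delta> k = (1/4) ^ k" for k
  have \<delta>: "\<delta> k > 0" for k by (simp add: \<delta>_def)
  have "\<exists>N. \<forall>m\<ge>N. \<forall>j\<ge>N. nrm (X m - X j) < \<delta> k" for k
    by (rule Cauchy[OF \<delta>])
  then obtain N where N: "\<And>k m j. m \<ge> N k \<Longrightarrow> j \<ge> N k \<Longrightarrow> nrm (X m - X j) < \<delta> k"
    by metis
  define r where "r k = (\<Sum>i\<le>k. N i)" for k
  have r_ge: "N k \<le> r m" if "k \<le> m" for k m
    unfolding r_def by (rule member_le_sum) (use that in auto)
  define g where "g k = X (r k)" for k
  have g: "g k \<in> wspace" for k unfolding g_def by (rule X)
  have [measurable]: "g k \<in> borel_measurable M" for k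
    using g by (rule wspace_measurable)
  have close: "nrm (g k - g m) < \<delta> k" if "k \<le> m" for k m
    unfolding g_def by (rule N) (use r_ge that in auto)
  have close_nn: "(\<integral>\<^sup>+x. ennreal (wsq (g k - g m) x) \<partial>M) \<le> ennreal ((1/16) ^ k)" if "k \<le> m" for k m
  proof -
    have "(nrm (g k - g m))\<^sup>2 \<le> (\<delta> k)\<^sup>2"
      using close[OF that] g by (intro power_mono) auto
    also have "\<dots> = (1/16) ^ k"
      by (simp add: \<delta>_def power2_eq_square power_mult_distrib[symmetric])
    finally show ?thesis
      using g by (simp add: nrm_sq_nn_integral V_closed ennreal_leI)
  qed
  define y where "y x = lim (\<lambda>k. W x *v g k x)" for x
  define f where "f x = lim (richardson (W x) (y x))" for x
  have [measurable]: "y \<in> borel_measurable M"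
    unfolding y_def[abs_def] by (rule borel_measurable_lim_metric) measurable
  have [measurable]: "(\<lambda>x. richardson (W x) (y x) k) \<in> borel_measurable M" for k
    by (induction k) auto
  have [measurable]: "f \<in> borel_measurable M"
    unfolding f_def[abs_def] by (rule borel_measurable_lim_metric) measurable
  \<comment> \<open>The weights \<open>4 ^ k\<close> are summable against the squared distances, so that almost everywhere
    the pointwise increments decay geometrically.\<close>
  have "(\<integral>\<^sup>+x. (\<Sum>k. ennreal (4 ^ k * wsq (g k - g (Suc k)) x)) \<partial>M)
      = (\<Sum>k. \<integral>\<^sup>+x. ennreal (4 ^ k * wsq (g k - g (Suc k)) x) \<partial>M)"
    by (rule nn_integral_suminf) (simp add: fun_diff_def wsq_measurable)
  also have "\<dots> \<le> (\<Sum>k. ennreal ((1/4) ^ k))"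
  proof (intro suminf_le allI)
    fix k :: nat
    have "(\<integral>\<^sup>+x. ennreal (4 ^ k * wsq (g k - g (Suc k)) x) \<partial>M)
        = ennreal (4 ^ k) * (\<integral>\<^sup>+x. ennreal (wsq (g k - g (Suc k)) x) \<partial>M)"
      by (subst nn_integral_cmult[symmetric]) (auto simp: ennreal_mult' fun_diff_def wsq_measurable)
    also have "\<dots> \<le> ennreal (4 ^ k) * ennreal ((1/16) ^ k)"
      by (intro mult_left_mono close_nn) auto
    also have "\<dots> = ennreal ((1/4) ^ k)"
      by (simp add: ennreal_mult[symmetric] power_mult_distrib[symmetric])
    finally show "(\<integral>\<^sup>+x. ennreal (4 ^ k * wsq (g k - g (Suc k)) x) \<partial>M) \<le> ennreal ((1/4) ^ k)" .
  qed auto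
  also have "\<dots> < \<infinity>"
  proof -
    have "(\<Sum>k. ennreal ((1/4) ^ k)) \<noteq> top"
      by (rule ennreal_suminf_neq_top[OF summable_geometric]) auto
    then show ?thesis by (simp only: less_top infinity_ennreal_def)
  qed
  finally have fin: "(\<integral>\<^sup>+x. (\<Sum>k. ennreal (4 ^ k * wsq (g k - g (Suc k)) x)) \<partial>M) \<noteq> \<infinity>"
    by simp
  have "AE x in M. (\<Sum>k. ennreal (4 ^ k * wsq (g k - g (Suc k)) x)) \<noteq> \<infinity>"
    by (rule nn_integral_noteq_infinite[OF _ fin]) (simp add: fun_diff_def wsq_measurable)
  then have Wf: "AE x in M. (\<lambda>k. W x *v g k x) \<longlonglongrightarrow> W x *v f x"
    using W_contraction
  proof eventually_elim
    case (elim x)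
    from elim(1) have "(\<Sum>k. ennreal (4 ^ k * wsq (g k - g (Suc k)) x)) < top"
      by (simp only: less_top infinity_ennreal_def)
    then obtain C where C: "0 \<le> C" "(\<Sum>k. ennreal (4 ^ k * wsq (g k - g (Suc k)) x)) = ennreal C"
      unfolding less_top_ennreal by blast
    define h where "h k = W x *v g (Suc k) x - W x *v g k x" for k
    have "norm (h k) \<le> sqrt C * (1/2) ^ k" for k
    proof -
      have "ennreal (4 ^ k * wsq (g k - g (Suc k)) x) \<le> ennreal C"
        unfolding C(2)[symmetric] using sum_le_suminf[of "\<lambda>k. ennreal (4 ^ k * wsq (g k - g (Suc k)) x)" "{k}"]
        by simp
      then have "4 ^ k * wsq (g k - g (Suc k)) x \<le> C"
        using C(1) by simp
      have "(norm (h k))\<^sup>2 \<le> wsq (g k - g (Suc k)) x"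
        using pos_contraction_norm_sq_le[OF elim(2), of "g k x - g (Suc k) x"]
        by (simp add: h_def wsq_def matrix_vector_mult_diff_distrib norm_minus_commute)
      then have "4 ^ k * (norm (h k))\<^sup>2 \<le> 4 ^ k * wsq (g k - g (Suc k)) x"
        by (rule mult_left_mono) simp
      also have "\<dots> \<le> C" by fact
      finally have "(norm (h k))\<^sup>2 \<le> C / 4 ^ k" by (simp add: field_simps)
      also have "\<dots> = (sqrt C * (1/2) ^ k)\<^sup>2"
        using C(1) power_mult[of "2::real" 2 k] power_even_eq[of "2::real" k]
        by (simp add: power_mult_distrib power_divide)
      finally show ?thesis
        by (rule power2_le_imp_le) (use C in simp)
    qed
    note h_le = this
    have "summable h"
      by (rule summable_comparison_test'[of "\<lambda>k. sqrt C * (1/2) ^ k"])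
         (auto intro!: summable_mult summable_geometric h_le)
    then have "(\<lambda>k. W x *v g 0 x + (\<Sum>i<k. h i)) \<longlonglongrightarrow> W x *v g 0 x + suminf h"
      by (intro tendsto_intros summable_LIMSEQ)
    moreover have "W x *v g 0 x + (\<Sum>i<k. h i) = W x *v g k x" for k
      by (simp add: h_def sum_lessThan_telescope[of "\<lambda>i. W x *v g i x"])
    ultimately have "(\<lambda>k. W x *v g k x) \<longlonglongrightarrow> W x *v g 0 x + suminf h"
      by simp
    with limI[OF this] have lim: "(\<lambda>k. W x *v g k x) \<longlonglongrightarrow> y x"
      unfolding y_def by simp
    have "y x \<in> range ((*v) (W x))"
      by (rule closed_sequentially[OF closed_range_matrix _ lim]) auto
    then have "W x *v f x = y x"
      unfolding f_def by (rule richardson_solves[OF elim(2)])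
    then show ?case using lim by simp
  qed
  have dist: "(\<integral>\<^sup>+x. ennreal (wsq (g k - f) x) \<partial>M) \<le> ennreal ((1/16) ^ k)" for k
  proof -
    have "AE x in M. ennreal (wsq (g k - f) x) \<le> liminf (\<lambda>m. ennreal (wsq (g k - g m) x))"
      using Wf W_contraction
    proof eventually_elim
      case (elim x)
      then have psd: "psd (W x)" by (simp add: pos_contraction_def)
      define d where "d m = g m x - f x" for m
      define b where "b m = wsq (g k - f) x - 2 * Re (cinner (d k) (W x *v d m))" for m
      have "(\<lambda>m. W x *v d m) \<longlonglongrightarrow> W x *v f x - W x *v f x"
        unfolding d_def matrix_vector_mult_diff_distrib by (intro tendsto_intros elim)
      then have "(\<lambda>m. cinner (d k) (W x *v d m)) \<longlonglongrightarrow> cinner (d k) 0"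
        by (intro tendsto_cinner tendsto_const) simp
      then have "b \<longlonglongrightarrow> wsq (g k - f) x - 2 * Re 0"
        unfolding b_def[abs_def] by (intro tendsto_intros) simp
      then have "(\<lambda>m. ennreal (b m)) \<longlonglongrightarrow> ennreal (wsq (g k - f) x)"
        by (intro tendsto_ennrealI) simp
      then have "ennreal (wsq (g k - f) x) = liminf (\<lambda>m. ennreal (b m))"
        by (intro lim_imp_Liminf[symmetric]) auto
      also have "\<dots> \<le> liminf (\<lambda>m. ennreal (wsq (g k - g m) x))"
      proof (intro Liminf_mono always_eventually allI ennreal_leI)
        fix m
        have "g k x - g m x = d k - d m" by (simp add: d_def)
        then have "wsq (g k - g m) x = Re (cinner (d k - d m) (W x *v (d k - d m)))"
          by (simp add: wsq_def)
        also have "\<dots> = Re (cinner (d k) (W x *v d k)) - Re (cinner (d k) (W x *v d m))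
            - Re (cinner (d m) (W x *v d k)) + Re (cinner (d m) (W x *v d m))"
          by (simp add: cinner_diff_left cinner_diff_right matrix_vector_mult_diff_distrib)
        also have "Re (cinner (d m) (W x *v d k)) = Re (cinner (d k) (W x *v d m))"
          by (simp add: psd_commute[OF psd, of "d m" "d k"])
        finally show "b m \<le> wsq (g k - g m) x"
          using psd_Re_nonneg[OF psd, of "d m"] by (simp add: b_def wsq_def d_def)
      qed
      finally show ?case .
    qed
    then have "(\<integral>\<^sup>+x. ennreal (wsq (g k - f) x) \<partial>M)
        \<le> (\<integral>\<^sup>+x. liminf (\<lambda>m. ennreal (wsq (g k - g m) x)) \<partial>M)"
      by (rule nn_integral_mono_AE)
    also have "\<dots> \<le> liminf (\<lambda>m. \<integral>\<^sup>+x. ennreal (wsq (g k - g m) x) \<partial>M)"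
      by (rule nn_integral_liminf) (simp add: fun_diff_def wsq_measurable)
    also have "\<dots> \<le> liminf (\<lambda>m. ennreal ((1/16) ^ k))"
    proof (rule Liminf_mono)
      show "\<forall>\<^sub>F m in sequentially. (\<integral>\<^sup>+x. ennreal (wsq (g k - g m) x) \<partial>M) \<le> ennreal ((1/16) ^ k)"
        using eventually_ge_at_top[of k] by eventually_elim (rule close_nn)
    qed
    also have "\<dots> = ennreal ((1/16) ^ k)"
      by (simp add: Liminf_const)
    finally show ?thesis .
  qed
  have gf: "g k - f \<in> wspace" for k
    using dist[of k] by (auto simp: wspace_def fun_diff_def intro: le_less_trans)
  have f: "f \<in> wspace"
  proof -
    have "g 0 - (g 0 - f) \<in> wspace" by (intro V_closed g gf)
    then show ?thesis by (simp del: minus_apply)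
  qed
  have gf_le: "nrm (g k - f) \<le> \<delta> k" for k
  proof (rule power2_le_imp_le)
    have "ennreal ((nrm (g k - f))\<^sup>2) \<le> ennreal ((1/16) ^ k)"
      using dist[of k] gf by (simp add: nrm_sq_nn_integral)
    then show "(nrm (g k - f))\<^sup>2 \<le> (\<delta> k)\<^sup>2"
      by (simp add: \<delta>_def power2_eq_square power_mult_distrib[symmetric])
  qed (use \<delta> less_imp_le in blast)
  have "\<forall>n\<ge>N k. norm (nrm (X n - f)) \<le> 2 * \<delta> k" for k
  proof (intro allI impI)
    fix n assume n: "N k \<le> n"
    have "nrm (X n - f) \<le> nrm (X n - g k) + nrm (g k - f)"
      by (rule nrm_triangle_diff) (use X g f in auto)
    moreover have "nrm (X n - g k) < \<delta> k"
      unfolding g_def by (rule N) (use n r_ge in auto)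
    moreover have "0 \<le> nrm (X n - f)" using X f by auto
    ultimately show "norm (nrm (X n - f)) \<le> 2 * \<delta> k" using gf_le[of k] by simp
  qed
  note near = this
  have "(\<lambda>n. nrm (X n - f)) \<longlonglongrightarrow> 0"
  proof (rule LIMSEQ_I)
    fix e :: real assume e: "e > 0"
    have "\<delta> \<longlonglongrightarrow> 0" unfolding \<delta>_def[abs_def] by (rule LIMSEQ_power_zero) simp
    then obtain k where "\<delta> k < e / 2"
      using order_tendstoD(2)[of \<delta> 0 sequentially "e / 2"] e
      by (auto simp: eventually_sequentially)
    then show "\<exists>no. \<forall>n\<ge>no. norm (nrm (X n - f) - 0) < e"
      using near[of k] by (intro exI[of _ "N k"]) force
  qed
  then show ?thesis using f by blast
qed

sublocale semi_hilbert "\<lambda>c f x. c *s f x" wspace wip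
  by unfold_locales (rule wspace_complete)

end

section \<open>Set functions that are countably additive on compact intervals\<close>

abbreviation borel_on :: "ereal \<Rightarrow> ereal \<Rightarrow> real set set" where
  "borel_on a b \<equiv> sets (restrict_space borel (einterval a b))"

lemma borel_on_iff: "A \<in> borel_on a b \<longleftrightarrow> A \<subseteq> einterval a b \<and> A \<in> sets borel"
  by (intro sets_restrict_space_iff) auto

lemma sigma_algebra_borel_on: "sigma_algebra (einterval a b) (borel_on a b)"
  using sets.sigma_algebra_axioms[of "restrict_space borel (einterval a b)"]
  by (simp add: space_restrict_space)

lemma rc_borelE:
  assumes "A \<in> rc_borel a b"
  obtains c d where "A \<subseteq> {c..d}" "{c..d} \<subseteq> einterval a b" "A \<in> sets borel"
  using assms by (auto simp: rc_borel_def)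

lemma rc_borel_in_sets: "A \<in> rc_borel a b \<Longrightarrow> A \<in> borel_on a b"
  by (auto simp: rc_borel_def borel_on_iff)

lemma rc_borel_borel: "A \<in> rc_borel a b \<Longrightarrow> A \<in> sets borel"
  by (simp add: rc_borel_def)

lemma rc_borel_subset: "A \<in> rc_borel a b \<Longrightarrow> B \<in> sets borel \<Longrightarrow> B \<subseteq> A \<Longrightarrow> B \<in> rc_borel a b"
  unfolding rc_borel_def by blast

lemma rc_borel_Icc: "{c..d} \<subseteq> einterval a b \<Longrightarrow> {c..d} \<in> rc_borel a b"
  unfolding rc_borel_def by auto

lemma rc_borel_in_Icc:
  "{c..d} \<subseteq> einterval a b \<Longrightarrow> B \<in> sets borel \<Longrightarrow> B \<subseteq> {c..d} \<Longrightarrow> B \<in> rc_borel a b"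
  using rc_borel_subset[OF rc_borel_Icc] .

lemma rc_borel_empty [simp]: "{} \<in> rc_borel a b"
  unfolding rc_borel_def by simp (rule exI[of _ 1], rule exI[of _ 0], simp)

lemma Icc_subset_einterval: "x \<in> einterval a b \<Longrightarrow> y \<in> einterval a b \<Longrightarrow> {x..y} \<subseteq> einterval a b"
  unfolding einterval_iff
  by (meson atLeastAtMost_iff einterval_iff ereal_less_eq(3) less_le_trans le_less_trans subsetI)

lemma Icc_hull:
  assumes "{c..d} \<subseteq> einterval a b" "{c'..d'} \<subseteq> einterval a b"
  obtains e f where "{c..d} \<subseteq> {e..f}" "{c'..d'} \<subseteq> {e..f}" "{e..f} \<subseteq> einterval a b"
proof (cases "c \<le> d \<and> c' \<le> d'")
  case True
  then have "c \<in> einterval a b" "d \<in> einterval a b" "c' \<in> einterval a b" "d' \<in> einterval a b"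
    using assms by auto
  then have "{min c c'..max d d'} \<subseteq> einterval a b"
    by (intro Icc_subset_einterval) (auto simp: min_def max_def)
  then show ?thesis by (intro that[of "min c c'" "max d d'"]) auto
next
  case False
  then show ?thesis
    using that[of c d] that[of c' d'] assms by (cases "c \<le> d") auto
qed

lemma rc_borel_Un: "A \<in> rc_borel a b \<Longrightarrow> B \<in> rc_borel a b \<Longrightarrow> A \<union> B \<in> rc_borel a b"
proof -
  assume A: "A \<in> rc_borel a b" and B: "B \<in> rc_borel a b"
  obtain c d where cd: "A \<subseteq> {c..d}" "{c..d} \<subseteq> einterval a b" "A \<in> sets borel"
    using rc_borelE[OF A] .
  obtain c' d' where cd': "B \<subseteq> {c'..d'}" "{c'..d'} \<subseteq> einterval a b" "B \<in> sets borel"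
    using rc_borelE[OF B] .
  obtain e f where "{c..d} \<subseteq> {e..f}" "{c'..d'} \<subseteq> {e..f}" "{e..f} \<subseteq> einterval a b"
    using Icc_hull[OF cd(2) cd'(2)] .
  then show ?thesis
    using cd cd' by (intro rc_borel_in_Icc[of e f]) auto
qed

lemma rc_borel_Union: "finite P \<Longrightarrow> P \<subseteq> rc_borel a b \<Longrightarrow> \<Union>P \<in> rc_borel a b"
  by (induction P rule: finite_induct) (auto intro: rc_borel_Un)

lemma dist0_sums:
  assumes "dist0 a b q" "E \<in> rc_borel a b"
    and "\<And>i::nat. A i \<in> sets borel" "\<And>i. A i \<subseteq> E" "disjoint_family A"
  shows "(\<lambda>i. q (A i)) sums q (\<Union>i. A i)"
proof -
  obtain c d where cd: "E \<subseteq> {c..d}" "{c..d} \<subseteq> einterval a b"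
    using rc_borelE[OF assms(2)] by metis
  have "\<forall>i. A i \<in> sets borel \<and> A i \<subseteq> {c..d}"
    using assms(3,4) cd(1) by blast
  then show ?thesis
    using assms(1,5) cd(2) unfolding dist0_def by blast
qed

lemma dist0I:
  assumes "\<And>(A :: nat \<Rightarrow> real set). (\<And>i. A i \<in> sets borel) \<Longrightarrow> (\<Union>i. A i) \<in> rc_borel a b
     \<Longrightarrow> disjoint_family A \<Longrightarrow> (\<lambda>i. q (A i)) sums q (\<Union>i. A i)"
  shows "dist0 a b q"
  unfolding dist0_def
proof (intro allI impI)
  fix c d :: real and A :: "nat \<Rightarrow> real set"
  assume cd: "{c..d} \<subseteq> einterval a b" and A: "\<forall>i. A i \<in> sets borel \<and> A i \<subseteq> {c..d}"
    and disj: "disjoint_family A"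
  have "(\<Union>i. A i) \<in> rc_borel a b"
    by (rule rc_borel_in_Icc[OF cd]) (use A in auto)
  then show "(\<lambda>i. q (A i)) sums q (\<Union>i. A i)"
    using assms A disj by blast
qed

lemma dist0_empty:
  assumes "dist0 a b q"
  shows "q {} = 0"
proof -
  have "(\<lambda>i::nat. q {}) sums q {}"
    using dist0_sums[OF assms, of "{}" "\<lambda>i. {}"] by (simp add: disjoint_family_on_def)
  then have "(\<lambda>i::nat. q {}) \<longlonglongrightarrow> 0"
    using summable_LIMSEQ_zero sums_summable by blast
  then show ?thesis
    using LIMSEQ_unique tendsto_const by blast
qed

lemma dist0_Un:
  assumes q: "dist0 a b q" and A: "A \<in> rc_borel a b" and B: "B \<in> rc_borel a b"
    and disj: "A \<inter> B = {}"
  shows "q (A \<union> B) = q A + q B"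
proof -
  have "(\<lambda>i. q (binaryset A B i)) sums q (\<Union>i. binaryset A B i)"
  proof (rule dist0_sums[OF q rc_borel_Un[OF A B]])
    show "disjoint_family (binaryset A B)"
      using disj by (auto simp: disjoint_family_on_def binaryset_def)
    show "binaryset A B i \<in> sets borel" "binaryset A B i \<subseteq> A \<union> B" for i
      using A B by (auto simp: binaryset_def rc_borel_borel)
  qed
  then show ?thesis
    using binaryset_sums[of q, OF dist0_empty[OF q], of A B]
    by (simp add: UN_binaryset_eq sums_unique2)
qed

lemma dist0_Diff:
  assumes q: "dist0 a b q" and A: "A \<in> rc_borel a b" and B: "B \<in> sets borel" "B \<subseteq> A"
  shows "q (A - B) = q A - q B"
proof -
  have "q (B \<union> (A - B)) = q B + q (A - B)"
    by (rule dist0_Un[OF q])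
       (use A B rc_borel_borel[OF A] in \<open>auto intro: rc_borel_subset[OF A]\<close>)
  moreover have "B \<union> (A - B) = A" using B by auto
  ultimately show ?thesis by simp
qed

lemma dist0_Union:
  assumes q: "dist0 a b q" and "finite P" "disjoint P" "P \<subseteq> rc_borel a b"
  shows "q (\<Union>P) = (\<Sum>B\<in>P. q B)"
  using assms(2-)
proof (induction P rule: finite_induct)
  case empty
  then show ?case by (simp add: dist0_empty[OF q])
next
  case (insert B P)
  have "q (B \<union> \<Union>P) = q B + q (\<Union>P)"
  proof (rule dist0_Un[OF q])
    show "B \<inter> \<Union>P = {}"
      using insert.hyps insert.prems by (auto simp: disjoint_def pairwise_def disjnt_def)
    show "\<Union>P \<in> rc_borel a b"
      using insert.hyps insert.prems by (intro rc_borel_Union) auto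
  qed (use insert.prems in auto)
  moreover have "disjoint P"
    using insert.prems by (auto simp: disjoint_def pairwise_def)
  ultimately show ?case
    using insert by simp
qed

lemma dist0_bounded_linear:
  assumes "bounded_linear f" "dist0 a b q"
  shows "dist0 a b (\<lambda>A. f (q A))"
  using assms(2) bounded_linear.sums[OF assms(1)] unfolding dist0_def by blast

lemma dist0_add:
  assumes "dist0 a b p" "dist0 a b q"
  shows "dist0 a b (\<lambda>A. p A + q A)"
  using assms sums_add unfolding dist0_def by blast

lemma dist0_decseq:
  assumes q: "dist0 a b q" and A: "\<And>n::nat. A n \<in> rc_borel a b" "decseq A"
  shows "(\<lambda>n. q (A n)) \<longlonglongrightarrow> q (\<Inter>n. A n)"
proof -
  define B where "B n = A n - A (Suc n)" for n
  have borel: "A n \<in> sets borel" for n using A(1) by (rule rc_borel_borel)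
  have "(\<lambda>n. q (B n)) sums q (\<Union>n. B n)"
  proof (rule dist0_sums[OF q A(1)[of 0]])
    show "B n \<subseteq> A 0" for n
      using decseqD[OF A(2), of 0 n] by (auto simp: B_def)
    show "disjoint_family B"
      unfolding disjoint_family_on_def
    proof (intro ballI impI)
      fix m n :: nat assume "m \<noteq> n"
      then consider "Suc m \<le> n" | "Suc n \<le> m" by linarith
      then show "B m \<inter> B n = {}"
        by cases (use decseqD[OF A(2), of "Suc m" n] decseqD[OF A(2), of "Suc n" m] in \<open>auto simp: B_def\<close>)
    qed
  qed (use borel in \<open>auto simp: B_def\<close>)
  moreover have "(\<Union>n. B n) = A 0 - (\<Inter>n. A n)"
  proof
    show "A 0 - (\<Inter>n. A n) \<subseteq> (\<Union>n. B n)"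
    proof
      fix x assume x: "x \<in> A 0 - (\<Inter>n. A n)"
      then obtain n where n: "x \<notin> A n" by auto
      define k where "k = (LEAST n. x \<notin> A n)"
      have k: "x \<notin> A k" unfolding k_def using n by (rule LeastI)
      then obtain j where j: "k = Suc j" using x by (cases k) auto
      have "x \<in> A j" using not_less_Least[of j "\<lambda>n. x \<notin> A n"] by (simp add: k_def[symmetric] j)
      then show "x \<in> (\<Union>n. B n)" using k j by (auto simp: B_def)
    qed
    show "(\<Union>n. B n) \<subseteq> A 0 - (\<Inter>n. A n)"
      using decseqD[OF A(2), of 0] by (auto simp: B_def)
  qed
  moreover have "q (A 0 - (\<Inter>n. A n)) = q (A 0) - q (\<Inter>n. A n)"
    by (rule dist0_Diff[OF q A(1)]) (use borel in auto)
  ultimately have "(\<lambda>n. \<Sum>i<n. q (B i)) \<longlonglongrightarrow> q (A 0) - q (\<Inter>n. A n)"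
    by (simp add: sums_def)
  moreover have "(\<Sum>i<n. q (B i)) = q (A 0) - q (A n)" for n
  proof (induction n)
    case (Suc n)
    have "q (B n) = q (A n) - q (A (Suc n))"
      unfolding B_def by (rule dist0_Diff[OF q A(1) borel]) (use decseqD[OF A(2), of n "Suc n"] in auto)
    then show ?case using Suc by simp
  qed simp
  ultimately have "(\<lambda>n. q (A 0) - q (A n)) \<longlonglongrightarrow> q (A 0) - q (\<Inter>n. A n)"
    by simp
  from tendsto_diff[OF tendsto_const this, of "q (A 0)"] show ?thesis by simp
qed

section \<open>Extending non-negative set functions to measures\<close>

text \<open>The shape of the supremum is that of the measure \<open>tr w\<close>. The same extension turns a real set
  function into a measure after a multiple of a dominating measure has been added to it.\<close>

definition ext_measure :: "ereal \<Rightarrow> ereal \<Rightarrow> (real set \<Rightarrow> real) \<Rightarrow> real measure" where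
  "ext_measure a b m =
     measure_of (einterval a b) (borel_on a b)
       (\<lambda>A. SUP (c, d) \<in> {(c, d). {c..d} \<subseteq> einterval a b}. ennreal (m (A \<inter> {c..d})))"

lemma sets_ext_measure [simp]: "sets (ext_measure a b m) = borel_on a b"
proof -
  interpret sigma_algebra "einterval a b" "borel_on a b" by (rule sigma_algebra_borel_on)
  show "sets (ext_measure a b m) = borel_on a b"
    by (simp add: ext_measure_def)
qed

lemma emeasure_ext_measure:
  assumes m: "dist0 a b m" and nonneg: "\<And>A. A \<in> rc_borel a b \<Longrightarrow> 0 \<le> m A" and A: "A \<in> borel_on a b"
  shows "emeasure (ext_measure a b m) A =
    (SUP (c, d) \<in> {(c, d). {c..d} \<subseteq> einterval a b}. ennreal (m (A \<inter> {c..d})))"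
proof (rule emeasure_measure_of[OF ext_measure_def])
  let ?I = "{(c :: real, d). {c..d} \<subseteq> einterval a b}"
  let ?\<mu> = "\<lambda>A. SUP (c, d) \<in> ?I. ennreal (m (A \<inter> {c..d}))"
  show "borel_on a b \<subseteq> Pow (einterval a b)" by (auto simp: borel_on_iff)
  show "A \<in> sets (ext_measure a b m)" using A by simp
  have mono: "m A \<le> m B" if "A \<subseteq> B" "A \<in> sets borel" "B \<in> rc_borel a b" for A B
  proof -
    have "0 \<le> m (B - A)"
      by (intro nonneg rc_borel_subset[OF that(3)]) (use that rc_borel_borel in auto)
    then show ?thesis using dist0_Diff[OF m that(3,2,1)] by simp
  qed
  have rc: "B \<inter> {c..d} \<in> rc_borel a b" if "B \<in> borel_on a b" "{c..d} \<subseteq> einterval a b" for B and c d :: real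
    by (rule rc_borel_in_Icc[OF that(2)]) (use that in \<open>auto simp: borel_on_iff\<close>)
  show "positive (sets (ext_measure a b m)) ?\<mu>"
    unfolding positive_def by (simp add: dist0_empty[OF m] case_prod_unfold SUP_constant bot_ennreal)
  show "countably_additive (sets (ext_measure a b m)) ?\<mu>"
    unfolding countably_additive_def
  proof (intro allI impI)
    fix B :: "nat \<Rightarrow> real set"
    assume B: "range B \<subseteq> sets (ext_measure a b m)" and disj: "disjoint_family B"
    have B': "B i \<in> borel_on a b" for i using B by auto
    have "(\<Sum>i. ?\<mu> (B i)) = (SUP p \<in> ?I. \<Sum>i. ennreal (m (B i \<inter> {fst p..snd p})))"
      unfolding case_prod_unfold
    proof (rule ennreal_suminf_SUP_eq_directed)
      fix N :: "nat set" and p p' assume p: "p \<in> {p. {fst p..snd p} \<subseteq> einterval a b}" "p' \<in> {p. {fst p..snd p} \<subseteq> einterval a b}"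
      obtain e f where ef: "{fst p..snd p} \<subseteq> {e..f}" "{fst p'..snd p'} \<subseteq> {e..f}" "{e..f} \<subseteq> einterval a b"
        using Icc_hull[of "fst p" "snd p" a b "fst p'" "snd p'"] p by auto
      have "m (B n \<inter> {fst p..snd p}) \<le> m (B n \<inter> {e..f})"
        "m (B n \<inter> {fst p'..snd p'}) \<le> m (B n \<inter> {e..f})" for n
        by (intro mono rc[OF B' ef(3)]; use ef B'[of n] in \<open>auto simp: borel_on_iff\<close>)+
      then show "\<exists>k\<in>{p. {fst p..snd p} \<subseteq> einterval a b}. \<forall>n\<in>N. ennreal (m (B n \<inter> {fst p..snd p})) \<le> ennreal (m (B n \<inter> {fst k..snd k})) \<and>
          ennreal (m (B n \<inter> {fst p'..snd p'})) \<le> ennreal (m (B n \<inter> {fst k..snd k}))"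
        using ef(3) by (intro bexI[of _ "(e, f)"]) (auto intro!: ennreal_leI)
    qed
    also have "\<dots> = ?\<mu> (\<Union>i. B i)"
      unfolding case_prod_unfold
    proof (rule SUP_cong)
      fix p assume "p \<in> {p. {fst p..snd p} \<subseteq> einterval a b}"
      then have p: "{fst p..snd p} \<subseteq> einterval a b" by simp
      have "(\<lambda>i. m (B i \<inter> {fst p..snd p})) sums m (\<Union>i. B i \<inter> {fst p..snd p})"
      proof (rule dist0_sums[OF m rc_borel_Icc[OF p]])
        show "disjoint_family (\<lambda>i. B i \<inter> {fst p..snd p})"
          using disj by (auto simp: disjoint_family_on_def)
      qed (use B' in \<open>auto simp: borel_on_iff\<close>)
      then have "(\<Sum>i. ennreal (m (B i \<inter> {fst p..snd p}))) = ennreal (m (\<Union>i. B i \<inter> {fst p..snd p}))"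
        by (intro suminf_ennreal_eq nonneg rc[OF B' p])
      then show "(\<Sum>i. ennreal (m (B i \<inter> {fst p..snd p}))) = ennreal (m ((\<Union>i. B i) \<inter> {fst p..snd p}))"
        by simp
    qed simp
    finally show "(\<Sum>i. ?\<mu> (B i)) = ?\<mu> (\<Union>i. B i)" .
  qed
qed

lemma emeasure_ext_measure_rc:
  assumes m: "dist0 a b m" and nonneg: "\<And>A. A \<in> rc_borel a b \<Longrightarrow> 0 \<le> m A" and A: "A \<in> rc_borel a b"
  shows "emeasure (ext_measure a b m) A = ennreal (m A)"
proof -
  obtain c d where cd: "A \<subseteq> {c..d}" "{c..d} \<subseteq> einterval a b" "A \<in> sets borel"
    using rc_borelE[OF A] .
  have "m (A \<inter> {c'..d'}) \<le> m A" for c' d'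
  proof -
    have "0 \<le> m (A - A \<inter> {c'..d'})"
      by (intro nonneg rc_borel_subset[OF A]) (use cd in auto)
    then show ?thesis using dist0_Diff[OF m A, of "A \<inter> {c'..d'}"] cd by simp
  qed
  then have "(SUP (c, d) \<in> {(c, d). {c..d} \<subseteq> einterval a b}. ennreal (m (A \<inter> {c..d}))) \<le> ennreal (m A)"
    by (intro SUP_least) (auto intro!: ennreal_leI)
  moreover have "ennreal (m (A \<inter> {c..d})) \<le> (SUP (c, d) \<in> {(c, d). {c..d} \<subseteq> einterval a b}. ennreal (m (A \<inter> {c..d})))"
    by (intro SUP_upper2[of "(c, d)"]) (use cd in auto)
  moreover have "A \<inter> {c..d} = A" using cd by auto
  ultimately have "(SUP (c, d) \<in> {(c, d). {c..d} \<subseteq> einterval a b}. ennreal (m (A \<inter> {c..d}))) = ennreal (m A)"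
    by (intro antisym) simp_all
  then show ?thesis
    using emeasure_ext_measure[OF m _ rc_borel_in_sets[OF A]] nonneg by simp
qed

section \<open>Total variation\<close>

definition tv :: "ereal \<Rightarrow> ereal \<Rightarrow> (real set \<Rightarrow> 'v::real_normed_vector) \<Rightarrow> real set \<Rightarrow> ennreal" where
  "tv a b q A = (SUP P \<in> {P. finite P \<and> disjoint P \<and> P \<subseteq> rc_borel a b \<and> \<Union>P \<subseteq> A}.
     \<Sum>B\<in>P. ennreal (norm (q B)))"

lemma tv_upper:
  "finite P \<Longrightarrow> disjoint P \<Longrightarrow> P \<subseteq> rc_borel a b \<Longrightarrow> \<Union>P \<subseteq> A \<Longrightarrow> (\<Sum>B\<in>P. ennreal (norm (q B))) \<le> tv a b q A"
  unfolding tv_def by (rule SUP_upper) auto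

lemma tv_least:
  assumes "\<And>P. finite P \<Longrightarrow> disjoint P \<Longrightarrow> P \<subseteq> rc_borel a b \<Longrightarrow> \<Union>P \<subseteq> A \<Longrightarrow> (\<Sum>B\<in>P. ennreal (norm (q B))) \<le> z"
  shows "tv a b q A \<le> z"
  unfolding tv_def by (rule SUP_least) (use assms in auto)

lemma norm_le_tv: "A \<in> rc_borel a b \<Longrightarrow> ennreal (norm (q A)) \<le> tv a b q A"
  using tv_upper[of "{A}" a b A q] by simp

lemma tv_mono: "A \<subseteq> B \<Longrightarrow> tv a b q A \<le> tv a b q B"
  by (rule tv_least) (rule tv_upper, auto)

lemma tv_superadditive:
  assumes q: "dist0 a b q" and disj: "A \<inter> B = {}"
  shows "tv a b q A + tv a b q B \<le> tv a b q (A \<union> B)"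
proof -
  let ?S = "\<lambda>A. {P. finite P \<and> disjoint P \<and> P \<subseteq> rc_borel a b \<and> \<Union>P \<subseteq> A}"
  let ?f = "\<lambda>P. \<Sum>B\<in>P. ennreal (norm (q B))"
  have ne: "?S A \<noteq> {}" "?S B \<noteq> {}" by (auto intro!: exI[of _ "{}"])
  have "?f P + ?f Q \<le> tv a b q (A \<union> B)" if P: "P \<in> ?S A" and Q: "Q \<in> ?S B" for P Q
  proof -
    have "P \<inter> Q \<subseteq> {{}}" using P Q disj by blast
    then have "?f (P \<inter> Q) = 0"
      by (intro sum.neutral) (auto simp: dist0_empty[OF q])
    then have "?f P + ?f Q = ?f (P \<union> Q)"
      using sum.union_inter[of P Q "\<lambda>B. ennreal (norm (q B))"] P Q by simp
    also have "\<dots> \<le> tv a b q (A \<union> B)"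
    proof (rule tv_upper)
      show "disjoint (P \<union> Q)"
        unfolding disjoint_def
      proof (intro ballI impI)
        have PP: "S \<inter> T = {}" if "S \<in> P" "T \<in> P" "S \<noteq> T" for S T
          using P that by (auto simp: disjoint_def)
        have QQ: "S \<inter> T = {}" if "S \<in> Q" "T \<in> Q" "S \<noteq> T" for S T
          using Q that by (auto simp: disjoint_def)
        have PQ: "S \<inter> T = {}" "T \<inter> S = {}" if "S \<in> P" "T \<in> Q" for S T
          using P Q that disj by blast+
        fix S T assume "S \<in> P \<union> Q" "T \<in> P \<union> Q" "S \<noteq> T"
        then show "S \<inter> T = {}"
          by (elim UnE) (simp_all add: PP QQ PQ)
      qed
    qed (use P Q in auto)
    finally show ?thesis .
  qed
  note * = this
  have "?f P + tv a b q B \<le> tv a b q (A \<union> B)" if "P \<in> ?S A" for P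
  proof -
    have "?f P + tv a b q B = (SUP Q\<in>?S B. ?f P + ?f Q)"
      unfolding tv_def by (rule ennreal_SUP_add_right[OF ne(2)])
    also have "\<dots> \<le> tv a b q (A \<union> B)"
      by (rule SUP_least) (rule *[OF that])
    finally show ?thesis .
  qed
  note ** = this
  have "tv a b q A + tv a b q B = (SUP P\<in>?S A. ?f P + tv a b q B)"
    unfolding tv_def[of a b q A] by (rule ennreal_SUP_add_left[OF ne(1), symmetric])
  also have "\<dots> \<le> tv a b q (A \<union> B)"
    by (rule SUP_least) (rule **)
  finally show ?thesis .
qed

text \<open>Every member of a partition of the union is cut along the sets \<open>A i\<close>. Distinct members may have
  the same trace on some \<open>A i\<close>, but then it is empty.\<close>

lemma tv_countably_subadditive:
  fixes q :: "real set \<Rightarrow> 'v::banach"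
  assumes q: "dist0 a b q" and A: "\<And>i::nat. A i \<in> sets borel" and disj: "disjoint_family A"
  shows "tv a b q (\<Union>i. A i) \<le> (\<Sum>i. tv a b q (A i))"
proof (rule tv_least)
  fix P assume P: "finite P" "disjoint P" "P \<subseteq> rc_borel a b" "\<Union>P \<subseteq> (\<Union>i. A i)"
  have "ennreal (norm (q B)) \<le> (\<Sum>i. ennreal (norm (q (B \<inter> A i))))" if "B \<in> P" for B
  proof (cases "(\<Sum>i. ennreal (norm (q (B \<inter> A i)))) = top")
    case False
    have B: "B \<in> rc_borel a b" using P that by auto
    have "(\<lambda>i. q (B \<inter> A i)) sums q (\<Union>i. B \<inter> A i)"
    proof (rule dist0_sums[OF q B])
      show "disjoint_family (\<lambda>i. B \<inter> A i)"
        using disj by (auto simp: disjoint_family_on_def)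
    qed (use A rc_borel_borel[OF B] in auto)
    moreover have "(\<Union>i. B \<inter> A i) = B" using P(4) that by auto
    ultimately have "q B = (\<Sum>i. q (B \<inter> A i))" by (simp add: sums_iff)
    moreover have "summable (\<lambda>i. norm (q (B \<inter> A i)))"
      by (rule summable_suminf_not_top) (use False in auto)
    ultimately have "ennreal (norm (q B)) \<le> ennreal (\<Sum>i. norm (q (B \<inter> A i)))"
      by (auto intro!: ennreal_leI summable_norm)
    then show ?thesis
      using False by simp
  qed simp
  then have "(\<Sum>B\<in>P. ennreal (norm (q B))) \<le> (\<Sum>B\<in>P. \<Sum>i. ennreal (norm (q (B \<inter> A i))))"
    by (rule sum_mono)
  also have "\<dots> = (\<Sum>i. \<Sum>B\<in>P. ennreal (norm (q (B \<inter> A i))))"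
    by (rule suminf_sum[symmetric]) simp
  also have "\<dots> \<le> (\<Sum>i. tv a b q (A i))"
  proof (intro suminf_le allI summableI)
    fix i
    have "(\<Sum>B\<in>(\<lambda>B. B \<inter> A i) ` P. ennreal (norm (q B))) = (\<Sum>B\<in>P. ennreal (norm (q (B \<inter> A i))))"
    proof (subst sum.reindex_nontrivial[OF P(1)])
      fix B C assume "B \<in> P" "C \<in> P" "B \<noteq> C" "B \<inter> A i = C \<inter> A i"
      then have "B \<inter> A i = {}"
        using P(2) by (auto simp: disjoint_def)
      then show "ennreal (norm (q (B \<inter> A i))) = 0" by (simp add: dist0_empty[OF q])
    qed simp
    moreover have "(\<Sum>B\<in>(\<lambda>B. B \<inter> A i) ` P. ennreal (norm (q B))) \<le> tv a b q (A i)"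
    proof (rule tv_upper)
      show "disjoint ((\<lambda>B. B \<inter> A i) ` P)"
        using P(2) unfolding disjoint_def by blast
      show "(\<lambda>B. B \<inter> A i) ` P \<subseteq> rc_borel a b"
      proof
        fix C assume "C \<in> (\<lambda>B. B \<inter> A i) ` P"
        then obtain B where B: "B \<in> rc_borel a b" "C = B \<inter> A i" using P(3) by auto
        show "C \<in> rc_borel a b"
          unfolding B(2) using A[of i] rc_borel_borel[OF B(1)] by (intro rc_borel_subset[OF B(1)]) auto
      qed
    qed (use P in auto)
    ultimately show "(\<Sum>B\<in>P. ennreal (norm (q (B \<inter> A i)))) \<le> tv a b q (A i)" by simp
  qed
  finally show "(\<Sum>B\<in>P. ennreal (norm (q B))) \<le> (\<Sum>i. tv a b q (A i))" .
qed

lemma total_variation_eq: "total_variation a b q = measure_of (einterval a b) (borel_on a b) (tv a b q)"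
  unfolding total_variation_def tv_def[abs_def] ..

lemma space_total_variation [simp]: "space (total_variation a b q) = einterval a b"
  and sets_total_variation [simp]: "sets (total_variation a b q) = borel_on a b"
proof -
  interpret sigma_algebra "einterval a b" "borel_on a b" by (rule sigma_algebra_borel_on)
  show "space (total_variation a b q) = einterval a b" "sets (total_variation a b q) = borel_on a b"
    by (simp_all add: total_variation_eq)
qed

lemma emeasure_total_variation:
  fixes q :: "real set \<Rightarrow> 'v::banach"
  assumes q: "dist0 a b q" and A: "A \<in> borel_on a b"
  shows "emeasure (total_variation a b q) A = tv a b q A"
proof (rule emeasure_measure_of[OF total_variation_eq])
  show "borel_on a b \<subseteq> Pow (einterval a b)" by (auto simp: borel_on_iff)
  show "A \<in> sets (total_variation a b q)" using A by simp
  have empty: "tv a b q {} = 0"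
  proof -
    have "tv a b q {} \<le> 0"
    proof (rule tv_least)
      fix P assume "\<Union>P \<subseteq> ({} :: real set)"
      then have "(\<Sum>B\<in>P. ennreal (norm (q B))) = 0"
        by (intro sum.neutral) (auto simp: dist0_empty[OF q])
      then show "(\<Sum>B\<in>P. ennreal (norm (q B))) \<le> 0" by simp
    qed
    then show ?thesis by simp
  qed
  then show "positive (sets (total_variation a b q)) (tv a b q)"
    by (simp add: positive_def)
  show "countably_additive (sets (total_variation a b q)) (tv a b q)"
    unfolding countably_additive_def
  proof (intro allI impI)
    fix B :: "nat \<Rightarrow> real set"
    assume B: "range B \<subseteq> sets (total_variation a b q)" and disj: "disjoint_family B"
    have B': "B i \<in> sets borel" for i
    proof -
      have "B i \<in> borel_on a b" using B by auto
      then show ?thesis by (simp add: borel_on_iff)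
    qed
    have "(\<Sum>i<n. tv a b q (B i)) \<le> tv a b q (\<Union>i<n. B i)" for n
    proof (induction n)
      case 0 show ?case by simp
    next
      case (Suc n)
      have "(\<Union>i<n. B i) \<inter> B n = {}"
      proof -
        have "B i \<inter> B n = {}" if "i < n" for i
          using disjoint_family_onD[OF disj, of i n] that by simp
        then show ?thesis by auto
      qed
      then have "tv a b q (\<Union>i<n. B i) + tv a b q (B n) \<le> tv a b q ((\<Union>i<n. B i) \<union> B n)"
        by (rule tv_superadditive[OF q])
      moreover have "(\<Union>i<n. B i) \<union> B n = (\<Union>i<Suc n. B i)"
        by (auto simp: lessThan_Suc)
      ultimately have "tv a b q (\<Union>i<n. B i) + tv a b q (B n) \<le> tv a b q (\<Union>i<Suc n. B i)"
        by simp
      from order_trans[OF add_right_mono[OF Suc] this] show ?case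
        by (simp only: sum.lessThan_Suc)
    qed
    also have "tv a b q (\<Union>i<n. B i) \<le> tv a b q (\<Union>i. B i)" for n
      by (rule tv_mono) auto
    finally have "(\<Sum>i. tv a b q (B i)) \<le> tv a b q (\<Union>i. B i)"
      by (intro suminf_le_const) auto
    then show "(\<Sum>i. tv a b q (B i)) = tv a b q (\<Union>i. B i)"
      using tv_countably_subadditive[OF q B' disj] by (rule antisym)
  qed
qed

text \<open>If the variation over \<open>E\<close> is infinite, then a partition carries a coordinate sum that
  dominates \<open>norm (q E)\<close>; so both halves of the resulting splitting of \<open>E\<close> have large values,
  and at least one half still has infinite variation.\<close>

lemma tv_infinite_split:
  fixes q :: "real set \<Rightarrow> 'v::euclidean_space"
  assumes q: "dist0 a b q" and E: "E \<in> rc_borel a b" and inf: "tv a b q E = \<infinity>"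
  shows "\<exists>F. F \<in> rc_borel a b \<and> F \<subseteq> E \<and> tv a b q F = \<infinity> \<and> norm (q (E - F)) > 1"
proof -
  define T where "T = 1 + norm (q E)"
  have T: "T > 0" "T \<ge> 1" unfolding T_def by (auto intro: add_pos_nonneg)
  have "ennreal (real DIM('v) * (2 * T)) < tv a b q E"
    using inf by simp
  then obtain P where P: "finite P" "disjoint P" "P \<subseteq> rc_borel a b" "\<Union>P \<subseteq> E"
    and big: "ennreal (real DIM('v) * (2 * T)) < (\<Sum>B\<in>P. ennreal (norm (q B)))"
    unfolding tv_def less_SUP_iff by auto
  have "real DIM('v) * (2 * T) < (\<Sum>B\<in>P. norm (q B))"
    using big T by (simp add: ennreal_less_iff)
  also have "\<dots> \<le> (\<Sum>B\<in>P. \<Sum>e\<in>Basis. \<bar>q B \<bullet> e\<bar>)"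
    by (intro sum_mono norm_le_l1)
  also have "\<dots> = (\<Sum>e\<in>Basis. \<Sum>B\<in>P. \<bar>q B \<bullet> e\<bar>)"
    by (rule sum.swap)
  finally have "\<exists>e\<in>Basis. 2 * T < (\<Sum>B\<in>P. \<bar>q B \<bullet> e\<bar>)"
    using sum_bounded_above[of "Basis :: 'v set" "\<lambda>e. \<Sum>B\<in>P. \<bar>q B \<bullet> e\<bar>" "2 * T"] by force
  then obtain e :: 'v where e: "e \<in> Basis" "2 * T < (\<Sum>B\<in>P. \<bar>q B \<bullet> e\<bar>)" by blast
  define P1 where "P1 = {B \<in> P. 0 \<le> q B \<bullet> e}"
  define P2 where "P2 = {B \<in> P. \<not> 0 \<le> q B \<bullet> e}"
  have "(\<Sum>B\<in>P. \<bar>q B \<bullet> e\<bar>) = (\<Sum>B\<in>P1. \<bar>q B \<bullet> e\<bar>) + (\<Sum>B\<in>P2. \<bar>q B \<bullet> e\<bar>)"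
    unfolding P1_def P2_def using P(1)
    by (subst sum.union_disjoint[symmetric]) (auto intro: sum.cong)
  also have "(\<Sum>B\<in>P1. \<bar>q B \<bullet> e\<bar>) = (\<Sum>B\<in>P1. q B \<bullet> e)"
    by (rule sum.cong) (auto simp: P1_def)
  also have "(\<Sum>B\<in>P2. \<bar>q B \<bullet> e\<bar>) = - (\<Sum>B\<in>P2. q B \<bullet> e)"
    unfolding sum_negf[symmetric] by (rule sum.cong) (auto simp: P2_def)
  finally have "\<bar>\<Sum>B\<in>P1. q B \<bullet> e\<bar> > T \<or> \<bar>\<Sum>B\<in>P2. q B \<bullet> e\<bar> > T"
    using e(2) by linarith
  moreover have sub: "P1 \<subseteq> P" "P2 \<subseteq> P" by (auto simp: P1_def P2_def)
  ultimately have "\<exists>Q. Q \<subseteq> P \<and> \<bar>\<Sum>B\<in>Q. q B \<bullet> e\<bar> > T"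
    by (elim disjE) (rule exI[of _ P1], simp, rule exI[of _ P2], simp)
  then obtain Q where Q: "Q \<subseteq> P" "\<bar>\<Sum>B\<in>Q. q B \<bullet> e\<bar> > T"
    by (elim exE conjE)
  define A where "A = \<Union>Q"
  have A: "A \<in> rc_borel a b" "A \<subseteq> E"
    unfolding A_def using Q P by (auto intro!: rc_borel_Union finite_subset[OF Q(1) P(1)])
  have "q A = (\<Sum>B\<in>Q. q B)"
    unfolding A_def using Q P
    by (intro dist0_Union[OF q] finite_subset[OF Q(1) P(1)] pairwise_subset[OF P(2) Q(1)]) auto
  then have "q A \<bullet> e = (\<Sum>B\<in>Q. q B \<bullet> e)" by (simp add: inner_sum_left)
  then have nA: "norm (q A) > T"
    using Q(2) Basis_le_norm[OF e(1), of "q A"] by linarith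
  have qd: "q (E - A) = q E - q A"
    by (rule dist0_Diff[OF q E rc_borel_borel[OF A(1)] A(2)])
  have "norm (q A) \<le> norm (q E) + norm (q (E - A))"
    unfolding qd using norm_triangle_sub[of "q A" "q E"] by (simp add: norm_minus_commute)
  then have nEA: "norm (q (E - A)) > 1"
    using nA unfolding T_def by linarith
  have EA: "E - A \<in> rc_borel a b"
    by (rule rc_borel_subset[OF E]) (use rc_borel_borel E A in auto)
  have "emeasure (total_variation a b q) (A \<union> (E - A)) \<le>
      emeasure (total_variation a b q) A + emeasure (total_variation a b q) (E - A)"
    by (rule emeasure_subadditive) (use A EA in \<open>auto intro: rc_borel_in_sets\<close>)
  moreover have "A \<union> (E - A) = E" using A by auto
  ultimately have "\<infinity> \<le> tv a b q A + tv a b q (E - A)"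
    using A E EA inf by (simp add: emeasure_total_variation[OF q] rc_borel_in_sets)
  then have "tv a b q A = \<infinity> \<or> tv a b q (E - A) = \<infinity>"
    by (simp add: top_unique ennreal_add_eq_top)
  then show ?thesis
  proof
    assume "tv a b q A = \<infinity>"
    then show ?thesis using A nEA by blast
  next
    assume "tv a b q (E - A) = \<infinity>"
    moreover have "E - (E - A) = A" using A by auto
    ultimately show ?thesis using EA nA T by (intro exI[of _ "E - A"]) auto
  qed
qed

text \<open>Repeated splitting would give a decreasing sequence of sets whose successive differences all have
  values of norm larger than one, although the values along a decreasing sequence converge.\<close>

lemma tv_finite:
  fixes q :: "real set \<Rightarrow> 'v::euclidean_space"
  assumes q: "dist0 a b q" and E: "E \<in> rc_borel a b"
  shows "tv a b q E < \<infinity>"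
proof (rule ccontr)
  assume "\<not> ?thesis"
  then have inf: "tv a b q E = \<infinity>" by (simp add: less_top[symmetric])
  have "\<exists>F. \<forall>n. (F n \<in> rc_borel a b \<and> F n \<subseteq> E \<and> tv a b q (F n) = \<infinity>) \<and>
      (F (Suc n) \<subseteq> F n \<and> norm (q (F n - F (Suc n))) > 1)"
  proof (rule dependent_nat_choice)
    show "\<exists>F. F \<in> rc_borel a b \<and> F \<subseteq> E \<and> tv a b q F = \<infinity>"
      using E inf by blast
    fix F and n :: nat assume "F \<in> rc_borel a b \<and> F \<subseteq> E \<and> tv a b q F = \<infinity>"
    then show "\<exists>G. (G \<in> rc_borel a b \<and> G \<subseteq> E \<and> tv a b q G = \<infinity>) \<and> (G \<subseteq> F \<and> norm (q (F - G)) > 1)"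
      using tv_infinite_split[OF q, of F] by blast
  qed
  then obtain F where F: "\<And>n. F n \<in> rc_borel a b" "\<And>n. F (Suc n) \<subseteq> F n"
    "\<And>n. norm (q (F n - F (Suc n))) > 1" by metis
  have dec: "decseq F" using F(2) by (simp add: decseq_Suc_iff)
  from dist0_decseq[OF q F(1) dec] have lim: "(\<lambda>n. q (F n)) \<longlonglongrightarrow> q (\<Inter>n. F n)" .
  have "(\<lambda>n. q (F n) - q (F (Suc n))) \<longlonglongrightarrow> q (\<Inter>n. F n) - q (\<Inter>n. F n)"
    by (intro tendsto_diff lim LIMSEQ_Suc)
  moreover have "q (F n - F (Suc n)) = q (F n) - q (F (Suc n))" for n
    by (rule dist0_Diff[OF q F(1) rc_borel_borel[OF F(1)] F(2)])
  ultimately have "(\<lambda>n. norm (q (F n - F (Suc n)))) \<longlonglongrightarrow> 0"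
    by (simp add: tendsto_norm_zero)
  then have "\<forall>\<^sub>F n in sequentially. norm (q (F n - F (Suc n))) < 1"
    by (rule order_tendstoD) simp
  then show False
    using F(3) by (auto simp: eventually_sequentially not_less[symmetric] dest: less_asym)
qed

section \<open>Densities with respect to locally finite measures\<close>

locale rc_measure =
  fixes a b :: ereal and M :: "real measure"
  assumes ab: "a < b" and sets_M: "sets M = borel_on a b"
    and finite_rc: "A \<in> rc_borel a b \<Longrightarrow> emeasure M A < \<infinity>"
begin

lemma space_M: "space M = einterval a b"
  using sets_eq_imp_space_eq[OF sets_M] by (simp add: space_restrict_space)

lemma rc_in_sets [intro]: "A \<in> rc_borel a b \<Longrightarrow> A \<in> sets M"
  by (simp add: sets_M rc_borel_in_sets)

lemma exhaustion:
  "\<exists>K :: nat \<Rightarrow> real set. (\<forall>i. K i \<in> rc_borel a b) \<and> (\<Union>i. K i) = einterval a b"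
proof -
  obtain u l :: "nat \<Rightarrow> real" where "einterval a b = (\<Union>i. {l i .. u i})"
    using einterval_Icc_approximation[OF ab] by metis
  then show ?thesis
    by (intro exI[of _ "\<lambda>i. {l i .. u i}"]) (auto intro: rc_borel_Icc)
qed

lemma sigma_finite: "sigma_finite_measure M"
proof
  obtain K :: "nat \<Rightarrow> real set" where K: "\<And>i. K i \<in> rc_borel a b" "(\<Union>i. K i) = einterval a b"
    using exhaustion by blast
  show "\<exists>A. countable A \<and> A \<subseteq> sets M \<and> \<Union>A = space M \<and> (\<forall>B\<in>A. emeasure M B \<noteq> \<infinity>)"
    using K finite_rc by (intro exI[of _ "range K"]) (auto simp: space_M less_top)
qed

lemma AE_rcI:
  assumes "\<And>K. K \<in> rc_borel a b \<Longrightarrow> AE x in M. x \<in> K \<longrightarrow> P x"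
  shows "AE x in M. P x"
proof -
  obtain K :: "nat \<Rightarrow> real set" where K: "\<And>i. K i \<in> rc_borel a b" "(\<Union>i. K i) = einterval a b"
    using exhaustion by blast
  have "AE x in M. \<forall>i. x \<in> K i \<longrightarrow> P x"
    unfolding AE_all_countable using assms K(1) by blast
  then show ?thesis
    by (rule AE_mp) (rule AE_I2, use K(2) in \<open>auto simp: space_M\<close>)
qed

lemma dist0_measure: "dist0 a b (measure M)"
proof (rule dist0I)
  fix A :: "nat \<Rightarrow> real set"
  assume A: "\<And>i. A i \<in> sets borel" "(\<Union>i. A i) \<in> rc_borel a b" "disjoint_family A"
  have "A i \<in> rc_borel a b" for i
    by (rule rc_borel_subset[OF A(2) A(1)]) auto
  then show "(\<lambda>i. measure M (A i)) sums measure M (\<Union>i. A i)"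
    using A(3) finite_rc[OF A(2)] by (intro measure_UNION) auto
qed

lemma set_integrable_const_rc:
  fixes c :: "'v::{banach, second_countable_topology}"
  shows "A \<in> rc_borel a b \<Longrightarrow> set_integrable M A (\<lambda>x. c)"
  unfolding set_integrable_def using finite_rc by (intro integrable_indicator) auto

lemma set_integral_const_rc:
  fixes c :: "'v::{banach, second_countable_topology}"
  shows "A \<in> rc_borel a b \<Longrightarrow> (LINT x:A|M. c) = measure M A *\<^sub>R c"
  using finite_rc by (intro set_integral_const) (auto simp: less_top)

lemma dist0_set_integral:
  fixes f :: "real \<Rightarrow> 'v::{banach, second_countable_topology}"
  assumes f: "\<And>A. A \<in> rc_borel a b \<Longrightarrow> set_integrable M A f"
  shows "dist0 a b (\<lambda>A. LINT x:A|M. f x)"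
proof (rule dist0I)
  fix A :: "nat \<Rightarrow> real set"
  assume A: "\<And>i. A i \<in> sets borel" "(\<Union>i. A i) \<in> rc_borel a b" "disjoint_family A"
  have rc: "A i \<in> rc_borel a b" for i
    by (rule rc_borel_subset[OF A(2) A(1)]) auto
  define U where "U n = (\<Union>i<n. A i)" for n
  have U: "(\<Union>n. U n) = (\<Union>i. A i)" unfolding U_def by auto
  have "(\<lambda>n. LINT x:U n|M. f x) \<longlonglongrightarrow> (LINT x:(\<Union>n. U n)|M. f x)"
  proof (rule set_integral_cont_up)
    show "incseq U" unfolding U_def incseq_def by (intro allI impI UN_mono) auto
    show "set_integrable M (\<Union>n. U n) f" unfolding U by (rule f[OF A(2)])
    show "U n \<in> sets M" for n unfolding U_def using rc by auto
  qed
  moreover have "(LINT x:U n|M. f x) = (\<Sum>i<n. LINT x:A i|M. f x)" for n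
    unfolding U_def
    by (rule set_integral_finite_Union)
       (use A(3) rc f in \<open>auto simp: disjoint_family_on_def\<close>)
  ultimately show "(\<lambda>i. LINT x:A i|M. f x) sums (LINT x:(\<Union>i. A i)|M. f x)"
    by (simp add: sums_def U)
qed

lemma set_integrable_matrix_vector:
  fixes h :: "real \<Rightarrow> complex^'n^'m"
  assumes [measurable]: "h \<in> borel_measurable M" "u \<in> borel_measurable M"
    and A: "A \<in> rc_borel a b" and h: "set_integrable M A h" and S: "\<And>x. x \<in> A \<Longrightarrow> norm (u x) \<le> S"
  shows "set_integrable M A (\<lambda>x. h x *v u x)"
proof -
  have [measurable]: "A \<in> sets M" using rc_in_sets[OF A] .
  show ?thesis
    unfolding set_integrable_def
  proof (rule Bochner_Integration.integrable_bound)
    show "integrable M (\<lambda>x. S * norm (indicator A x *\<^sub>R h x))"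
      using h by (intro integrable_mult_right integrable_norm) (simp add: set_integrable_def)
    show "AE x in M. norm (indicator A x *\<^sub>R (h x *v u x)) \<le> norm (S * norm (indicator A x *\<^sub>R h x))"
    proof (rule AE_I2)
      fix x
      show "norm (indicator A x *\<^sub>R (h x *v u x)) \<le> norm (S * norm (indicator A x *\<^sub>R h x))"
      proof (cases "x \<in> A")
        case True
        have "norm (h x *v u x) \<le> norm (h x) * norm (u x)" by (rule norm_matrix_vector_le)
        also have "\<dots> \<le> norm (h x) * \<bar>S\<bar>" using S[OF True] by (intro mult_left_mono) auto
        finally show ?thesis using True by (simp add: abs_mult mult.commute)
      qed simp
    qed
  qed measurable
qed

text \<open>The set function \<open>C M + r\<close> is non-negative, so it extends to a measure that is absolutely continuous
  with respect to \<open>M\<close>, and the Radon--Nikodym theorem for measures applies to it.\<close>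

lemma real_density_exists:
  fixes r :: "real set \<Rightarrow> real"
  assumes r: "dist0 a b r" and le: "\<And>A. A \<in> rc_borel a b \<Longrightarrow> \<bar>r A\<bar> \<le> C * measure M A"
  shows "\<exists>h\<in>borel_measurable M. \<forall>A\<in>rc_borel a b. set_integrable M A h \<and> r A = (LINT x:A|M. h x)"
proof -
  define m where "m A = C * measure M A + r A" for A
  have m: "dist0 a b m"
    unfolding m_def
    by (intro dist0_add dist0_bounded_linear[OF bounded_linear_mult_right] dist0_measure r)
  have nonneg: "0 \<le> m A" if "A \<in> rc_borel a b" for A
    using le[OF that] by (simp add: m_def)
  define N where "N = ext_measure a b m"
  have N: "emeasure N A = ennreal (m A)" if "A \<in> rc_borel a b" for A
    unfolding N_def by (rule emeasure_ext_measure_rc[OF m nonneg that])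
  have "absolutely_continuous M N"
    unfolding absolutely_continuous_def
  proof
    fix A assume A: "A \<in> null_sets M"
    then have A': "A \<in> borel_on a b" by (auto simp: sets_M[symmetric])
    have "ennreal (m (A \<inter> {c..d})) = 0" if "{c..d} \<subseteq> einterval a b" for c d
    proof -
      have rc: "A \<inter> {c..d} \<in> rc_borel a b"
        by (rule rc_borel_in_Icc[OF that]) (use A' in \<open>auto simp: borel_on_iff\<close>)
      have "A \<inter> {c..d} \<in> null_sets M"
        by (rule null_set_Int2[OF A]) (rule rc_in_sets[OF rc_borel_Icc[OF that]])
      then have "measure M (A \<inter> {c..d}) = 0" by (simp add: measure_eq_0_null_sets)
      then show ?thesis using le[OF rc] by (simp add: m_def)
    qed
    moreover have "emeasure N A = (SUP (c, d) \<in> {(c, d). {c..d} \<subseteq> einterval a b}. ennreal (m (A \<inter> {c..d})))"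
      unfolding N_def by (rule emeasure_ext_measure[OF m nonneg A'])
    ultimately have "emeasure N A \<le> 0"
      by (simp add: case_prod_unfold SUP_constant bot_ennreal)
    then show "A \<in> null_sets N"
      using A' by (auto simp: null_sets_def N_def)
  qed
  then obtain f where f: "f \<in> borel_measurable M" and dens: "density M f = N"
    using sigma_finite_measure.Radon_Nikodym[OF sigma_finite, of N]
    by (auto simp: N_def sets_M)
  define h where "h x = enn2real (f x) - C" for x
  have "set_integrable M A h \<and> r A = (LINT x:A|M. h x)" if A: "A \<in> rc_borel a b" for A
  proof -
    have fin: "(\<integral>\<^sup>+x. f x * indicator A x \<partial>M) = ennreal (m A)"
      using N[OF A] rc_in_sets[OF A] f by (simp add: dens[symmetric] emeasure_density)
    have "AE x in M. f x * indicator A x \<noteq> \<infinity>"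
      by (rule nn_integral_noteq_infinite) (use fin f rc_in_sets[OF A] in auto)
    then have "AE x in M. ennreal (indicator A x * enn2real (f x)) = f x * indicator A x"
      by eventually_elim (auto simp: indicator_def less_top)
    then have "(\<integral>\<^sup>+x. ennreal (indicator A x * enn2real (f x)) \<partial>M) = ennreal (m A)"
      unfolding fin[symmetric] by (rule nn_integral_cong_AE)
    then have "has_bochner_integral M (\<lambda>x. indicator A x * enn2real (f x)) (m A)"
      by (intro has_bochner_integral_nn_integral)
         (use f rc_in_sets[OF A] nonneg[OF A] in auto)
    then have 1: "set_integrable M A (\<lambda>x. enn2real (f x))" "(LINT x:A|M. enn2real (f x)) = m A"
      by (auto simp: set_integrable_def set_lebesgue_integral_def has_bochner_integral_iff)
    show ?thesis
      unfolding h_def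
      using set_integral_diff[OF 1(1) set_integrable_const_rc[OF A, of C]] 1(2)
        set_integral_const_rc[OF A, of C]
      by (simp add: m_def mult.commute)
  qed
  moreover have "h \<in> borel_measurable M" unfolding h_def using f by measurable
  ultimately show ?thesis by blast
qed

lemma density_exists:
  fixes r :: "real set \<Rightarrow> 'v::euclidean_space"
  assumes r: "dist0 a b r" and le: "\<And>A. A \<in> rc_borel a b \<Longrightarrow> norm (r A) \<le> C * measure M A"
  shows "\<exists>h\<in>borel_measurable M. \<forall>A\<in>rc_borel a b. set_integrable M A h \<and> r A = (LINT x:A|M. h x)"
proof -
  have "\<exists>h\<in>borel_measurable M. \<forall>A\<in>rc_borel a b. set_integrable M A h \<and> r A \<bullet> e = (LINT x:A|M. h x)"
    if "e \<in> Basis" for e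
  proof (rule real_density_exists)
    show "dist0 a b (\<lambda>A. r A \<bullet> e)"
      by (rule dist0_bounded_linear[OF bounded_linear_inner_left r])
    show "\<bar>r A \<bullet> e\<bar> \<le> C * measure M A" if "A \<in> rc_borel a b" for A
      using Basis_le_norm[OF \<open>e \<in> Basis\<close>, of "r A"] le[OF that] by linarith
  qed
  then obtain h where h: "\<And>e. e \<in> Basis \<Longrightarrow> h e \<in> borel_measurable M"
    "\<And>e A. e \<in> Basis \<Longrightarrow> A \<in> rc_borel a b \<Longrightarrow> set_integrable M A (h e)"
    "\<And>e A. e \<in> Basis \<Longrightarrow> A \<in> rc_borel a b \<Longrightarrow> r A \<bullet> e = (LINT x:A|M. h e x)"
    by metis
  define H where "H x = (\<Sum>e\<in>Basis. h e x *\<^sub>R e)" for x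
  have "set_integrable M A H \<and> r A = (LINT x:A|M. H x)" if A: "A \<in> rc_borel a b" for A
  proof -
    have int: "integrable M (\<lambda>x. (indicator A x *\<^sub>R h e x) *\<^sub>R e)" if "e \<in> Basis" for e
      using h(2)[OF that A] by (auto simp: set_integrable_def)
    have H: "indicator A x *\<^sub>R H x = (\<Sum>e\<in>Basis. (indicator A x *\<^sub>R h e x) *\<^sub>R e)" for x
      by (simp add: H_def scaleR_sum_right)
    have "(LINT x:A|M. H x) = (\<Sum>e\<in>Basis. LINT x|M. (indicator A x *\<^sub>R h e x) *\<^sub>R e)"
      unfolding set_lebesgue_integral_def H by (rule Bochner_Integration.integral_sum[OF int])
    also have "\<dots> = (\<Sum>e\<in>Basis. (r A \<bullet> e) *\<^sub>R e)"
    proof (rule sum.cong)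
      fix e :: 'v assume e: "e \<in> Basis"
      have "(LINT x|M. (indicator A x *\<^sub>R h e x) *\<^sub>R e) = (LINT x|M. indicator A x *\<^sub>R h e x) *\<^sub>R e"
        using h(2)[OF e A] by (intro integral_scaleR_left) (simp add: set_integrable_def)
      then show "(LINT x|M. (indicator A x *\<^sub>R h e x) *\<^sub>R e) = (r A \<bullet> e) *\<^sub>R e"
        using h(3)[OF e A] by (simp add: set_lebesgue_integral_def)
    qed simp
    also have "\<dots> = r A" by (rule euclidean_representation)
    finally have "r A = (LINT x:A|M. H x)" ..
    moreover have "set_integrable M A H"
      unfolding set_integrable_def H by (rule Bochner_Integration.integrable_sum[OF int])
    ultimately show ?thesis by blast
  qed
  moreover have "H \<in> borel_measurable M"
    unfolding H_def using h(1) by (intro borel_measurable_sum borel_measurable_scaleR) auto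
  ultimately show ?thesis by blast
qed

lemma rn_density:
  fixes r :: "real set \<Rightarrow> complex^'n^'n"
  assumes "dist0 a b r" "\<And>A. A \<in> rc_borel a b \<Longrightarrow> norm (r A) \<le> C * measure M A"
  shows "rn_density a b M r \<in> borel_measurable M"
    and "A \<in> rc_borel a b \<Longrightarrow> set_integrable M A (rn_density a b M r)"
    and "A \<in> rc_borel a b \<Longrightarrow> r A = (LINT x:A|M. rn_density a b M r x)"
proof -
  have "\<exists>h. h \<in> borel_measurable M \<and>
      (\<forall>A\<in>rc_borel a b. set_integrable M A h \<and> r A = (LINT x:A|M. h x))"
    using density_exists[OF assms] by blast
  from someI_ex[OF this]
  show "rn_density a b M r \<in> borel_measurable M"
    and "A \<in> rc_borel a b \<Longrightarrow> set_integrable M A (rn_density a b M r)"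
    and "A \<in> rc_borel a b \<Longrightarrow> r A = (LINT x:A|M. rn_density a b M r x)"
    unfolding rn_density_def by blast+
qed

lemma AE_nonneg_of_integrals:
  fixes f :: "real \<Rightarrow> real"
  assumes [measurable]: "f \<in> borel_measurable M"
    and int: "\<And>A. A \<in> rc_borel a b \<Longrightarrow> set_integrable M A f"
    and nonneg: "\<And>A. A \<in> rc_borel a b \<Longrightarrow> 0 \<le> (LINT x:A|M. f x)"
  shows "AE x in M. 0 \<le> f x"
proof (rule AE_rcI)
  fix K assume K: "K \<in> rc_borel a b"
  define A where "A = K \<inter> {x \<in> space M. f x < 0}"
  have "A \<in> sets M"
    unfolding A_def using rc_in_sets[OF K] by measurable
  then have A: "A \<in> rc_borel a b"
    by (intro rc_borel_subset[OF K]) (auto simp: sets_M borel_on_iff A_def)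
  have int': "integrable M (\<lambda>x. - (indicator A x *\<^sub>R f x))"
    using int[OF A] by (simp add: set_integrable_def)
  have pos: "AE x in M. 0 \<le> - (indicator A x *\<^sub>R f x)"
    by (rule AE_I2) (auto simp: A_def indicator_def)
  have "(LINT x|M. - (indicator A x *\<^sub>R f x)) = 0"
    using nonneg[OF A] integral_nonneg_AE[OF pos]
    by (simp add: set_lebesgue_integral_def)
  then have "AE x in M. - (indicator A x *\<^sub>R f x) = 0"
    using integral_nonneg_eq_0_iff_AE[OF int' pos] by simp
  then show "AE x in M. x \<in> K \<longrightarrow> 0 \<le> f x"
    using AE_space by eventually_elim (auto simp: A_def indicator_def split: if_splits)
qed

text \<open>Positivity of each quadratic form holds almost everywhere, and a countable dense set of
  vectors decides whether a matrix is positive semidefinite.\<close>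

lemma AE_psd_of_integrals:
  fixes h :: "real \<Rightarrow> complex^'n^'n"
  assumes [measurable]: "h \<in> borel_measurable M"
    and int: "\<And>A. A \<in> rc_borel a b \<Longrightarrow> set_integrable M A h"
    and psd: "\<And>A. A \<in> rc_borel a b \<Longrightarrow> psd (LINT x:A|M. h x)"
  shows "AE x in M. psd (h x)"
proof -
  obtain D :: "(complex^'n) set" where D: "countable D"
    "\<And>X. open X \<Longrightarrow> X \<noteq> {} \<Longrightarrow> \<exists>d\<in>D. d \<in> X"
    using countable_dense_setE by blast
  have "AE x in M. 0 \<le> Re (cinner v (h x *v v)) \<and> Im (cinner v (h x *v v)) = 0" for v
  proof -
    have bl: "bounded_linear (\<lambda>B :: complex^'n^'n. cinner v (B *v v))"
      by (intro bounded_linear_compose[OF bounded_bilinear.bounded_linear_right[OF bounded_bilinear_cinner]]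
          bounded_bilinear.bounded_linear_left[OF bounded_bilinear_matrix_vector])
    have *: "AE x in M. 0 \<le> L (cinner v (h x *v v))"
      if L: "bounded_linear L" and pos: "\<And>z. z \<in> \<real>\<^sub>\<ge>\<^sub>0 \<Longrightarrow> 0 \<le> L z" for L :: "complex \<Rightarrow> real"
    proof (rule AE_nonneg_of_integrals)
      have LB: "bounded_linear (\<lambda>B :: complex^'n^'n. L (cinner v (B *v v)))"
        by (rule bounded_linear_compose[OF L bl])
      have ind: "indicator A x *\<^sub>R L (cinner v (h x *v v)) = L (cinner v ((indicator A x *\<^sub>R h x) *v v))" for A x
        by (rule linear_scale[OF bounded_linear.linear[OF LB], symmetric])
      show "(\<lambda>x. L (cinner v (h x *v v))) \<in> borel_measurable M"
        by (rule borel_measurable_continuous_on[OF linear_continuous_on[OF L]]) measurable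
      show "set_integrable M A (\<lambda>x. L (cinner v (h x *v v)))" if A: "A \<in> rc_borel a b" for A
        unfolding set_integrable_def ind
        using int[OF A] by (intro integrable_bounded_linear[OF LB]) (simp add: set_integrable_def)
      show "0 \<le> (LINT x:A|M. L (cinner v (h x *v v)))" if A: "A \<in> rc_borel a b" for A
      proof -
        have "(LINT x:A|M. L (cinner v (h x *v v))) = L (cinner v ((LINT x:A|M. h x) *v v))"
          unfolding set_lebesgue_integral_def ind
          using int[OF A] by (intro integral_bounded_linear[OF LB]) (simp add: set_integrable_def)
        then show ?thesis using psd[OF A] pos by (simp add: psd_def)
      qed
    qed
    have "AE x in M. 0 \<le> Re (cinner v (h x *v v))"
      by (rule *) (auto simp: bounded_linear_Re complex_nonneg_Reals_iff)
    moreover have "AE x in M. 0 \<le> Im (cinner v (h x *v v))"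
      by (rule *) (auto simp: bounded_linear_Im complex_nonneg_Reals_iff)
    moreover have "AE x in M. 0 \<le> - Im (cinner v (h x *v v))"
      by (rule *) (auto simp: bounded_linear_Im bounded_linear_minus complex_nonneg_Reals_iff)
    ultimately show ?thesis by eventually_elim auto
  qed
  then have "AE x in M. \<forall>v\<in>D. 0 \<le> Re (cinner v (h x *v v)) \<and> Im (cinner v (h x *v v)) = 0"
    unfolding AE_ball_countable[OF D(1)] by blast
  then show ?thesis
  proof eventually_elim
    case (elim x)
    let ?S = "{v. 0 \<le> Re (cinner v (h x *v v))} \<inter> {v. Im (cinner v (h x *v v)) = 0}"
    have cont: "continuous_on UNIV (\<lambda>v. cinner v (h x *v v))"
      by (intro bounded_bilinear.continuous_on[OF bounded_bilinear_cinner]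
          bounded_bilinear.continuous_on[OF bounded_bilinear_matrix_vector] continuous_intros)
    have "closed ?S"
      by (intro closed_Int closed_Collect_le closed_Collect_eq continuous_intros cont)
    then have "open (- ?S)" by (rule open_Compl)
    then have "- ?S = {}" using D(2)[of "- ?S"] elim by blast
    then have "v \<in> ?S" for v by blast
    then show ?case by (auto simp: psd_def complex_nonneg_Reals_iff)
  qed
qed

end

section \<open>The measures attached to the coefficients\<close>

lemma rc_measure_total_variation:
  fixes q :: "real set \<Rightarrow> 'v::euclidean_space"
  assumes "a < b" "dist0 a b q"
  shows "rc_measure a b (total_variation a b q)"
  using assms by unfold_locales (auto simp: emeasure_total_variation rc_borel_in_sets
      tv_finite[unfolded infinity_ennreal_def])

lemma norm_le_total_variation:
  fixes q :: "real set \<Rightarrow> 'v::euclidean_space"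
  assumes q: "dist0 a b q" and A: "A \<in> rc_borel a b"
  shows "norm (q A) \<le> measure (total_variation a b q) A"
proof -
  have "ennreal (norm (q A)) \<le> emeasure (total_variation a b q) A"
    using norm_le_tv[OF A, of q] by (simp add: emeasure_total_variation[OF q rc_borel_in_sets[OF A]])
  also have "\<dots> = ennreal (measure (total_variation a b q) A)"
    using tv_finite[OF q A]
    by (intro emeasure_eq_ennreal_measure)
       (simp add: emeasure_total_variation[OF q rc_borel_in_sets[OF A]] less_top)
  finally show ?thesis by simp
qed

lemma bounded_linear_Re_trace: "bounded_linear (\<lambda>A :: complex^'n^'n. Re (trace A))"
  unfolding trace_def
  by (intro bounded_linear_compose[OF bounded_linear_Re] bounded_linear_sum
      bounded_linear_compose[OF bounded_linear_vec_nth bounded_linear_vec_nth])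

lemma nonneg_dist_psd: "nonneg_dist a b w \<Longrightarrow> A \<in> rc_borel a b \<Longrightarrow> psd (w A)"
  by (auto simp: nonneg_dist_def psd_def)

lemma tr_measure_eq: "tr_measure a b w = ext_measure a b (\<lambda>A. Re (trace (w A)))"
  by (simp add: tr_measure_def ext_measure_def)

lemma emeasure_tr_measure:
  assumes "dist0 a b w" "nonneg_dist a b w" "A \<in> rc_borel a b"
  shows "emeasure (tr_measure a b w) A = ennreal (Re (trace (w A)))"
  unfolding tr_measure_eq
  by (rule emeasure_ext_measure_rc)
     (use assms in \<open>auto intro: dist0_bounded_linear[OF bounded_linear_Re_trace] psd_trace_nonneg nonneg_dist_psd\<close>)

lemma rc_measure_tr_measure:
  assumes "a < b" "dist0 a b w" "nonneg_dist a b w"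
  shows "rc_measure a b (tr_measure a b w)"
proof
  show "sets (tr_measure a b w) = borel_on a b" by (simp add: tr_measure_eq)
  show "emeasure (tr_measure a b w) A < \<infinity>" if "A \<in> rc_borel a b" for A
    using emeasure_tr_measure[OF assms(2,3) that] by simp
qed (rule assms(1))

lemma norm_psd_le_trace:
  fixes A :: "complex^'n^'n"
  assumes "psd A"
  shows "norm A \<le> (real CARD('n))\<^sup>2 * Re (trace A)"
proof -
  have "norm A \<le> (\<Sum>i\<in>UNIV. norm (A $ i))"
    unfolding norm_vec_def by (rule L2_set_le_sum) simp
  also have "\<dots> \<le> (\<Sum>i\<in>UNIV. \<Sum>j\<in>UNIV. cmod (A $ i $ j))"
    unfolding norm_vec_def[of "A $ _"] by (intro sum_mono L2_set_le_sum) simp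
  also have "\<dots> \<le> (\<Sum>(i::'n)\<in>UNIV. \<Sum>(j::'n)\<in>UNIV. Re (trace A))"
    by (intro sum_mono psd_entry_le_trace assms)
  also have "\<dots> = (real CARD('n))\<^sup>2 * Re (trace A)"
    by (simp add: power2_eq_square)
  finally show ?thesis .
qed

lemma w_density:
  fixes w :: "real set \<Rightarrow> complex^'n^'n"
  assumes ab: "a < b" and w: "dist0 a b w" "nonneg_dist a b w"
  shows "w_density a b w \<in> borel_measurable (tr_measure a b w)"
    and "A \<in> rc_borel a b \<Longrightarrow> set_integrable (tr_measure a b w) A (w_density a b w)"
    and "A \<in> rc_borel a b \<Longrightarrow> w A = (LINT x:A|tr_measure a b w. w_density a b w x)"
proof -
  interpret rc_measure a b "tr_measure a b w"
    by (rule rc_measure_tr_measure[OF ab w])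
  have le: "norm (w A) \<le> (real CARD('n))\<^sup>2 * measure (tr_measure a b w) A" if A: "A \<in> rc_borel a b" for A
    using norm_psd_le_trace[OF nonneg_dist_psd[OF w(2) A]] psd_trace_nonneg[OF nonneg_dist_psd[OF w(2) A]]
    by (simp add: measure_def emeasure_tr_measure[OF w A])
  show "w_density a b w \<in> borel_measurable (tr_measure a b w)"
    and "A \<in> rc_borel a b \<Longrightarrow> set_integrable (tr_measure a b w) A (w_density a b w)"
    and "A \<in> rc_borel a b \<Longrightarrow> w A = (LINT x:A|tr_measure a b w. w_density a b w x)"
    unfolding w_density_def using rn_density[OF w(1) le] by blast+
qed

lemma w_density_pos_contraction:
  fixes w :: "real set \<Rightarrow> complex^'n^'n"
  assumes ab: "a < b" and w: "dist0 a b w" "nonneg_dist a b w"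
  shows "AE x in tr_measure a b w. pos_contraction (w_density a b w x)"
proof -
  interpret rc_measure a b "tr_measure a b w"
    by (rule rc_measure_tr_measure[OF ab w])
  let ?M = "tr_measure a b w" and ?W = "w_density a b w"
  note W = w_density[OF ab w]
  have "AE x in ?M. psd (?W x)"
  proof (rule AE_psd_of_integrals[OF W(1,2)])
    show "psd (LINT x:A|?M. ?W x)" if A: "A \<in> rc_borel a b" for A
      using nonneg_dist_psd[OF w(2) A] unfolding W(3)[OF A] .
  qed
  moreover have "AE x in ?M. 0 \<le> 1 - Re (trace (?W x))"
  proof (rule AE_nonneg_of_integrals)
    have ind: "indicator A x *\<^sub>R Re (trace (?W x)) = Re (trace (indicator A x *\<^sub>R ?W x))" for A x
      by (rule linear_scale[OF bounded_linear.linear[OF bounded_linear_Re_trace], symmetric])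
    have int: "set_integrable ?M A (\<lambda>x. Re (trace (?W x)))" if A: "A \<in> rc_borel a b" for A
      unfolding set_integrable_def ind
      using W(2)[OF A] by (intro integrable_bounded_linear[OF bounded_linear_Re_trace]) (simp add: set_integrable_def)
    show "(\<lambda>x. 1 - Re (trace (?W x))) \<in> borel_measurable ?M"
      by (intro borel_measurable_diff borel_measurable_const
          borel_measurable_continuous_on[OF linear_continuous_on[OF bounded_linear_Re_trace] W(1)])
    show "set_integrable ?M A (\<lambda>x. 1 - Re (trace (?W x)))" if A: "A \<in> rc_borel a b" for A
      by (intro set_integral_diff set_integrable_const_rc int A)
    show "0 \<le> (LINT x:A|?M. 1 - Re (trace (?W x)))" if A: "A \<in> rc_borel a b" for A
    proof -
      have "(LINT x:A|?M. Re (trace (?W x))) = Re (trace (LINT x:A|?M. ?W x))"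
        unfolding set_lebesgue_integral_def ind
        using W(2)[OF A] by (intro integral_bounded_linear[OF bounded_linear_Re_trace]) (simp add: set_integrable_def)
      also have "\<dots> = measure ?M A"
        using W(3)[OF A] psd_trace_nonneg[OF nonneg_dist_psd[OF w(2) A]]
        by (simp add: measure_def emeasure_tr_measure[OF w A])
      finally show ?thesis
        using set_integral_diff(2)[OF set_integrable_const_rc[OF A, of "1::real"] int[OF A]]
          set_integral_const_rc[OF A, of "1::real"] by simp
    qed
  qed
  ultimately show ?thesis
    by eventually_elim (auto intro: psd_trace_contraction)
qed

lemma weighted_L2_w:
  fixes w :: "real set \<Rightarrow> complex^'n^'n"
  assumes ab: "a < b" and w: "dist0 a b w" "nonneg_dist a b w"
  shows "weighted_L2 (tr_measure a b w) (w_density a b w)"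
  by (intro weighted_L2.intro w_density[OF assms] w_density_pos_contraction[OF assms])

section \<open>Balanced functions as primitives of distributions of order zero\<close>

text \<open>For \<open>p\<close> countably additive on compact intervals, this single formula says that \<open>u\<close> has locally bounded variation, is balanced and is an antiderivative
  of \<open>p\<close>: the balanced value at an endpoint contains half of the mass there. It does not mention one-sided
  limits of \<open>u\<close>, so it is preserved by linear combinations and by pointwise limits.\<close>

definition bal_prim :: "ereal \<Rightarrow> ereal \<Rightarrow> (real set \<Rightarrow> 'v::real_normed_vector) \<Rightarrow> (real \<Rightarrow> 'v) \<Rightarrow> bool" where
  "bal_prim a b p u \<longleftrightarrow>
     (\<forall>s t. s < t \<longrightarrow> {s..t} \<subseteq> einterval a b \<longrightarrow> u t - u s = (1/2) *\<^sub>R (p {s..t} + p {s<..<t}))"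

lemma dist0_open_interval:
  assumes p: "dist0 a b p" and st: "s < t" "{s..t} \<subseteq> einterval a b"
  shows "p {s..t} = p {s} + p {s<..<t} + p {t}"
proof -
  have rc: "A \<in> rc_borel a b" if "A \<in> sets borel" "A \<subseteq> {s..t}" for A
    using rc_borel_in_Icc[OF st(2) that] .
  have "p ({s} \<union> {s<..<t}) = p {s} + p {s<..<t}"
    by (rule dist0_Un[OF p]) (use st(1) in \<open>auto intro!: rc\<close>)
  moreover have "p (({s} \<union> {s<..<t}) \<union> {t}) = p ({s} \<union> {s<..<t}) + p {t}"
    by (rule dist0_Un[OF p]) (use st(1) in \<open>auto intro!: rc\<close>)
  moreover have "({s} \<union> {s<..<t}) \<union> {t} = {s..t}"
    using st(1) by auto
  ultimately show ?thesis by simp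
qed

lemma antiderivative_point:
  "antiderivative a b p u \<Longrightarrow> x \<in> einterval a b \<Longrightarrow> p {x} = rc_version u x - lc_version u x"
  unfolding antiderivative_def using Icc_subset_einterval[of x a b x]
  by (metis atLeastAtMost_singleton order_refl)

lemma bv_bal_imp_bal_prim:
  assumes p: "dist0 a b p" and u: "bv_bal a b u" and prim: "antiderivative a b p u"
  shows "bal_prim a b p u"
  unfolding bal_prim_def
proof (intro allI impI)
  fix s t :: real assume st: "s < t" "{s..t} \<subseteq> einterval a b"
  then have mem: "s \<in> einterval a b" "t \<in> einterval a b" by auto
  have 1: "p {s..t} = rc_version u t - lc_version u s"
    using prim st unfolding antiderivative_def by simp
  have 2: "p {s<..<t} = p {s..t} - p {s} - p {t}"
    using dist0_open_interval[OF p st] by simp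
  have 3: "u s = (1/2) *\<^sub>R (rc_version u s + lc_version u s)"
    "u t = (1/2) *\<^sub>R (rc_version u t + lc_version u t)"
    using u mem by (auto simp: bv_bal_def)
  show "u t - u s = (1/2) *\<^sub>R (p {s..t} + p {s<..<t})"
    unfolding 2 1 antiderivative_point[OF prim mem(1)] antiderivative_point[OF prim mem(2)]
    by (subst 3(1), subst 3(2)) (simp add: algebra_simps)
qed

text \<open>The variation measure of \<open>p\<close> controls the increments of \<open>u\<close>; the function \<open>g\<close> is the balanced
  primitive of this measure.\<close>

lemma bal_prim_monotone_bound:
  fixes p :: "real set \<Rightarrow> 'v::euclidean_space"
  assumes ab: "a < b" and p: "dist0 a b p" and u: "bal_prim a b p u" and cd: "{c..d} \<subseteq> einterval a b"
  obtains g B where "\<And>s t. c \<le> s \<Longrightarrow> s \<le> t \<Longrightarrow> t \<le> d \<Longrightarrow> norm (u t - u s) \<le> g t - g s"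
    "\<And>t. c \<le> t \<Longrightarrow> t \<le> d \<Longrightarrow> 0 \<le> g t \<and> g t \<le> B"
proof -
  interpret rc_measure a b "total_variation a b p"
    by (rule rc_measure_total_variation[OF ab p])
  define m where "m = measure (total_variation a b p)"
  have m: "dist0 a b m" unfolding m_def by (rule dist0_measure)
  have m_nonneg: "0 \<le> m A" for A by (simp add: m_def)
  have pm: "norm (p A) \<le> m A" if "A \<in> rc_borel a b" for A
    unfolding m_def by (rule norm_le_total_variation[OF p that])
  have rc: "A \<in> rc_borel a b" if "A \<in> sets borel" "A \<subseteq> {c..d}" for A
    using rc_borel_in_Icc[OF cd that] .
  define g where "g t = (1/2) * (m {c..t} + m {c..<t})" for t
  have "norm (u t - u s) \<le> g t - g s" if "c \<le> s" "s \<le> t" "t \<le> d" for s t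
  proof (cases "s = t")
    case False
    with that have st: "s < t" by simp
    have "{c..t} - {c..<s} = {s..t}" "{c..<t} - {c..s} = {s<..<t}"
      using that by auto
    moreover have "m ({c..t} - {c..<s}) = m {c..t} - m {c..<s}"
      by (rule dist0_Diff[OF m rc]) (use that in auto)
    moreover have "m ({c..<t} - {c..s}) = m {c..<t} - m {c..s}"
      by (rule dist0_Diff[OF m rc]) (use that st in auto)
    ultimately have g: "g t - g s = (1/2) * (m {s..t} + m {s<..<t})"
      by (simp add: g_def field_simps)
    have "{s..t} \<subseteq> einterval a b" using that cd by auto
    then have "u t - u s = (1/2) *\<^sub>R (p {s..t} + p {s<..<t})"
      using u st unfolding bal_prim_def by blast
    then have "norm (u t - u s) \<le> (1/2) * (norm (p {s..t}) + norm (p {s<..<t}))"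
      by (simp add: norm_triangle_ineq)
    also have "\<dots> \<le> (1/2) * (m {s..t} + m {s<..<t})"
      by (intro mult_left_mono add_mono pm rc) (use that in auto)
    finally show ?thesis by (simp add: g)
  qed simp
  moreover have "0 \<le> g t \<and> g t \<le> m {c..d}" if "c \<le> t" "t \<le> d" for t
  proof
    show "0 \<le> g t" using m_nonneg by (simp add: g_def)
    have le: "m A \<le> m {c..d}" if "A \<in> sets borel" "A \<subseteq> {c..d}" for A
      using dist0_Diff[OF m rc[of "{c..d}"] that] m_nonneg[of "{c..d} - A"] by simp
    have "m {c..t} \<le> m {c..d}" "m {c..<t} \<le> m {c..d}"
      by (rule le; use that in auto)+
    then show "g t \<le> m {c..d}" by (simp add: g_def)
  qed
  ultimately show ?thesis using that by blast
qed

lemma bal_prim_bv_loc: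
  fixes p :: "real set \<Rightarrow> 'v::euclidean_space"
  assumes ab: "a < b" and p: "dist0 a b p" and u: "bal_prim a b p u"
  shows "bv_loc a b u"
  unfolding bv_loc_def
proof (intro allI impI)
  fix c d :: real assume cd: "{c..d} \<subseteq> einterval a b"
  obtain g B where g: "\<And>s t. c \<le> s \<Longrightarrow> s \<le> t \<Longrightarrow> t \<le> d \<Longrightarrow> norm (u t - u s) \<le> g t - g s"
    "\<And>t. c \<le> t \<Longrightarrow> t \<le> d \<Longrightarrow> 0 \<le> g t \<and> g t \<le> B"
    using bal_prim_monotone_bound[OF ab p u cd] by blast
  have "(\<Sum>i<N. norm (u (t (Suc i)) - u (t i))) \<le> B" if t: "incseq t" "range t \<subseteq> {c..d}" for t N
  proof -
    have tm: "c \<le> t i" "t i \<le> d" for i using t(2) by (auto simp: image_subset_iff)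
    have "(\<Sum>i<N. norm (u (t (Suc i)) - u (t i))) \<le> (\<Sum>i<N. g (t (Suc i)) - g (t i))"
      by (intro sum_mono g(1) tm incseq_SucD[OF t(1)])
    also have "\<dots> = g (t N) - g (t 0)" by (rule sum_lessThan_telescope)
    also have "\<dots> \<le> B" using g(2)[OF tm[of N]] g(2)[OF tm[of 0]] by linarith
    finally show ?thesis .
  qed
  then show "\<exists>B. \<forall>t N. incseq t \<longrightarrow> range t \<subseteq> {c..d} \<longrightarrow> (\<Sum>i<N. norm (u (t (Suc i)) - u (t i))) \<le> B"
    by blast
qed

lemma bal_prim_bounded:
  fixes p :: "real set \<Rightarrow> 'v::euclidean_space"
  assumes ab: "a < b" and p: "dist0 a b p" and u: "bal_prim a b p u" and cd: "{c..d} \<subseteq> einterval a b"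
  shows "\<exists>S. \<forall>t\<in>{c..d}. norm (u t) \<le> S"
proof -
  obtain g B where g: "\<And>s t. c \<le> s \<Longrightarrow> s \<le> t \<Longrightarrow> t \<le> d \<Longrightarrow> norm (u t - u s) \<le> g t - g s"
    "\<And>t. c \<le> t \<Longrightarrow> t \<le> d \<Longrightarrow> 0 \<le> g t \<and> g t \<le> B"
    using bal_prim_monotone_bound[OF ab p u cd] by blast
  have "norm (u t) \<le> norm (u c) + B" if "t \<in> {c..d}" for t
  proof -
    have "norm (u t) \<le> norm (u c) + norm (u t - u c)"
      by (metis norm_triangle_sub)
    moreover have "norm (u t - u c) \<le> g t - g c" using that by (intro g(1)) auto
    moreover have "g t \<le> B" "0 \<le> g c" using g(2) that by auto
    ultimately show ?thesis by linarith
  qed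
  then show ?thesis by blast
qed

lemma bal_prim_measurable:
  fixes p :: "real set \<Rightarrow> 'v::euclidean_space"
  assumes ab: "a < b" and p: "dist0 a b p" and u: "bal_prim a b p u"
  shows "u \<in> borel_measurable (restrict_space borel (einterval a b))"
proof -
  have "(\<lambda>x. u x \<bullet> e) \<in> borel_measurable (restrict_space borel {c..d})"
    if cd: "{c..d} \<subseteq> einterval a b" and e: "e \<in> Basis" for c d e
  proof -
    obtain g B where g: "\<And>s t. c \<le> s \<Longrightarrow> s \<le> t \<Longrightarrow> t \<le> d \<Longrightarrow> norm (u t - u s) \<le> g t - g s"
      "\<And>t. c \<le> t \<Longrightarrow> t \<le> d \<Longrightarrow> 0 \<le> g t \<and> g t \<le> B"
      using bal_prim_monotone_bound[OF ab p u cd] by blast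
    have inc: "\<bar>u t \<bullet> e - u s \<bullet> e\<bar> \<le> g t - g s" if "c \<le> s" "s \<le> t" "t \<le> d" for s t
      using Basis_le_norm[OF e, of "u t - u s"] g(1)[OF that] by (simp add: inner_diff_left)
    have "mono_on {c..d} g"
      by (rule mono_onI) (use inc in fastforce)
    moreover have "mono_on {c..d} (\<lambda>x. u x \<bullet> e + g x)"
      by (rule mono_onI) (use inc in fastforce)
    ultimately have "(\<lambda>x. (u x \<bullet> e + g x) - g x) \<in> borel_measurable (restrict_space borel {c..d})"
      by (intro borel_measurable_diff borel_measurable_mono_on_fnc)
    then show ?thesis by simp
  qed
  note * = this
  obtain l r :: "nat \<Rightarrow> real" where lr: "einterval a b = (\<Union>i. {l i .. r i})"
    using einterval_Icc_approximation[OF ab] by metis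
  have "(\<lambda>x. u x \<bullet> e) \<in> borel_measurable (restrict_space borel (einterval a b))" if e: "e \<in> Basis" for e
  proof (rule measurable_piecewise_restrict[where C = "range (\<lambda>i. {l i .. r i})"])
    fix \<Omega> assume "\<Omega> \<in> range (\<lambda>i. {l i .. r i})"
    then obtain i where i: "\<Omega> = {l i .. r i}" by auto
    have sub: "{l i .. r i} \<subseteq> einterval a b" using lr by auto
    show "\<Omega> \<inter> space (restrict_space borel (einterval a b)) \<in> borel_on a b"
      using sub by (auto simp: i space_restrict_space borel_on_iff)
    have "restrict_space (restrict_space borel (einterval a b)) \<Omega> = restrict_space borel {l i .. r i}"
      using sub by (subst restrict_restrict_space) (auto simp: i Int_absorb1)
    then show "(\<lambda>x. u x \<bullet> e) \<in> borel_measurable (restrict_space (restrict_space borel (einterval a b)) \<Omega>)"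
      using *[OF sub e] by simp
  qed (use lr in \<open>auto simp: space_restrict_space\<close>)
  then show ?thesis by (subst borel_measurable_euclidean_space) blast
qed

lemma half_sum: "(1/2) *\<^sub>R (x + y + z + y) = (1/2) *\<^sub>R x + y + (1/2) *\<^sub>R (z :: 'v::real_vector)"
proof -
  have "x + y + z + y = x + 2 *\<^sub>R y + z" by (simp add: scaleR_2)
  then show ?thesis by (simp only: scaleR_add_right scaleR_scaleR) simp
qed

lemma bal_prim_step:
  assumes p: "dist0 a b p" and u: "bal_prim a b p u"
    and mem: "s \<in> einterval a b" "z \<in> einterval a b" and ne: "s \<noteq> z"
  shows "u z = u s + sgn (z - s) *\<^sub>R ((1/2) *\<^sub>R p {s} + p {min s z<..<max s z} + (1/2) *\<^sub>R p {z})"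
proof -
  have *: "u t - u r = (1/2) *\<^sub>R p {r} + p {r<..<t} + (1/2) *\<^sub>R p {t}"
    if "r < t" "r \<in> einterval a b" "t \<in> einterval a b" for r t
  proof -
    have sub: "{r..t} \<subseteq> einterval a b" by (rule Icc_subset_einterval[OF that(2,3)])
    then have "u t - u r = (1/2) *\<^sub>R (p {r..t} + p {r<..<t})"
      using u that(1) unfolding bal_prim_def by blast
    then show ?thesis
      by (simp only: dist0_open_interval[OF p that(1) sub] half_sum)
  qed
  show ?thesis
  proof (cases "s < z")
    case True
    then show ?thesis
      using *[OF True mem] by (simp add: algebra_simps)
  next
    case False
    with ne have lt: "z < s" by simp
    then show ?thesis
      using *[OF lt mem(2,1)] by (simp add: algebra_simps)
  qed
qed

text \<open>The values of \<open>p\<close> on subsets of a punctured neighbourhood of \<open>x\<close> are bounded by the variation of the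
  neighbourhood, which tends to zero as it shrinks to the empty set, even if \<open>x\<close> carries mass.\<close>

lemma bal_prim_near:
  fixes p :: "real set \<Rightarrow> 'v::euclidean_space"
  assumes ab: "a < b" and p: "dist0 a b p" and u: "bal_prim a b p u" and x: "x \<in> einterval a b" and e: "e > 0"
  shows "\<exists>\<epsilon>>0. \<forall>y. y \<noteq> x \<and> dist y x < \<epsilon> \<longrightarrow> dist (u y) (u x + sgn (y - x) *\<^sub>R ((1/2) *\<^sub>R p {x})) < e"
proof -
  interpret rc_measure a b "total_variation a b p"
    by (rule rc_measure_total_variation[OF ab p])
  define m where "m = measure (total_variation a b p)"
  have m: "dist0 a b m" unfolding m_def by (rule dist0_measure)
  obtain \<delta> where \<delta>: "\<delta> > 0" "{x - \<delta>..x + \<delta>} \<subseteq> einterval a b"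
  proof -
    obtain e where e: "e > 0" "ball x e \<subseteq> einterval a b"
      using x open_einterval[of a b] openE by blast
    have "{x - e / 2..x + e / 2} \<subseteq> ball x e" using e(1) by (auto simp: dist_real_def)
    then show ?thesis using e by (intro that[of "e / 2"]) auto
  qed
  define \<epsilon> where "\<epsilon> n = \<delta> / real (Suc n)" for n
  have \<epsilon>: "0 < \<epsilon> n" "\<epsilon> n \<le> \<delta>" "\<epsilon> (Suc n) \<le> \<epsilon> n" for n
    using \<delta>(1) by (auto simp: \<epsilon>_def divide_simps)
  define A where "A n = {y. y \<noteq> x \<and> \<bar>y - x\<bar> < \<epsilon> n}" for n
  have A: "A n = {x - \<epsilon> n<..<x + \<epsilon> n} - {x}" for n by (auto simp: A_def)
  have A_rc: "A n \<in> rc_borel a b" for n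
  proof (rule rc_borel_in_Icc[OF \<delta>(2)])
    show "A n \<in> sets borel" unfolding A by simp
    show "A n \<subseteq> {x - \<delta>..x + \<delta>}" using \<epsilon>(2)[of n] by (auto simp: A)
  qed
  have dec: "decseq A"
    by (rule decseq_SucI) (auto simp: A_def intro: less_le_trans[OF _ \<epsilon>(3)])
  have int: "(\<Inter>n. A n) = {}"
  proof -
    have "y \<notin> (\<Inter>n. A n)" for y
    proof (cases "y = x")
      case False
      then have "0 < \<bar>y - x\<bar> / \<delta>" using \<delta>(1) by simp
      then obtain n where "inverse (real (Suc n)) < \<bar>y - x\<bar> / \<delta>"
        using reals_Archimedean by blast
      then have "\<not> \<bar>y - x\<bar> < \<epsilon> n" using \<delta>(1) by (simp add: \<epsilon>_def field_simps)
      then show ?thesis by (auto simp: A_def)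
    qed (simp add: A_def)
    then show ?thesis by blast
  qed
  have "(\<lambda>n. m (A n)) \<longlonglongrightarrow> 0"
    using dist0_decseq[OF m A_rc dec] unfolding int dist0_empty[OF m] .
  then have "\<forall>\<^sub>F n in sequentially. m (A n) < e / 2" by (rule order_tendstoD) (use e in simp)
  then obtain n where n: "m (A n) < e / 2" by (auto simp: eventually_sequentially)
  have le: "norm (p D) \<le> m (A n)" if D: "D \<in> sets borel" "D \<subseteq> A n" for D
  proof -
    have "norm (p D) \<le> m D"
      unfolding m_def by (rule norm_le_total_variation[OF p rc_borel_subset[OF A_rc D]])
    also have "\<dots> \<le> m (A n)"
      using dist0_Diff[OF m A_rc D] measure_nonneg[of "total_variation a b p" "A n - D"] by (simp add: m_def)
    finally show ?thesis .
  qed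
  have "dist (u y) (u x + sgn (y - x) *\<^sub>R ((1/2) *\<^sub>R p {x})) < e" if y: "y \<noteq> x" "dist y x < \<epsilon> n" for y
  proof -
    have yA: "y \<in> A n" using y by (simp add: A_def dist_real_def)
    then have yX: "y \<in> einterval a b" using rc_borel_in_sets[OF A_rc] by (auto simp: borel_on_iff)
    have D: "{min x y<..<max x y} \<subseteq> A n" using yA by (auto simp: A_def)
    have sg: "\<bar>sgn (y - x)\<bar> = 1" using y(1) by (simp add: sgn_real_def)
    have "u y - (u x + sgn (y - x) *\<^sub>R ((1/2) *\<^sub>R p {x}))
        = sgn (y - x) *\<^sub>R (p {min x y<..<max x y} + (1/2) *\<^sub>R p {y})"
      using bal_prim_step[OF p u x yX] y(1) by (simp add: algebra_simps)
    then have "dist (u y) (u x + sgn (y - x) *\<^sub>R ((1/2) *\<^sub>R p {x})) = norm (p {min x y<..<max x y} + (1/2) *\<^sub>R p {y})"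
      by (simp only: dist_norm norm_scaleR sg mult_1_left)
    also have "\<dots> \<le> norm (p {min x y<..<max x y}) + norm ((1/2) *\<^sub>R p {y})" by (rule norm_triangle_ineq)
    also have "\<dots> < e"
    proof -
      have "norm (p {min x y<..<max x y}) \<le> m (A n)" by (rule le[OF _ D]) simp
      moreover have "norm (p {y}) \<le> m (A n)" by (rule le) (use yA in auto)
      moreover have "norm ((1/2) *\<^sub>R p {y}) = norm (p {y}) / 2" by simp
      ultimately show ?thesis using n norm_ge_zero[of "p {y}"] by linarith
    qed
    finally show ?thesis .
  qed
  then show ?thesis using \<epsilon>(1) by blast
qed

lemma bal_prim_limits:
  fixes p :: "real set \<Rightarrow> 'v::euclidean_space"
  assumes ab: "a < b" and p: "dist0 a b p" and u: "bal_prim a b p u" and x: "x \<in> einterval a b"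
  shows "rc_version u x = u x + (1/2) *\<^sub>R p {x}" "lc_version u x = u x - (1/2) *\<^sub>R p {x}"
proof -
  have lim: "(u \<longlongrightarrow> u x + \<sigma> *\<^sub>R ((1/2) *\<^sub>R p {x})) (at x within S)" if "\<And>y. y \<in> S \<Longrightarrow> sgn (y - x) = \<sigma>" for \<sigma> S
    unfolding tendsto_iff eventually_at
    using bal_prim_near[OF ab p u x] that by metis
  have "(u \<longlongrightarrow> u x + 1 *\<^sub>R ((1/2) *\<^sub>R p {x})) (at_right x)" by (rule lim) simp
  then show "rc_version u x = u x + (1/2) *\<^sub>R p {x}"
    unfolding rc_version_def by (intro tendsto_Lim) auto
  have "(u \<longlongrightarrow> u x + (-1) *\<^sub>R ((1/2) *\<^sub>R p {x})) (at_left x)" by (rule lim) simp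
  then show "lc_version u x = u x - (1/2) *\<^sub>R p {x}"
    unfolding lc_version_def by (intro tendsto_Lim) auto
qed

lemma bal_prim_imp_bv_bal:
  fixes p :: "real set \<Rightarrow> 'v::euclidean_space"
  assumes ab: "a < b" and p: "dist0 a b p" and u: "bal_prim a b p u"
  shows "bv_bal a b u" "antiderivative a b p u"
proof -
  note lim = bal_prim_limits[OF ab p u]
  show "bv_bal a b u"
    unfolding bv_bal_def using bal_prim_bv_loc[OF ab p u]
    by (auto simp: lim scaleR_add_left[symmetric])
  have "p {c..d} = rc_version u d - lc_version u c" if cd: "c \<le> d" "{c..d} \<subseteq> einterval a b" for c d
  proof (cases "c = d")
    case True
    then show ?thesis using cd by (simp add: lim scaleR_add_left[symmetric])
  next
    case False
    with cd have lt: "c < d" by simp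
    have mem: "c \<in> einterval a b" "d \<in> einterval a b" using cd by auto
    have "u d - u c = (1/2) *\<^sub>R (p {c..d} + p {c<..<d})"
      using u lt cd(2) unfolding bal_prim_def by blast
    moreover have "p {c<..<d} = p {c..d} - p {c} - p {d}"
      using dist0_open_interval[OF p lt cd(2)] by simp
    ultimately have "u d - u c = p {c..d} - (1/2) *\<^sub>R p {c} - (1/2) *\<^sub>R p {d}"
      by (simp add: algebra_simps scaleR_add_left[symmetric])
    then show ?thesis
      by (simp add: lim mem algebra_simps)
  qed
  then show "antiderivative a b p u"
    unfolding antiderivative_def using bal_prim_bv_loc[OF ab p u] by blast
qed

section \<open>A priori bounds for solutions\<close>

text \<open>On a short one-sided neighbourhood \<open>I\<close> of a point, the values of a solution differ little from
  the one-sided limit \<open>b\<close> at this point, which is comparable to the value \<open>v\<close> at the point itself.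
  The number \<open>\<eta>\<close> is the mass of the coefficient on \<open>I\<close>.\<close>

lemma two_sided_estimate:
  fixes u :: "real \<Rightarrow> 'v::real_normed_vector" and \<beta> \<kappa> \<eta> N :: real
  assumes \<beta>: "0 \<le> \<beta>" and \<kappa>: "0 \<le> \<kappa>" and N: "0 \<le> N"
    and \<eta>: "0 \<le> \<eta>" "4 * (\<kappa> + 1) * (1 + 2 * \<beta>\<^sup>2) * \<eta> \<le> 1"
    and vb: "norm v \<le> \<beta> * norm b" "norm b \<le> \<beta> * norm v"
    and bdd: "\<exists>S. \<forall>y\<in>I. norm (u y) \<le> S"
    and est: "\<And>S y. (\<forall>y\<in>I. norm (u y) \<le> S) \<Longrightarrow> y \<in> I \<Longrightarrow> norm (u y - b) \<le> \<kappa> * (2 * N + 2 * (S * \<eta>))"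
    and y: "y \<in> I"
  shows "norm (u y) \<le> (2 * \<beta> + 4 * \<kappa> + 8 * \<kappa> * \<beta>) * (norm v + N) \<and> norm v \<le> (2 * \<beta> + 4 * \<kappa> + 8 * \<kappa> * \<beta>) * (norm (u y) + N)"
proof -
  define S where "S = (SUP y\<in>I. norm (u y))"
  have bddS: "bdd_above ((\<lambda>y. norm (u y)) ` I)"
    using bdd by (auto intro: bdd_aboveI2)
  have S: "norm (u y) \<le> S" if "y \<in> I" for y
    unfolding S_def by (rule cSUP_upper[OF that bddS])
  have S0: "0 \<le> S" using S[OF y] norm_ge_zero order_trans by blast
  \<comment> \<open>The bound on \<open>\<eta>\<close> makes \<open>\<theta> * S\<close> absorbable, also after multiplication by \<open>2 * \<beta>\<^sup>2\<close>.\<close>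
  define \<theta> where "\<theta> = 2 * \<kappa> * \<eta>"
  have "\<theta> * (1 + 2 * \<beta>\<^sup>2) \<le> 2 * (\<kappa> + 1) * \<eta> * (1 + 2 * \<beta>\<^sup>2)"
    unfolding \<theta>_def using \<eta>(1) \<kappa> by (intro mult_right_mono) auto
  also have "\<dots> = 4 * (\<kappa> + 1) * (1 + 2 * \<beta>\<^sup>2) * \<eta> / 2"
    by (simp add: algebra_simps)
  also have "\<dots> \<le> 1 / 2" using \<eta>(2) by simp
  finally have "\<theta> * (1 + 2 * \<beta>\<^sup>2) \<le> 1 / 2" .
  moreover have \<theta>0: "0 \<le> \<theta>" unfolding \<theta>_def using \<eta>(1) \<kappa> by simp
  moreover have "\<theta> * (1 + 2 * \<beta>\<^sup>2) = \<theta> + 2 * \<beta>\<^sup>2 * \<theta>" by (simp add: algebra_simps)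
  moreover have "0 \<le> 2 * \<beta>\<^sup>2 * \<theta>" using \<theta>0 by simp
  ultimately have \<theta>: "\<theta> \<le> 1 / 2" "2 * \<beta>\<^sup>2 * \<theta> \<le> 1 / 2"
    by linarith+
  have est': "norm (u y - b) \<le> 2 * \<kappa> * N + \<theta> * S" if "y \<in> I" for y
    using est[of S y] S that by (auto simp: \<theta>_def algebra_simps)
  have "norm (u y) \<le> \<beta> * norm v + 2 * \<kappa> * N + \<theta> * S" if "y \<in> I" for y
    using est'[OF that] vb(2) norm_triangle_sub[of "u y" b] by linarith
  then have "S \<le> \<beta> * norm v + 2 * \<kappa> * N + \<theta> * S"
    unfolding S_def[symmetric] using y by (subst S_def) (auto intro!: cSUP_least)
  moreover have "\<theta> * S \<le> S / 2" using mult_right_mono[OF \<theta>(1) S0] by simp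
  ultimately have S_le: "S \<le> 2 * \<beta> * norm v + 4 * \<kappa> * N" by linarith
  have first: "norm (u y) \<le> (2 * \<beta> + 4 * \<kappa> + 8 * \<kappa> * \<beta>) * (norm v + N)"
  proof -
    have "2 * \<beta> * norm v + 4 * \<kappa> * N \<le> (2 * \<beta> + 4 * \<kappa> + 8 * \<kappa> * \<beta>) * norm v + (2 * \<beta> + 4 * \<kappa> + 8 * \<kappa> * \<beta>) * N"
      using \<beta> \<kappa> N by (intro add_mono mult_right_mono) auto
    then show ?thesis using S[OF y] S_le by (simp add: algebra_simps)
  qed
  have "norm b \<le> norm (u y) + (2 * \<kappa> * N + \<theta> * S)"
    using est'[OF y] norm_triangle_sub[of b "u y"] by (simp add: norm_minus_commute)
  also have "\<dots> \<le> norm (u y) + (2 * \<kappa> * N + \<theta> * (2 * \<beta> * norm v + 4 * \<kappa> * N))"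
    using mult_left_mono[OF S_le \<theta>0] by simp
  finally have "norm v \<le> \<beta> * (norm (u y) + (2 * \<kappa> * N + \<theta> * (2 * \<beta> * norm v + 4 * \<kappa> * N)))"
    using vb(1) \<beta> by (meson mult_left_mono order_trans)
  also have "\<dots> = \<beta> * norm (u y) + 2 * \<kappa> * \<beta> * N + (2 * \<beta>\<^sup>2 * \<theta>) * norm v + \<theta> * (4 * \<kappa> * \<beta> * N)"
    by (simp add: algebra_simps power2_eq_square)
  also have "\<dots> \<le> \<beta> * norm (u y) + 2 * \<kappa> * \<beta> * N + (1/2) * norm v + (1/2) * (4 * \<kappa> * \<beta> * N)"
    using \<theta> \<beta> \<kappa> N by (intro add_mono mult_right_mono order_refl) auto
  finally have "norm v \<le> 2 * \<beta> * norm (u y) + 8 * \<kappa> * \<beta> * N" by (simp add: field_simps)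
  also have "\<dots> \<le> (2 * \<beta> + 4 * \<kappa> + 8 * \<kappa> * \<beta>) * norm (u y) + (2 * \<beta> + 4 * \<kappa> + 8 * \<kappa> * \<beta>) * N"
    using \<beta> \<kappa> N by (intro add_mono mult_right_mono) auto
  finally show ?thesis using first by (simp add: algebra_simps)
qed

locale ode =
  fixes a b :: ereal and J :: "complex^'n^'n" and q :: "real set \<Rightarrow> complex^'n^'n"
  assumes ab: "a < b" and J: "invertible J" and q: "dist0 a b q"
    and jumps: "x \<in> einterval a b \<Longrightarrow> invertible (2 *\<^sub>R J + q {x})"
      "x \<in> einterval a b \<Longrightarrow> invertible (2 *\<^sub>R J - q {x})"
begin

sublocale rc_measure a b "total_variation a b q"
  by (rule rc_measure_total_variation[OF ab q])

abbreviation V :: "real measure" where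
  "V \<equiv> total_variation a b q"

definition q_density :: "real \<Rightarrow> complex^'n^'n" where
  "q_density = rn_density a b V q"

lemma q_density_measurable [measurable]: "q_density \<in> borel_measurable V"
  and q_density_integrable: "A \<in> rc_borel a b \<Longrightarrow> set_integrable V A q_density"
  and q_density_integral: "A \<in> rc_borel a b \<Longrightarrow> q A = (LINT x:A|V. q_density x)"
proof -
  have le: "norm (q A) \<le> 1 * measure V A" if "A \<in> rc_borel a b" for A
    using norm_le_total_variation[OF q that] by simp
  show "q_density \<in> borel_measurable V"
    unfolding q_density_def by (rule rn_density(1)[OF q le])
  show "set_integrable V A q_density" if "A \<in> rc_borel a b" for A
    unfolding q_density_def by (rule rn_density(2)[OF q le that])
  show "q A = (LINT x:A|V. q_density x)" if "A \<in> rc_borel a b" for A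
    unfolding q_density_def by (rule rn_density(3)[OF q le that])
qed

definition q_mass :: "real set \<Rightarrow> real" where
  "q_mass A = (LINT x:A|V. norm (q_density x))"

lemma norm_q_density_integrable: "A \<in> rc_borel a b \<Longrightarrow> set_integrable V A (\<lambda>x. norm (q_density x))"
  using integrable_norm[OF q_density_integrable[unfolded set_integrable_def], of A]
  by (simp add: set_integrable_def)

lemma dist0_q_mass: "dist0 a b q_mass"
  unfolding q_mass_def[abs_def] by (rule dist0_set_integral) (rule norm_q_density_integrable)

lemma q_mass_nonneg: "0 \<le> q_mass A"
  unfolding q_mass_def set_lebesgue_integral_def by (intro integral_nonneg_AE) simp

lemma q_mass_mono: "A \<in> sets borel \<Longrightarrow> A \<subseteq> B \<Longrightarrow> B \<in> rc_borel a b \<Longrightarrow> q_mass A \<le> q_mass B"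
  using dist0_Diff[OF dist0_q_mass, of B A] q_mass_nonneg[of "B - A"] by simp

lemma q_times_eq: "q_times a b q u A = (LINT x:A|V. q_density x *v u x)"
  by (simp add: q_times_def q_density_def)

lemma q_times_integrable:
  assumes "u \<in> borel_measurable V" "A \<in> rc_borel a b" "\<And>x. x \<in> A \<Longrightarrow> norm (u x) \<le> S"
  shows "set_integrable V A (\<lambda>x. q_density x *v u x)"
  by (rule set_integrable_matrix_vector[OF q_density_measurable assms(1,2) q_density_integrable[OF assms(2)] assms(3)])

lemma norm_indicator_matrix_vector_le:
  assumes "x \<in> A \<Longrightarrow> norm (v :: complex^'m) \<le> S"
  shows "norm (indicator A x *\<^sub>R (B *v v)) \<le> S * (indicator A x *\<^sub>R norm B)"
proof (cases "x \<in> A")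
  case True
  have "norm (B *v v) \<le> norm B * norm v" by (rule norm_matrix_vector_le)
  also have "\<dots> \<le> norm B * S" using assms[OF True] by (intro mult_left_mono) auto
  finally show ?thesis using True by (simp add: mult.commute)
qed simp

lemma q_times_bound:
  assumes u: "u \<in> borel_measurable V" and A: "A \<in> rc_borel a b" and S: "\<And>x. x \<in> A \<Longrightarrow> norm (u x) \<le> S"
  shows "norm (q_times a b q u A) \<le> S * q_mass A"
proof -
  have "norm (LINT x|V. indicator A x *\<^sub>R (q_density x *v u x)) \<le> (LINT x|V. S * (indicator A x *\<^sub>R norm (q_density x)))"
  proof (rule order_trans[OF integral_norm_bound integral_mono])
    show "integrable V (\<lambda>x. norm (indicator A x *\<^sub>R (q_density x *v u x)))"
      by (rule integrable_norm) (use q_times_integrable[OF u A S] in \<open>simp add: set_integrable_def\<close>)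
    show "integrable V (\<lambda>x. S * (indicator A x *\<^sub>R norm (q_density x)))"
      using norm_q_density_integrable[OF A] by (intro integrable_mult_right) (simp add: set_integrable_def)
  qed (rule norm_indicator_matrix_vector_le[OF S])
  then show ?thesis
    by (simp add: q_times_eq q_mass_def set_lebesgue_integral_def)
qed

lemma q_times_singleton:
  assumes s: "s \<in> einterval a b"
  shows "q_times a b q u {s} = q {s} *v u s"
proof -
  have rc: "{s} \<in> rc_borel a b"
    using rc_borel_Icc[OF Icc_subset_einterval[OF s s]] by simp
  have "q_times a b q u {s} = (LINT x|V. (indicator {s} x *\<^sub>R q_density x) *v u s)"
    unfolding q_times_eq set_lebesgue_integral_def
    by (rule Bochner_Integration.integral_cong) (auto simp: indicator_def)
  also have "\<dots> = (LINT x|V. indicator {s} x *\<^sub>R q_density x) *v u s"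
    using q_density_integrable[OF rc]
    by (intro integral_bounded_linear[OF bounded_bilinear.bounded_linear_left[OF bounded_bilinear_matrix_vector]])
       (simp add: set_integrable_def)
  also have "\<dots> = q {s} *v u s"
    by (simp add: q_density_integral[OF rc] set_lebesgue_integral_def)
  finally show ?thesis .
qed

definition sol :: "(real \<Rightarrow> complex^'n) \<Rightarrow> (real set \<Rightarrow> complex^'n) \<Rightarrow> bool" where
  "sol u r \<longleftrightarrow> bv_bal a b u \<and> solves a b J q u r"

lemma sol_obtain:
  assumes "sol u r"
  obtains p where "dist0 a b p" "bal_prim a b p u" "\<And>A. A \<in> rc_borel a b \<Longrightarrow> J *v p A + q_times a b q u A = r A"
proof -
  obtain p where p: "dist0 a b p" "antiderivative a b p u"
    "\<forall>A\<in>rc_borel a b. J *v p A + q_times a b q u A = r A"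
    using assms unfolding sol_def solves_def by blast
  have "bal_prim a b p u"
    by (rule bv_bal_imp_bal_prim[OF p(1) _ p(2)]) (use assms in \<open>simp add: sol_def\<close>)
  then show ?thesis using that p by blast
qed

lemma solI:
  assumes "dist0 a b p" "bal_prim a b p u" "\<And>A. A \<in> rc_borel a b \<Longrightarrow> J *v p A + q_times a b q u A = r A"
  shows "sol u r"
  unfolding sol_def solves_def using bal_prim_imp_bv_bal[OF ab assms(1,2)] assms by blast

lemma sol_cong: "sol u r \<Longrightarrow> (\<And>A. A \<in> rc_borel a b \<Longrightarrow> r A = r' A) \<Longrightarrow> sol u r'"
  unfolding sol_def solves_def by auto

lemma sol_measurable:
  assumes "sol u r" "sets M = borel_on a b"
  shows "u \<in> borel_measurable M"
proof -
  obtain p where p: "dist0 a b p" "bal_prim a b p u" using sol_obtain[OF assms(1)] .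
  have "u \<in> borel_measurable (restrict_space borel (einterval a b))"
    by (rule bal_prim_measurable[OF ab p])
  then show ?thesis using measurable_cong_sets[OF assms(2) refl] by blast
qed

lemma sol_bounded:
  assumes "sol u r" "A \<in> rc_borel a b"
  shows "\<exists>S. \<forall>t\<in>A. norm (u t) \<le> S"
proof -
  obtain p where p: "dist0 a b p" "bal_prim a b p u" using sol_obtain[OF assms(1)] .
  obtain c d where cd: "A \<subseteq> {c..d}" "{c..d} \<subseteq> einterval a b" using rc_borelE[OF assms(2)] .
  show ?thesis using bal_prim_bounded[OF ab p cd(2)] cd(1) by blast
qed

lemma sol_q_times_integrable:
  assumes "sol u r" "A \<in> rc_borel a b"
  shows "set_integrable V A (\<lambda>x. q_density x *v u x)"
  using sol_bounded[OF assms] q_times_integrable[OF sol_measurable[OF assms(1) sets_M] assms(2)] by blast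

lemma bounded_linear_vec_scale: "bounded_linear (\<lambda>x :: complex^'m. c *s x)"
proof
  show "\<exists>K. \<forall>x :: complex^'m. norm (c *s x) \<le> norm x * K"
    by (auto intro!: exI[of _ "cmod c"] simp: vec_norm_scale)
qed (auto simp: vector_add_ldistrib scaleR_eq_scale mult.commute)

lemma sol_combination:
  assumes u: "sol u r" and v: "sol v s"
  shows "sol (\<lambda>x. u x + c *s v x) (\<lambda>A. r A + c *s s A)"
proof -
  obtain p where p: "dist0 a b p" "bal_prim a b p u" "\<And>A. A \<in> rc_borel a b \<Longrightarrow> J *v p A + q_times a b q u A = r A"
    using sol_obtain[OF u] by blast
  obtain p' where p': "dist0 a b p'" "bal_prim a b p' v" "\<And>A. A \<in> rc_borel a b \<Longrightarrow> J *v p' A + q_times a b q v A = s A"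
    using sol_obtain[OF v] by blast
  show ?thesis
  proof (rule solI)
    show "dist0 a b (\<lambda>A. p A + c *s p' A)"
      by (intro dist0_add p(1) dist0_bounded_linear[OF bounded_linear_vec_scale p'(1)])
    show "bal_prim a b (\<lambda>A. p A + c *s p' A) (\<lambda>x. u x + c *s v x)"
      unfolding bal_prim_def
    proof (intro allI impI)
      fix s t :: real assume st: "s < t" "{s..t} \<subseteq> einterval a b"
      have "u t - u s = (1/2) *\<^sub>R (p {s..t} + p {s<..<t})" "v t - v s = (1/2) *\<^sub>R (p' {s..t} + p' {s<..<t})"
        using p(2) p'(2) st unfolding bal_prim_def by blast+
      then have "(u t - u s) + c *s (v t - v s) =
         (1/2) *\<^sub>R (p {s..t} + p {s<..<t}) + c *s ((1/2) *\<^sub>R (p' {s..t} + p' {s<..<t}))"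
        by (simp only:)
      then show "u t + c *s v t - (u s + c *s v s) = (1/2) *\<^sub>R (p {s..t} + c *s p' {s..t} + (p {s<..<t} + c *s p' {s<..<t}))"
        by (simp add: vec_eq_iff scaleR_conv_of_real algebra_simps)
    qed
    fix A assume A: "A \<in> rc_borel a b"
    have "q_times a b q (\<lambda>x. u x + c *s v x) A = (LINT x:A|V. q_density x *v u x + c *s (q_density x *v v x))"
      by (simp add: q_times_eq matrix_vector_right_distrib vector_scalar_commute)
    also have "\<dots> = q_times a b q u A + (LINT x:A|V. c *s (q_density x *v v x))"
      unfolding q_times_eq
    proof (rule set_integral_add(2))
      show "set_integrable V A (\<lambda>x. c *s (q_density x *v v x))"
        using integrable_bounded_linear[OF bounded_linear_vec_scale, OF sol_q_times_integrable[OF v A, unfolded set_integrable_def]]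
        unfolding set_integrable_def by (simp add: linear_scale[OF bounded_linear.linear[OF bounded_linear_vec_scale]])
    qed (rule sol_q_times_integrable[OF u A])
    also have "(LINT x:A|V. c *s (q_density x *v v x)) = c *s q_times a b q v A"
      using integral_bounded_linear[OF bounded_linear_vec_scale, OF sol_q_times_integrable[OF v A, unfolded set_integrable_def]]
      unfolding set_lebesgue_integral_def q_times_eq
      by (simp add: linear_scale[OF bounded_linear.linear[OF bounded_linear_vec_scale]])
    finally show "J *v (p A + c *s p' A) + q_times a b q (\<lambda>x. u x + c *s v x) A = r A + c *s s A"
      unfolding p(3)[OF A, symmetric] p'(3)[OF A, symmetric]
      by (simp add: matrix_vector_right_distrib vector_scalar_commute vector_add_ldistrib)
  qed
qed

definition Jinv :: "complex^'n^'n" where "Jinv = matrix_inv J"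

lemma Jinv: "Jinv *v (J *v x) = x" "J *v (Jinv *v x) = x"
proof -
  have "J ** Jinv = mat 1 \<and> Jinv ** J = mat 1"
    unfolding Jinv_def matrix_inv_def by (rule someI_ex) (use J in \<open>simp add: invertible_def\<close>)
  then show "Jinv *v (J *v x) = x" "J *v (Jinv *v x) = x"
    by (simp_all add: matrix_vector_mul_assoc)
qed

lemma increment_bound:
  assumes p: "\<And>A. A \<in> rc_borel a b \<Longrightarrow> J *v p A + q_times a b q u A = r A"
    and u: "u \<in> borel_measurable V" and I: "I \<in> rc_borel a b" and S: "\<And>x. x \<in> I \<Longrightarrow> norm (u x) \<le> S" "0 \<le> S"
    and A: "A \<in> sets borel" "A \<subseteq> I" and N: "norm (r A) \<le> N"
  shows "norm (p A) \<le> norm Jinv * (N + S * q_mass I)"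
proof -
  have rc: "A \<in> rc_borel a b" by (rule rc_borel_subset[OF I A])
  have "p A = Jinv *v (J *v p A)" by (simp add: Jinv)
  also have "\<dots> = Jinv *v (r A - q_times a b q u A)"
    using p[OF rc] by (metis add_diff_cancel_right')
  finally have "norm (p A) \<le> norm Jinv * norm (r A - q_times a b q u A)"
    by (simp add: norm_matrix_vector_le)
  also have "norm (r A - q_times a b q u A) \<le> N + S * q_mass A"
    using norm_triangle_ineq4[of "r A" "q_times a b q u A"] N q_times_bound[OF u rc, of S] S A by force
  also have "S * q_mass A \<le> S * q_mass I"
    by (intro mult_left_mono q_mass_mono A I S)
  finally show ?thesis by (simp add: mult_left_mono)
qed

text \<open>The one-sided limits of a homogeneous solution at \<open>s\<close> are the images of its value under these two
  operators; the hypothesis on \<open>2J \<plusminus> \<Delta>\<^sub>q(s)\<close> is their invertibility.\<close>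

lemma jump_operator_bounds:
  assumes s: "s \<in> einterval a b" and e: "e = 1 \<or> e = -1"
  shows "\<exists>\<beta>\<ge>0. \<forall>v. norm v \<le> \<beta> * norm (v + (e/2) *\<^sub>R (Jinv *v (q {s} *v v))) \<and>
    norm (v + (e/2) *\<^sub>R (Jinv *v (q {s} *v v))) \<le> \<beta> * norm v"
proof -
  define L where "L = 2 *\<^sub>R J + e *\<^sub>R q {s}"
  have "invertible L" using jumps[OF s] e by (auto simp: L_def)
  then obtain K where K: "K ** L = mat 1" by (auto simp: invertible_def)
  define \<beta> where "\<beta> = 2 * norm K * norm J + (1 + norm Jinv * norm (q {s}))"
  have "\<beta> \<ge> 0" by (simp add: \<beta>_def)
  moreover have "norm v \<le> \<beta> * norm (v + (e/2) *\<^sub>R (Jinv *v (q {s} *v v)))" for v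
  proof -
    let ?b = "v + (e/2) *\<^sub>R (Jinv *v (q {s} *v v))"
    have sc: "(c *\<^sub>R A) *v x = c *\<^sub>R (A *v x)" for c and A :: "complex^'n^'n" and x
      by (rule linear_scale[OF bounded_linear.linear[OF bounded_bilinear.bounded_linear_left[OF bounded_bilinear_matrix_vector]]])
    have sc': "A *v (c *\<^sub>R x) = c *\<^sub>R (A *v x)" for c and A :: "complex^'n^'n" and x
      by (rule linear_scale[OF bounded_linear.linear[OF bounded_bilinear.bounded_linear_right[OF bounded_bilinear_matrix_vector]]])
    have "L *v v = 2 *\<^sub>R (J *v ?b)"
      by (simp add: L_def matrix_vector_mult_add_rdistrib matrix_vector_right_distrib Jinv sc
          sc' scaleR_add_right)
    then have "v = K *v (2 *\<^sub>R (J *v ?b))"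
      using K by (metis matrix_vector_mul_assoc matrix_vector_mul_lid)
    then have "norm v \<le> norm K * norm (2 *\<^sub>R (J *v ?b))"
      by (metis norm_matrix_vector_le)
    also have "\<dots> = 2 * norm K * norm (J *v ?b)" by simp
    also have "\<dots> \<le> 2 * norm K * (norm J * norm ?b)"
      by (intro mult_left_mono norm_matrix_vector_le) auto
    also have "\<dots> \<le> \<beta> * norm ?b"
      unfolding \<beta>_def mult.assoc[symmetric] by (intro mult_right_mono) auto
    finally show ?thesis .
  qed
  moreover have "norm (v + (e/2) *\<^sub>R (Jinv *v (q {s} *v v))) \<le> \<beta> * norm v" for v
  proof -
    have "norm (Jinv *v (q {s} *v v)) \<le> norm Jinv * (norm (q {s}) * norm v)"
      by (meson mult_left_mono norm_ge_zero norm_matrix_vector_le order_trans)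
    moreover have "norm ((e/2) *\<^sub>R (Jinv *v (q {s} *v v))) \<le> norm (Jinv *v (q {s} *v v))"
      using e by auto
    ultimately have "norm (v + (e/2) *\<^sub>R (Jinv *v (q {s} *v v))) \<le> norm v + norm Jinv * (norm (q {s}) * norm v)"
      using norm_triangle_ineq[of v "(e/2) *\<^sub>R (Jinv *v (q {s} *v v))"] by linarith
    also have "\<dots> = (1 + norm Jinv * norm (q {s})) * norm v" by (simp add: algebra_simps)
    also have "\<dots> \<le> \<beta> * norm v" unfolding \<beta>_def by (intro mult_right_mono) auto
    finally show ?thesis .
  qed
  ultimately show ?thesis by blast
qed

lemma q_mass_small:
  assumes A: "\<And>n::nat. A n \<in> rc_borel a b" "decseq A" "(\<Inter>n. A n) = {}" and \<eta>: "\<eta> > 0"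
  shows "\<exists>n. q_mass (A n) \<le> \<eta>"
proof -
  have "(\<lambda>n. q_mass (A n)) \<longlonglongrightarrow> 0"
    using dist0_decseq[OF dist0_q_mass A(1,2)] by (simp add: A(3) dist0_empty[OF dist0_q_mass])
  then have "\<forall>\<^sub>F n in sequentially. q_mass (A n) < \<eta>" by (rule order_tendstoD) (rule \<eta>)
  then show ?thesis by (auto simp: eventually_sequentially intro: less_imp_le)
qed

text \<open>For each of the two sides, the punctured one-sided neighbourhoods of \<open>s\<close> shrink to the empty set, so
  some of them has a small coefficient mass; the mass at \<open>s\<close> itself is absorbed by the jump operators.\<close>

lemma local_bound:
  assumes cd: "{c..d} \<subseteq> einterval a b" and s: "s \<in> {c..d}"
  shows "\<exists>\<epsilon>>0. \<exists>C\<ge>0. \<forall>u r N. sol u r \<longrightarrow> (\<forall>A\<in>sets borel. A \<subseteq> {c..d} \<longrightarrow> norm (r A) \<le> N) \<longrightarrow>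
    (\<forall>y\<in>{c..d}. \<bar>y - s\<bar> < \<epsilon> \<longrightarrow> norm (u y) \<le> C * (norm (u s) + N) \<and> norm (u s) \<le> C * (norm (u y) + N))"
proof -
  have sX: "s \<in> einterval a b" using s cd by auto
  \<comment> \<open>The part of the neighbourhood to the left of \<open>s\<close> for \<open>e = 1\<close>, to the right for \<open>e = -1\<close>.\<close>
  define side where "side e \<epsilon> = {y \<in> {c..d}. 0 < e * (s - y) \<and> e * (s - y) < \<epsilon>}" for e \<epsilon> :: real
  have side: "\<exists>\<epsilon>>0. \<exists>C\<ge>0. \<forall>u r N. sol u r \<longrightarrow> (\<forall>A\<in>sets borel. A \<subseteq> {c..d} \<longrightarrow> norm (r A) \<le> N) \<longrightarrow>
    (\<forall>y\<in>side e \<epsilon>. norm (u y) \<le> C * (norm (u s) + N) \<and> norm (u s) \<le> C * (norm (u y) + N))"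
    if e: "e = 1 \<or> e = -1" for e :: real
  proof -
    define lim where "lim v = v + (e/2) *\<^sub>R (Jinv *v (q {s} *v v))" for v
    obtain \<beta> where \<beta>: "0 \<le> \<beta>" "\<And>v. norm v \<le> \<beta> * norm (lim v)" "\<And>v. norm (lim v) \<le> \<beta> * norm v"
      using jump_operator_bounds[OF sX e] unfolding lim_def by blast
    define K where "K = 4 * (norm Jinv + 1) * (1 + 2 * \<beta>\<^sup>2)"
    have K: "0 < K"
      unfolding K_def by (intro mult_pos_pos) (auto intro: add_nonneg_pos add_pos_nonneg)
    define C where "C = 2 * \<beta> + 4 * norm Jinv + 8 * norm Jinv * \<beta>"
    have C: "0 \<le> C" unfolding C_def using \<beta>(1) by simp
    define A where "A n = side e (1 / real (Suc n))" for n
    have A_sub: "A n \<subseteq> {c..d}" for n by (auto simp: A_def side_def)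
    have "A n \<in> sets borel" for n
    proof -
      have "A n = {c..d} \<inter> (if e = 1 then {s - 1 / real (Suc n)<..<s} else {s<..<s + 1 / real (Suc n)})"
        using e by (auto simp: A_def side_def)
      then show ?thesis by simp
    qed
    then have A_rc: "A n \<in> rc_borel a b" for n
      by (rule rc_borel_in_Icc[OF cd _ A_sub])
    have dec: "decseq A"
    proof (rule decseq_SucI)
      fix n
      have "1 / real (Suc (Suc n)) \<le> 1 / real (Suc n)" by (simp add: field_simps)
      then show "A (Suc n) \<subseteq> A n" by (auto simp: A_def side_def)
    qed
    have int: "(\<Inter>n. A n) = {}"
    proof -
      have "y \<notin> (\<Inter>n. A n)" for y
      proof
        assume y: "y \<in> (\<Inter>n. A n)"
        then have "y \<in> A 0" by blast
        then have "0 < e * (s - y)" by (simp add: A_def side_def)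
        then obtain n where "1 / real (Suc n) < e * (s - y)"
          using reals_Archimedean by (auto simp: inverse_eq_divide)
        moreover have "y \<in> A n" using y by blast
        ultimately show False by (simp add: A_def side_def)
      qed
      then show ?thesis by blast
    qed
    from q_mass_small[of A "1 / K", OF A_rc dec int] K obtain n where "q_mass (A n) \<le> 1 / K"
      by auto
    then have n: "K * q_mass (A n) \<le> 1" using K by (simp add: field_simps)
    have main: "norm (u y) \<le> C * (norm (u s) + N) \<and> norm (u s) \<le> C * (norm (u y) + N)"
      if u: "sol u r" and N: "\<forall>A\<in>sets borel. A \<subseteq> {c..d} \<longrightarrow> norm (r A) \<le> N" and y: "y \<in> A n" for u r N y
    proof -
      obtain p where p: "dist0 a b p" "bal_prim a b p u" "\<And>A. A \<in> rc_borel a b \<Longrightarrow> J *v p A + q_times a b q u A = r A"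
        using sol_obtain[OF u] by blast
      have um: "u \<in> borel_measurable V" by (rule sol_measurable[OF u sets_M])
      have N0: "0 \<le> N" using N norm_ge_zero[of "r {}"] by (meson empty_subsetI order_trans sets.empty_sets)
      have rc_s: "{s} \<in> rc_borel a b" using rc_borel_in_Icc[OF cd, of "{s}"] s by simp
      have ps: "p {s} = Jinv *v r {s} - Jinv *v (q {s} *v u s)"
      proof -
        have "p {s} = Jinv *v (J *v p {s})" by (simp add: Jinv)
        also have "J *v p {s} = r {s} - q {s} *v u s"
          using p(3)[OF rc_s] by (simp add: q_times_singleton[OF sX] algebra_simps)
        finally show ?thesis by (simp add: matrix_vector_mult_diff_distrib)
      qed
      have near: "norm (u z - lim (u s)) \<le> norm Jinv * (2 * N + 2 * (S * q_mass (A n)))"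
        if S: "\<forall>y\<in>A n. norm (u y) \<le> S" and z: "z \<in> A n" for S z
      proof -
        have S0: "0 \<le> S" using S z norm_ge_zero order_trans by blast
        have z': "z \<in> {c..d}" "0 < e * (s - z)" using z by (auto simp: A_def side_def)
        have inc: "norm (p B) \<le> norm Jinv * (N + S * q_mass (A n))" if "B \<in> sets borel" "B \<subseteq> A n" for B
          using S S0 N that A_sub[of n] by (intro increment_bound[OF p(3) um A_rc]) auto
        define D where "D = {min s z<..<max s z}"
        have D: "D \<in> sets borel" "D \<subseteq> A n"
          using z s e by (auto simp: D_def A_def side_def)
        have sg: "sgn (z - s) = - e"
          using z'(2) e by (auto simp: sgn_real_def)
        have zs: "s \<noteq> z" "z \<in> einterval a b" using z' cd by auto
        have diff: "u z = u s - (e/2) *\<^sub>R p {s} - e *\<^sub>R p D - (e/2) *\<^sub>R p {z}"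
          unfolding bal_prim_step[OF p(1,2) sX zs(2,1)] sg D_def by (simp add: algebra_simps)
        have eq: "u z - lim (u s) = - ((e/2) *\<^sub>R (Jinv *v r {s}) + e *\<^sub>R p D + (e/2) *\<^sub>R p {z})"
          unfolding diff lim_def ps by (simp add: algebra_simps)
        have n1: "norm ((e/2) *\<^sub>R (Jinv *v r {s})) \<le> (1/2) * (norm Jinv * N)"
        proof -
          have "norm (Jinv *v r {s}) \<le> norm Jinv * norm (r {s})" by (rule norm_matrix_vector_le)
          also have "\<dots> \<le> norm Jinv * N" using N s by (intro mult_left_mono) auto
          finally show ?thesis using e by auto
        qed
        have n2: "norm (e *\<^sub>R p D) \<le> norm Jinv * (N + S * q_mass (A n))"
          using inc[OF D] e by auto
        have n3: "norm ((e/2) *\<^sub>R p {z}) \<le> (1/2) * (norm Jinv * (N + S * q_mass (A n)))"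
          using inc[of "{z}"] z e by auto
        have "norm (u z - lim (u s)) \<le> norm ((e/2) *\<^sub>R (Jinv *v r {s})) + norm (e *\<^sub>R p D) + norm ((e/2) *\<^sub>R p {z})"
          unfolding eq norm_minus_cancel
          by (intro order_trans[OF norm_triangle_ineq] add_right_mono norm_triangle_ineq)
        also have "\<dots> \<le> (1/2) * (norm Jinv * N) + norm Jinv * (N + S * q_mass (A n))
            + (1/2) * (norm Jinv * (N + S * q_mass (A n)))"
          by (intro add_mono n1 n2 n3)
        also have "\<dots> = norm Jinv * (2 * N + (3/2) * (S * q_mass (A n)))"
          by (simp add: algebra_simps)
        also have "\<dots> \<le> norm Jinv * (2 * N + 2 * (S * q_mass (A n)))"
          using mult_nonneg_nonneg[OF S0 q_mass_nonneg[of "A n"]] by (intro mult_left_mono) auto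
        finally show ?thesis .
      qed
      have bdd: "\<exists>S. \<forall>y\<in>A n. norm (u y) \<le> S" by (rule sol_bounded[OF u A_rc])
      show ?thesis
        unfolding C_def
        by (rule two_sided_estimate[OF \<beta>(1) norm_ge_zero N0 q_mass_nonneg n[unfolded K_def] \<beta>(2) \<beta>(3) bdd near y])
    qed
    show ?thesis
    proof (rule exI[of _ "1 / real (Suc n)"], rule conjI, simp, rule exI[of _ C], rule conjI[OF C], intro allI impI ballI)
      fix u r N y
      assume "sol u r" "\<forall>A\<in>sets borel. A \<subseteq> {c..d} \<longrightarrow> norm (r A) \<le> N" "y \<in> side e (1 / real (Suc n))"
      then show "norm (u y) \<le> C * (norm (u s) + N) \<and> norm (u s) \<le> C * (norm (u y) + N)"
        using main[of u r N y] by (simp add: A_def)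
    qed
  qed
  obtain \<epsilon>1 C1 where 1: "\<epsilon>1 > 0" "C1 \<ge> 0" "\<forall>u r N. sol u r \<longrightarrow> (\<forall>A\<in>sets borel. A \<subseteq> {c..d} \<longrightarrow> norm (r A) \<le> N) \<longrightarrow>
    (\<forall>y\<in>side 1 \<epsilon>1. norm (u y) \<le> C1 * (norm (u s) + N) \<and> norm (u s) \<le> C1 * (norm (u y) + N))"
    using side[of 1] by auto
  obtain \<epsilon>2 C2 where 2: "\<epsilon>2 > 0" "C2 \<ge> 0" "\<forall>u r N. sol u r \<longrightarrow> (\<forall>A\<in>sets borel. A \<subseteq> {c..d} \<longrightarrow> norm (r A) \<le> N) \<longrightarrow>
    (\<forall>y\<in>side (-1) \<epsilon>2. norm (u y) \<le> C2 * (norm (u s) + N) \<and> norm (u s) \<le> C2 * (norm (u y) + N))"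
    using side[of "-1"] by auto
  define C where "C = 1 + C1 + C2"
  have C: "0 \<le> C" using 1 2 by (simp add: C_def)
  show ?thesis
  proof (rule exI[of _ "min \<epsilon>1 \<epsilon>2"], rule conjI, (use 1 2 in simp), rule exI[of _ C], rule conjI[OF C], intro allI impI ballI)
    fix u r N y
    assume u: "sol u r" and N: "\<forall>A\<in>sets borel. A \<subseteq> {c..d} \<longrightarrow> norm (r A) \<le> N"
      and y: "y \<in> {c..d}" "\<bar>y - s\<bar> < min \<epsilon>1 \<epsilon>2"
    have N0: "0 \<le> N" using N norm_ge_zero[of "r {}"] by (meson empty_subsetI order_trans sets.empty_sets)
    have grow: "C' * (norm z + N) \<le> C * (norm z + N)" if "C' \<le> C" for C' and z :: "complex^'n"
      using that N0 by (intro mult_right_mono) auto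
    have le: "1 \<le> C" "C1 \<le> C" "C2 \<le> C" using 1(2) 2(2) by (auto simp: C_def)
    consider "y = s" | "y \<in> side 1 \<epsilon>1" | "y \<in> side (-1) \<epsilon>2"
      using y by (cases y s rule: linorder_cases) (auto simp: side_def)
    then show "norm (u y) \<le> C * (norm (u s) + N) \<and> norm (u s) \<le> C * (norm (u y) + N)"
    proof cases
      case 1
      then show ?thesis using grow[OF le(1), of "u s"] N0 by simp
    next
      case 2
      then have "norm (u y) \<le> C1 * (norm (u s) + N)" "norm (u s) \<le> C1 * (norm (u y) + N)"
        using 1(3) u N by blast+
      then show ?thesis using grow[OF le(2), of "u s"] grow[OF le(2), of "u y"] by linarith
    next
      case 3
      then have "norm (u y) \<le> C2 * (norm (u s) + N)" "norm (u s) \<le> C2 * (norm (u y) + N)"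
        using \<open>\<forall>u r N. sol u r \<longrightarrow> (\<forall>A\<in>sets borel. A \<subseteq> {c..d} \<longrightarrow> norm (r A) \<le> N) \<longrightarrow>
          (\<forall>y\<in>side (-1) \<epsilon>2. norm (u y) \<le> C2 * (norm (u s) + N) \<and> norm (u s) \<le> C2 * (norm (u y) + N))\<close> u N by blast+
      then show ?thesis using grow[OF le(3), of "u s"] grow[OF le(3), of "u y"] by linarith
    qed
  qed
qed

text \<open>Local comparability of the values of all solutions chains to compact intervals by bisection. The
  constant depends on the coefficients and the interval only. The right-hand side enters through its
  largest value on the interval, so differences of solutions are covered as well.\<close>

theorem sol_bound:
  assumes cd: "c \<le> d" "{c..d} \<subseteq> einterval a b"
  shows "\<exists>C\<ge>0. \<forall>u r N. sol u r \<longrightarrow> (\<forall>A\<in>sets borel. A \<subseteq> {c..d} \<longrightarrow> norm (r A) \<le> N) \<longrightarrow>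
    (\<forall>y\<in>{c..d}. \<forall>z\<in>{c..d}. norm (u y) \<le> C * (norm (u z) + N))"
proof -
  define small where "small r N \<longleftrightarrow> (\<forall>A\<in>sets borel. A \<subseteq> {c..d} \<longrightarrow> norm (r A) \<le> N)"
    for r :: "real set \<Rightarrow> complex^'n" and N
  have small_nonneg: "0 \<le> N" if "small r N" for r :: "real set \<Rightarrow> complex^'n" and N
    using that norm_ge_zero[of "r {}"] unfolding small_def by (meson empty_subsetI order_trans sets.empty_sets)
  define P where "P s t \<longleftrightarrow> (c \<le> s \<and> t \<le> d \<longrightarrow> (\<exists>C\<ge>0. \<forall>u r N. sol u r \<longrightarrow> small r N \<longrightarrow>
    (\<forall>y\<in>{s..t}. \<forall>z\<in>{s..t}. norm (u y) \<le> C * (norm (u z) + N))))" for s t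
  have compose: "x \<le> (C1 * C2 + C1) * (z + N)"
    if "x \<le> C1 * (y + N)" "y \<le> C2 * (z + N)" "0 \<le> C1" "0 \<le> C2" "0 \<le> N" "0 \<le> z" for x y z C1 C2 N :: real
  proof -
    have "C1 * (y + N) \<le> C1 * (C2 * (z + N) + N)"
      using that by (intro mult_left_mono) auto
    also have "\<dots> \<le> (C1 * C2 + C1) * (z + N)"
      using that by (simp add: algebra_simps)
    finally show ?thesis using that by linarith
  qed
  have "P c d"
    using cd(1)
  proof (induction rule: Bolzano)
    case (trans s m t)
    show ?case
      unfolding P_def
    proof
      assume st: "c \<le> s \<and> t \<le> d"
      obtain C1 where C1: "C1 \<ge> 0" "\<And>u r N y z. sol u r \<Longrightarrow> small r N \<Longrightarrow> y \<in> {s..m} \<Longrightarrow> z \<in> {s..m} \<Longrightarrow> norm (u y) \<le> C1 * (norm (u z) + N)"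
        using trans st unfolding P_def by (meson order_trans)
      obtain C2 where C2: "C2 \<ge> 0" "\<And>u r N y z. sol u r \<Longrightarrow> small r N \<Longrightarrow> y \<in> {m..t} \<Longrightarrow> z \<in> {m..t} \<Longrightarrow> norm (u y) \<le> C2 * (norm (u z) + N)"
        using trans st unfolding P_def by (meson order_trans)
      define C where "C = (C1 * C2 + C1) + (C2 * C1 + C2)"
      have C: "C \<ge> 0" unfolding C_def using C1(1) C2(1) by simp
      have "norm (u y) \<le> C * (norm (u z) + N)" if u: "sol u r" and N: "small r N" and yz: "y \<in> {s..t}" "z \<in> {s..t}" for u r N y z
      proof -
        have m: "m \<in> {s..m}" "m \<in> {m..t}" using trans by auto
        have N0: "0 \<le> N" using small_nonneg[OF N] .
        have nn: "0 \<le> C1 * C2" using C1(1) C2(1) by simp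
        have grow: "C' * (norm (u z) + N) \<le> C * (norm (u z) + N)" if "C' \<le> C" for C'
          using that N0 by (intro mult_right_mono) auto
        have le: "C1 \<le> C" "C2 \<le> C" "C1 * C2 + C1 \<le> C" "C2 * C1 + C2 \<le> C"
          using C1(1) C2(1) nn by (auto simp: C_def mult.commute)
        consider "y \<in> {s..m}" "z \<in> {s..m}" | "y \<in> {s..m}" "z \<in> {m..t}" | "y \<in> {m..t}" "z \<in> {s..m}" | "y \<in> {m..t}" "z \<in> {m..t}"
          using yz by fastforce
        then show ?thesis
        proof cases
          case 1 then show ?thesis using C1(2)[OF u N 1] grow[OF le(1)] by linarith
        next
          case 2 then show ?thesis
            using compose[OF C1(2)[OF u N 2(1) m(1)] C2(2)[OF u N m(2) 2(2)] C1(1) C2(1) N0] grow[OF le(3)] by simp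
        next
          case 3 then show ?thesis
            using compose[OF C2(2)[OF u N 3(1) m(2)] C1(2)[OF u N m(1) 3(2)] C2(1) C1(1) N0] grow[OF le(4)] by simp
        next
          case 4 then show ?thesis using C2(2)[OF u N 4] grow[OF le(2)] by linarith
        qed
      qed
      then show "\<exists>C\<ge>0. \<forall>u r N. sol u r \<longrightarrow> small r N \<longrightarrow> (\<forall>y\<in>{s..t}. \<forall>z\<in>{s..t}. norm (u y) \<le> C * (norm (u z) + N))"
        using C by (intro exI[of _ C]) simp
    qed
  next
    case (local x)
    then have x: "x \<in> {c..d}" by simp
    obtain \<epsilon> C where \<epsilon>: "\<epsilon> > 0" and C: "C \<ge> 0" and est: "\<forall>u r N. sol u r \<longrightarrow> small r N \<longrightarrow>
      (\<forall>y\<in>{c..d}. \<bar>y - x\<bar> < \<epsilon> \<longrightarrow> norm (u y) \<le> C * (norm (u x) + N) \<and> norm (u x) \<le> C * (norm (u y) + N))"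
      using local_bound[OF cd(2) x] unfolding small_def by auto
    have "P s t" if "s \<le> x \<and> x \<le> t \<and> t - s < \<epsilon>" for s t
      unfolding P_def
    proof
      assume st: "c \<le> s \<and> t \<le> d"
      have "norm (u y) \<le> (C * C + C) * (norm (u z) + N)"
        if u: "sol u r" and N: "small r N" and yz: "y \<in> {s..t}" "z \<in> {s..t}" for u r N y z
      proof -
        have "y \<in> {c..d}" "\<bar>y - x\<bar> < \<epsilon>" "z \<in> {c..d}" "\<bar>z - x\<bar> < \<epsilon>"
          using yz st \<open>s \<le> x \<and> x \<le> t \<and> t - s < \<epsilon>\<close> by auto
        then have "norm (u y) \<le> C * (norm (u x) + N)" "norm (u x) \<le> C * (norm (u z) + N)"
          using est u N by blast+
        then show ?thesis
          by (rule compose) (use C small_nonneg[OF N] in auto)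
      qed
      then show "\<exists>C\<ge>0. \<forall>u r N. sol u r \<longrightarrow> small r N \<longrightarrow> (\<forall>y\<in>{s..t}. \<forall>z\<in>{s..t}. norm (u y) \<le> C * (norm (u z) + N))"
        using C by (intro exI[of _ "C * C + C"]) simp
    qed
    then show ?case using \<epsilon> by blast
  qed
  then show ?thesis by (simp add: P_def small_def)
qed

corollary sol_unique:
  assumes u: "sol u r" "\<And>A. A \<in> rc_borel a b \<Longrightarrow> r A = 0"
    and x: "x \<in> einterval a b" "u x = 0" and y: "y \<in> einterval a b"
  shows "u y = 0"
proof -
  have sub: "{min x y..max x y} \<subseteq> einterval a b"
    by (rule Icc_subset_einterval) (use x y in \<open>auto simp: min_def max_def\<close>)
  have "min x y \<le> max x y" by simp
  from sol_bound[OF this sub]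
  obtain C where C: "\<forall>u r N. sol u r \<longrightarrow> (\<forall>A\<in>sets borel. A \<subseteq> {min x y..max x y} \<longrightarrow> norm (r A) \<le> N) \<longrightarrow>
    (\<forall>z\<in>{min x y..max x y}. \<forall>z'\<in>{min x y..max x y}. norm (u z) \<le> C * (norm (u z') + N))"
    by blast
  have "\<forall>A\<in>sets borel. A \<subseteq> {min x y..max x y} \<longrightarrow> norm (r A) \<le> 0"
    using rc_borel_in_Icc[OF sub] u(2) by simp
  then have "norm (u y) \<le> C * (norm (u x) + 0)"
    by (intro C[THEN spec, THEN spec, THEN spec, THEN mp, OF u(1), THEN mp, THEN bspec, THEN bspec]) auto
  then show ?thesis using x(2) by simp
qed

end

section \<open>Solutions of the inhomogeneous equation\<close>

locale weighted_ode = ode a b J q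
  for a b :: ereal and J :: "complex^'n^'n" and q :: "real set \<Rightarrow> complex^'n^'n" +
  fixes w :: "real set \<Rightarrow> complex^'n^'n" and x0 :: real
  assumes w: "dist0 a b w" "nonneg_dist a b w" and x0: "x0 \<in> einterval a b"
begin

abbreviation "M \<equiv> tr_measure a b w"
abbreviation "W \<equiv> w_density a b w"

sublocale tr: rc_measure a b M
  by (rule rc_measure_tr_measure[OF ab w])

sublocale H: weighted_L2 M W
  by (rule weighted_L2_w[OF ab w])

lemma pre_L2_eq: "pre_L2 a b w = H.wspace"
  by (simp add: pre_L2_def H.wspace_def H.wsq_def)

lemma pre_inner_eq: "pre_inner a b w = H.wip"
  by (simp add: pre_inner_def H.wip_def fun_eq_iff)

definition indicator_axis :: "real set \<Rightarrow> 'n \<Rightarrow> real \<Rightarrow> complex^'n" where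
  "indicator_axis A i x = indicator A x *\<^sub>R axis i 1"

lemma wsq_indicator_axis_le: "AE x in M. H.wsq (indicator_axis A i) x \<le> indicator A x"
  using H.W_contraction
proof eventually_elim
  case (elim x)
  have n: "(norm (axis i 1 :: complex^'n))\<^sup>2 = 1"
    by (simp add: norm_sq_cinner cinner_axis_left)
  have "H.wsq (indicator_axis A i) x \<le> (norm (indicator_axis A i x))\<^sup>2"
    using elim by (simp add: H.wsq_def pos_contraction_def)
  also have "\<dots> = indicator A x"
    using n by (simp add: indicator_axis_def indicator_def)
  finally show ?case .
qed

lemma indicator_axis_wspace:
  assumes A: "A \<in> rc_borel a b"
  shows "indicator_axis A i \<in> H.wspace" "H.nrm (indicator_axis A i) \<le> sqrt (measure M A)"
proof -
  have [measurable]: "A \<in> sets M" using tr.rc_in_sets[OF A] .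
  have int: "integrable M (indicator A :: real \<Rightarrow> real)"
    using tr.finite_rc[OF A] by (intro integrable_real_indicator) auto
  show 1: "indicator_axis A i \<in> H.wspace"
    by (rule H.wspaceI[OF _ int wsq_indicator_axis_le]) (unfold indicator_axis_def[abs_def], measurable)
  have "(H.nrm (indicator_axis A i))\<^sup>2 = (LINT x|M. H.wsq (indicator_axis A i) x)"
    by (rule H.nrm_sq_integral[OF 1])
  also have "\<dots> \<le> (LINT x|M. indicator A x)"
    by (rule integral_mono_AE[OF H.wsq_integrable[OF 1] int wsq_indicator_axis_le])
  also have "\<dots> = measure M A" by simp
  finally show "H.nrm (indicator_axis A i) \<le> sqrt (measure M A)"
    by (rule real_le_rsqrt)
qed

text \<open>The components of \<open>wf\<close> are inner products with functions of compact support, which bounds the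
  distribution \<open>wf\<close> by the norm of \<open>f\<close>.\<close>

lemma w_times_component:
  assumes f: "f \<in> H.wspace" and A: "A \<in> rc_borel a b"
  shows "w_times a b w f A $ i = H.wip (indicator_axis A i) f"
proof -
  have [measurable]: "A \<in> sets M" "f \<in> borel_measurable M" "W \<in> borel_measurable M"
    using tr.rc_in_sets[OF A] f H.wspace_measurable H.W_measurable by auto
  have "integrable M (\<lambda>x. indicator A x *\<^sub>R (W x *v f x))"
  proof (rule Bochner_Integration.integrable_bound)
    show "integrable M (\<lambda>x. indicator A x + H.wsq f x)"
      using tr.finite_rc[OF A]
      by (intro Bochner_Integration.integrable_add H.wsq_integrable f integrable_real_indicator) auto
    show "AE x in M. norm (indicator A x *\<^sub>R (W x *v f x)) \<le> norm (indicator A x + H.wsq f x)"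
      using H.W_contraction H.wsq_nonneg_AE[of f]
    proof eventually_elim
      case (elim x)
      define t where "t = norm (W x *v f x)"
      have t: "0 \<le> t" "t\<^sup>2 \<le> H.wsq f x"
        using pos_contraction_norm_sq_le[OF elim(1), of "f x"] by (auto simp: t_def H.wsq_def)
      have "t \<le> 1 + t\<^sup>2"
        using zero_le_power2[of "t - 1/2"] by (simp add: power2_eq_square algebra_simps)
      then show ?case using t elim(2) by (auto simp: indicator_def t_def)
    qed
  qed measurable
  then have "w_times a b w f A $ i = (LINT x|M. (indicator A x *\<^sub>R (W x *v f x)) $ i)"
    unfolding w_times_def set_lebesgue_integral_def
    by (rule integral_bounded_linear[OF bounded_linear_vec_nth, symmetric])
  also have "\<dots> = H.wip (indicator_axis A i) f"
    unfolding H.wip_def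
  proof (rule Bochner_Integration.integral_cong)
    fix x
    have "indicator_axis A i x = complex_of_real (indicator A x) *s axis i 1"
      by (simp add: indicator_axis_def scaleR_eq_scale)
    then show "(indicator A x *\<^sub>R (W x *v f x)) $ i = cinner (indicator_axis A i x) (W x *v f x)"
      by (simp add: cinner_scale_left cinner_axis_left) (simp add: scaleR_conv_of_real)
  qed simp
  finally show ?thesis .
qed

lemma norm_w_times_le:
  assumes f: "f \<in> H.wspace" and A: "A \<in> rc_borel a b"
  shows "norm (w_times a b w f A) \<le> real CARD('n) * sqrt (measure M A) * H.nrm f"
proof -
  have "norm (w_times a b w f A) \<le> (\<Sum>i\<in>UNIV. norm (w_times a b w f A $ i))"
    unfolding norm_vec_def by (rule L2_set_le_sum) simp
  also have "\<dots> \<le> (\<Sum>(i::'n)\<in>UNIV. sqrt (measure M A) * H.nrm f)"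
  proof (rule sum_mono)
    fix i
    have "norm (w_times a b w f A $ i) \<le> H.nrm (indicator_axis A i) * H.nrm f"
      unfolding w_times_component[OF f A] by (rule H.Cauchy_Schwarz[OF indicator_axis_wspace(1)[OF A] f])
    also have "\<dots> \<le> sqrt (measure M A) * H.nrm f"
      by (intro mult_right_mono indicator_axis_wspace(2) A H.nrm_nonneg f)
    finally show "norm (w_times a b w f A $ i) \<le> sqrt (measure M A) * H.nrm f" .
  qed
  finally show ?thesis by simp
qed

lemma w_times_combination:
  assumes "f \<in> H.wspace" "g \<in> H.wspace" "A \<in> rc_borel a b"
  shows "w_times a b w (f + (\<lambda>x. c *s g x)) A = w_times a b w f A + c *s w_times a b w g A"
  using assms
  by (simp add: vec_eq_iff w_times_component H.V_closed H.ip_add_right H.ip_scale_right indicator_axis_wspace)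

lemma w_times_null: "f \<in> H.wspace \<Longrightarrow> H.nrm f = 0 \<Longrightarrow> A \<in> rc_borel a b \<Longrightarrow> w_times a b w f A = 0"
  using norm_w_times_le[of f A] by simp

lemma w_times_cong:
  assumes "f \<in> H.wspace" "g \<in> H.wspace" "H.nrm (f - g) = 0" "A \<in> rc_borel a b"
  shows "w_times a b w f A = w_times a b w g A"
proof -
  have "f = g + (\<lambda>x. 1 *s (f - g) x)" by (simp add: fun_eq_iff)
  then have "w_times a b w f A = w_times a b w g A + 1 *s w_times a b w (f - g) A"
    using w_times_combination[of g "f - g" A 1] assms H.V_closed by metis
  then show ?thesis using w_times_null[of "f - g" A] assms by (simp add: H.V_closed)
qed

definition N0 :: "(complex^'n) set" where
  "N0 = init_null a b J q w x0"

lemma sol_null_iff: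
  "u \<in> sol_null a b J q w \<longleftrightarrow> sol u (\<lambda>A. 0) \<and> (\<forall>A\<in>rc_borel a b. w_times a b w u A = 0)"
  by (auto simp: sol_null_def sol_def)

text \<open>If the integrals of \<open>W u\<close> over all relatively compact Borel sets vanish, then \<open>W u\<close> vanishes almost
  everywhere. Hence adding a homogeneous null solution does not change the class of a function.\<close>

lemma sol_null_wspace:
  assumes u: "u \<in> sol_null a b J q w"
  shows "u \<in> H.wspace" "H.nrm u = 0"
proof -
  have s: "sol u (\<lambda>A. 0)" and wu: "\<And>A. A \<in> rc_borel a b \<Longrightarrow> w_times a b w u A = 0"
    using u by (auto simp: sol_null_iff)
  have um [measurable]: "u \<in> borel_measurable M"
    by (rule sol_measurable[OF s tr.sets_M])
  have [measurable]: "W \<in> borel_measurable M" by (rule H.W_measurable)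
  have int: "set_integrable M A (\<lambda>x. W x *v u x)" if A: "A \<in> rc_borel a b" for A
  proof -
    obtain S where "\<forall>t\<in>A. norm (u t) \<le> S" using sol_bounded[OF s A] by blast
    then show ?thesis
      by (intro tr.set_integrable_matrix_vector[OF H.W_measurable um A w_density(2)[OF ab w A]]) auto
  qed
  have "AE x in M. 0 \<le> L (W x *v u x)" if L: "bounded_linear L" for L :: "complex^'n \<Rightarrow> real"
  proof (rule tr.AE_nonneg_of_integrals)
    have ind: "indicator A x *\<^sub>R L (W x *v u x) = L (indicator A x *\<^sub>R (W x *v u x))" for A x
      by (rule linear_scale[OF bounded_linear.linear[OF L], symmetric])
    show "(\<lambda>x. L (W x *v u x)) \<in> borel_measurable M"
      by (rule borel_measurable_continuous_on[OF linear_continuous_on[OF L]]) measurable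
    show "set_integrable M A (\<lambda>x. L (W x *v u x))" if A: "A \<in> rc_borel a b" for A
      unfolding set_integrable_def ind
      using int[OF A] by (intro integrable_bounded_linear[OF L]) (simp add: set_integrable_def)
    show "0 \<le> (LINT x:A|M. L (W x *v u x))" if A: "A \<in> rc_borel a b" for A
    proof -
      have "(LINT x:A|M. L (W x *v u x)) = L (w_times a b w u A)"
        unfolding set_lebesgue_integral_def ind w_times_def
        using int[OF A] by (intro integral_bounded_linear[OF L]) (simp add: set_integrable_def)
      then show ?thesis using wu[OF A] bounded_linear.linear[OF L] by (simp add: linear_0)
    qed
  qed
  note nonneg = this
  have pos: "AE x in M. 0 \<le> (W x *v u x) \<bullet> e" "AE x in M. 0 \<le> - ((W x *v u x) \<bullet> e)" for e
    by (rule nonneg[OF bounded_linear_inner_left], rule nonneg[OF bounded_linear_minus[OF bounded_linear_inner_left]])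
  have "AE x in M. (W x *v u x) \<bullet> e = 0" for e
    using pos[of e] by eventually_elim simp
  then have "AE x in M. \<forall>e\<in>Basis. (W x *v u x) \<bullet> e = 0"
    by (intro AE_finite_allI finite_Basis)
  then have Wu: "AE x in M. W x *v u x = 0"
    by eventually_elim (simp add: euclidean_eq_iff[where 'a = "complex^'n"])
  show "u \<in> H.wspace"
  proof (rule H.wspaceI[OF um, of "\<lambda>x. 0"])
    show "AE x in M. H.wsq u x \<le> 0" using Wu by eventually_elim (simp add: H.wsq_def)
  qed simp
  then show "H.nrm u = 0" using Wu by (simp add: H.nrm_eq_0_iff_AE)
qed

lemma sol_zero: "sol (\<lambda>x. 0) (\<lambda>A. 0)"
proof (rule solI)
  show "dist0 a b (\<lambda>A. 0 :: complex^'n)" by (simp add: dist0_def)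
  show "bal_prim a b (\<lambda>A. 0 :: complex^'n) (\<lambda>x. 0)" by (simp add: bal_prim_def)
qed (simp add: q_times_eq)

lemma sol_null_combination:
  assumes "u \<in> sol_null a b J q w" "v \<in> sol_null a b J q w"
  shows "(\<lambda>x. u x + c *s v x) \<in> sol_null a b J q w"
proof -
  have "sol (\<lambda>x. u x + c *s v x) (\<lambda>A. 0 + c *s 0)"
    by (rule sol_combination) (use assms in \<open>auto simp: sol_null_iff\<close>)
  moreover have "w_times a b w (\<lambda>x. u x + c *s v x) A = 0" if "A \<in> rc_borel a b" for A
    using w_times_combination[OF sol_null_wspace(1)[OF assms(1)] sol_null_wspace(1)[OF assms(2)] that, of c] assms that
    by (simp add: sol_null_iff plus_fun_def)
  ultimately show ?thesis by (simp add: sol_null_iff)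
qed

lemma N0I: "u \<in> sol_null a b J q w \<Longrightarrow> u x0 \<in> N0"
  unfolding N0_def init_null_def by blast

lemma N0_combination:
  assumes "x \<in> N0" "y \<in> N0"
  shows "x + c *s y \<in> N0"
proof -
  obtain u v where "u \<in> sol_null a b J q w" "v \<in> sol_null a b J q w" "x = u x0" "y = v x0"
    using assms unfolding N0_def init_null_def by blast
  then show ?thesis
    using N0I[OF sol_null_combination[of u v c]] by simp
qed

lemma N0_zero: "0 \<in> N0"
proof -
  have "(\<lambda>x. 0) \<in> sol_null a b J q w"
    using sol_zero w_times_null[OF H.wspace_zero H.nrm_zero] by (simp add: sol_null_iff zero_fun_def)
  from N0I[OF this] show ?thesis .
qed

lemma corth_combination: "x \<in> corth S \<Longrightarrow> y \<in> corth S \<Longrightarrow> x + c *s y \<in> corth S"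
  by (simp add: corth_def cinner_add_right cinner_scale_right)

text \<open>The orthogonal decomposition is taken with respect to the real inner product. Since \<open>N0\<close> is closed under
  multiplication by \<open>\<i>\<close>, real orthogonality to \<open>N0\<close> implies complex orthogonality.\<close>

lemma N0_decomposition: "\<exists>y\<in>N0. x - y \<in> corth N0"
proof -
  have sub: "subspace N0"
    unfolding subspace_def
    using N0_zero N0_combination[of _ _ 1] N0_combination[OF N0_zero] by (auto simp: scaleR_eq_scale)
  obtain y z where yz: "y \<in> span N0" "\<And>v. v \<in> span N0 \<Longrightarrow> orthogonal z v" "x = y + z"
    using orthogonal_subspace_decomp_exists[of N0 x] by metis
  have "cinner v z = 0" if v: "v \<in> N0" for v
  proof -
    have "\<i> *s v \<in> N0" using N0_combination[OF N0_zero v, of \<i>] by simp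
    then have "orthogonal z v" "orthogonal z (\<i> *s v)"
      using yz(2) v by (auto intro: span_base)
    then have "cinner z v = 0"
      by (auto simp: orthogonal_def inner_eq_cinner cinner_scale_right complex_eq_iff)
    then show ?thesis using cinner_commute[of v z] by simp
  qed
  then show ?thesis
  proof (intro bexI[of _ y])
    show "y \<in> N0" using span_minimal[OF order_refl sub] yz(1) by blast
  qed (simp add: corth_def yz(3))
qed

definition pairs :: "((real \<Rightarrow> complex^'n) \<times> (real \<Rightarrow> complex^'n)) set" where
  "pairs = {(u, f). u \<in> H.wspace \<and> f \<in> H.wspace \<and> sol u (w_times a b w f)}"

lemma pre_T_max_eq: "pre_T_max a b J q w = pairs"
  by (auto simp: pre_T_max_def pairs_def pre_L2_eq sol_def)

lemma pairs_combination:
  assumes "(u, f) \<in> pairs" "(v, g) \<in> pairs"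
  shows "(u + (\<lambda>x. c *s v x), f + (\<lambda>x. c *s g x)) \<in> pairs"
proof -
  have "sol (\<lambda>x. u x + c *s v x) (\<lambda>A. w_times a b w f A + c *s w_times a b w g A)"
    by (rule sol_combination) (use assms in \<open>auto simp: pairs_def\<close>)
  then have "sol (u + (\<lambda>x. c *s v x)) (w_times a b w (f + (\<lambda>x. c *s g x)))"
    unfolding plus_fun_def[of u]
    by (rule sol_cong) (use assms w_times_combination in \<open>auto simp: pairs_def\<close>)
  then show ?thesis using assms by (auto simp: pairs_def intro: H.V_closed)
qed

lemma pairs_zero: "(0, 0) \<in> pairs"
proof -
  have "sol 0 (w_times a b w 0)"
    using sol_cong[OF sol_zero, of "w_times a b w 0"] w_times_null[OF H.wspace_zero H.nrm_zero]
    by (simp add: zero_fun_def)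
  then show ?thesis by (simp add: pairs_def H.wspace_zero)
qed

lemma pairs_bound:
  assumes "{c..d} \<subseteq> einterval a b"
  shows "\<exists>C\<ge>0. \<forall>(u, f)\<in>pairs. \<forall>y\<in>{c..d}. \<forall>z\<in>{c..d}. norm (u y) \<le> C * (norm (u z) + H.nrm f)"
proof (cases "c \<le> d")
  case True
  obtain C where C: "C \<ge> 0" "\<forall>u r N. sol u r \<longrightarrow> (\<forall>A\<in>sets borel. A \<subseteq> {c..d} \<longrightarrow> norm (r A) \<le> N) \<longrightarrow>
    (\<forall>y\<in>{c..d}. \<forall>z\<in>{c..d}. norm (u y) \<le> C * (norm (u z) + N))"
    using sol_bound[OF True assms] by blast
  define k where "k = real CARD('n) * sqrt (measure M {c..d})"
  have k: "k \<ge> 0" by (simp add: k_def)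
  have "norm (u y) \<le> (C * (1 + k)) * (norm (u z) + H.nrm f)"
    if uf: "(u, f) \<in> pairs" and yz: "y \<in> {c..d}" "z \<in> {c..d}" for u f y z
  proof -
    have f: "f \<in> H.wspace" and s: "sol u (w_times a b w f)" using uf by (auto simp: pairs_def)
    have "norm (w_times a b w f A) \<le> k * H.nrm f" if A: "A \<in> sets borel" "A \<subseteq> {c..d}" for A
    proof -
      have rc: "A \<in> rc_borel a b" by (rule rc_borel_in_Icc[OF assms A])
      have "measure M A \<le> measure M {c..d}"
        using dist0_Diff[OF tr.dist0_measure rc_borel_Icc[OF assms] A] measure_nonneg[of M "{c..d} - A"] by simp
      then have "real CARD('n) * sqrt (measure M A) * H.nrm f \<le> k * H.nrm f"
        unfolding k_def using f by (intro mult_right_mono mult_left_mono) auto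
      then show ?thesis using norm_w_times_le[OF f rc] by simp
    qed
    then have "norm (u y) \<le> C * (norm (u z) + k * H.nrm f)"
      by (intro C(2)[THEN spec, THEN spec, THEN spec, THEN mp, OF s, THEN mp, THEN bspec, THEN bspec] yz) auto
    also have "\<dots> \<le> C * ((1 + k) * (norm (u z) + H.nrm f))"
    proof (rule mult_left_mono[OF _ C(1)])
      have "(1 + k) * (norm (u z) + H.nrm f) = (norm (u z) + k * H.nrm f) + (k * norm (u z) + H.nrm f)"
        by (simp add: algebra_simps)
      then show "norm (u z) + k * H.nrm f \<le> (1 + k) * (norm (u z) + H.nrm f)"
        using k f by simp
    qed
    finally show ?thesis by (simp add: mult.assoc)
  qed
  then show ?thesis using C(1) k by (intro exI[of _ "C * (1 + k)"]) auto
qed auto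

text \<open>A normalized sequence violating the bound has, along a subsequence, convergent values at \<open>x0\<close>.
  The a priori bound applied to differences turns this into locally bounded pointwise convergence; the
  limit solves the homogeneous equation and is a null vector of the weighted space. Its value at \<open>x0\<close>
  is then a unit vector in \<open>N0\<close> and orthogonal to \<open>N0\<close>.\<close>

lemma evaluation_bound_at_x0:
  "\<exists>C. \<forall>u f. (u, f) \<in> pairs \<longrightarrow> u x0 \<in> corth N0 \<longrightarrow> norm (u x0) \<le> C * (H.nrm u + H.nrm f)"
proof (rule ccontr)
  assume contr: "\<not> ?thesis"
  have "\<exists>u f. (u, f) \<in> pairs \<and> u x0 \<in> corth N0 \<and> norm (u x0) = 1 \<and> H.nrm u + H.nrm f \<le> 1 / real (Suc k)" for k
  proof -
    have "\<not> (\<forall>u f. (u, f) \<in> pairs \<longrightarrow> u x0 \<in> corth N0 \<longrightarrow> norm (u x0) \<le> real (Suc k) * (H.nrm u + H.nrm f))"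
      using contr by (rule contrapos_nn) (rule exI)
    then obtain u f where uf: "(u, f) \<in> pairs" "u x0 \<in> corth N0"
      and big: "\<not> norm (u x0) \<le> real (Suc k) * (H.nrm u + H.nrm f)"
      by (auto simp only: not_all not_imp)
    have u: "u \<in> H.wspace" "f \<in> H.wspace" using uf by (auto simp: pairs_def)
    have "0 \<le> real (Suc k) * (H.nrm u + H.nrm f)" using u by simp
    then have pos: "norm (u x0) > 0" using big by linarith
    define c where "c = complex_of_real (1 / norm (u x0))"
    have nc: "cmod c = 1 / norm (u x0)" using pos by (simp add: c_def norm_divide)
    have "(0 + (\<lambda>x. c *s u x), 0 + (\<lambda>x. c *s f x)) \<in> pairs"
      by (rule pairs_combination[OF pairs_zero uf(1)])
    then have "((\<lambda>x. c *s u x), (\<lambda>x. c *s f x)) \<in> pairs" by simp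
    moreover have "c *s u x0 \<in> corth N0"
      using uf(2) by (simp add: corth_def cinner_scale_right)
    moreover have "norm (c *s u x0) = 1" using pos by (simp add: vec_norm_scale nc)
    moreover have "H.nrm (\<lambda>x. c *s u x) + H.nrm (\<lambda>x. c *s f x) \<le> 1 / real (Suc k)"
      using big pos u by (simp add: H.nrm_scale nc field_simps)
    ultimately show ?thesis
      by (intro exI[of _ "\<lambda>x. c *s u x"] exI[of _ "\<lambda>x. c *s f x"]) simp
  qed
  then obtain U F where UF: "\<And>k. (U k, F k) \<in> pairs" "\<And>k. U k x0 \<in> corth N0" "\<And>k. norm (U k x0) = 1"
    "\<And>k. H.nrm (U k) + H.nrm (F k) \<le> 1 / real (Suc k)"
    by metis
  have "compact (sphere (0 :: complex^'n) 1)" by simp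
  then obtain e \<phi> where e: "e \<in> sphere 0 1" and \<phi>: "strict_mono \<phi>" and conv: "((\<lambda>k. U k x0) \<circ> \<phi>) \<longlonglongrightarrow> e"
    using UF(3) unfolding compact_def by (metis dist_0_norm mem_sphere)
  define u where "u k = U (\<phi> k)" for k
  define f where "f k = F (\<phi> k)" for k
  have uf: "(u k, f k) \<in> pairs" "u k x0 \<in> corth N0" "norm (u k x0) = 1" for k
    using UF by (auto simp: u_def f_def)
  have uw: "u k \<in> H.wspace" and fw: "f k \<in> H.wspace" and us: "sol (u k) (w_times a b w (f k))" for k
    using uf(1)[of k] by (auto simp: pairs_def)
  have um: "u k \<in> borel_measurable V" "u k \<in> borel_measurable M" for k
    using sol_measurable[OF us sets_M] sol_measurable[OF us tr.sets_M] by auto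
  have ulim: "(\<lambda>k. u k x0) \<longlonglongrightarrow> e" using conv by (simp add: u_def o_def)
  have small: "H.nrm (u k) \<le> 1 / real (Suc k)" "H.nrm (f k) \<le> 1 / real (Suc k)" for k
  proof -
    have "1 / real (Suc (\<phi> k)) \<le> 1 / real (Suc k)"
      using strict_mono_imp_increasing[OF \<phi>, of k] by (intro divide_left_mono) auto
    moreover have "0 \<le> H.nrm (u k)" "0 \<le> H.nrm (f k)" using uw fw by auto
    ultimately show "H.nrm (u k) \<le> 1 / real (Suc k)" "H.nrm (f k) \<le> 1 / real (Suc k)"
      using UF(4)[of "\<phi> k"] by (auto simp: u_def f_def)
  qed
  have null_seq: "(\<lambda>k. 1 / real (Suc k)) \<longlonglongrightarrow> 0"
    using LIMSEQ_inverse_real_of_nat by (simp add: inverse_eq_divide)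
  have f0: "(\<lambda>k. H.nrm (f k)) \<longlonglongrightarrow> 0" and u0: "(\<lambda>k. H.nrm (u k)) \<longlonglongrightarrow> 0"
    by (rule Lim_null_comparison[OF _ null_seq]; use small uw fw in simp)+
  have cauchy: "Cauchy (\<lambda>k. u k y)" if y: "y \<in> einterval a b" for y
  proof -
    have sub: "{min x0 y..max x0 y} \<subseteq> einterval a b"
      by (rule Icc_subset_einterval) (use x0 y in \<open>auto simp: min_def max_def\<close>)
    obtain C where C: "C \<ge> 0" "\<forall>(u, f)\<in>pairs. \<forall>s\<in>{min x0 y..max x0 y}. \<forall>t\<in>{min x0 y..max x0 y}. norm (u s) \<le> C * (norm (u t) + H.nrm f)"
      using pairs_bound[OF sub] by blast
    have mem: "y \<in> {min x0 y..max x0 y}" "x0 \<in> {min x0 y..max x0 y}" by auto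
    have est: "norm (u j y - u k y) \<le> C * (norm (u j x0 - u k x0) + (H.nrm (f j) + H.nrm (f k)))" for j k
    proof -
      have "(u j + (\<lambda>x. (-1) *s u k x), f j + (\<lambda>x. (-1) *s f k x)) \<in> pairs"
        by (rule pairs_combination[OF uf(1) uf(1)])
      then have p: "(u j - u k, f j - f k) \<in> pairs" by (simp add: fun_diff_def plus_fun_def)
      have "norm ((u j - u k) y) \<le> C * (norm ((u j - u k) x0) + H.nrm (f j - f k))"
        using C(2) p mem by blast
      moreover have "H.nrm (f j - f k) \<le> H.nrm (f j) + H.nrm (f k)"
        using H.nrm_triangle_diff[of "f j" 0 "f k"] H.nrm_minus_commute[of 0 "f k"] fw H.wspace_zero by simp
      then have "C * (norm ((u j - u k) x0) + H.nrm (f j - f k)) \<le> C * (norm ((u j - u k) x0) + (H.nrm (f j) + H.nrm (f k)))"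
        using C(1) by (intro mult_left_mono) auto
      ultimately show ?thesis by simp
    qed
    show ?thesis
    proof (rule metric_CauchyI)
      fix r :: real assume r: "r > 0"
      define D where "D = C + 1"
      have D: "D > 0" using C(1) by (simp add: D_def)
      define r' where "r' = r / (4 * D)"
      have r': "r' > 0" using r D by (simp add: r'_def)
      have "Cauchy (\<lambda>k. u k x0)" using ulim by (rule LIMSEQ_imp_Cauchy)
      then obtain N1 where N1: "\<And>j k. j \<ge> N1 \<Longrightarrow> k \<ge> N1 \<Longrightarrow> dist (u j x0) (u k x0) < r'"
        using metric_CauchyD[OF _ r'] by blast
      obtain N2 where N2: "\<And>k. k \<ge> N2 \<Longrightarrow> H.nrm (f k) < r'"
        using order_tendstoD(2)[OF f0 r'] by (auto simp: eventually_sequentially)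
      have "dist (u j y) (u k y) < r" if "j \<ge> max N1 N2" "k \<ge> max N1 N2" for j k
      proof -
        have "norm (u j x0 - u k x0) + (H.nrm (f j) + H.nrm (f k)) \<le> 3 * r'"
          using N1[of j k] N2[of j] N2[of k] that by (simp add: dist_norm)
        then have "norm (u j y - u k y) \<le> C * (3 * r')"
          using est[of j k] C(1) by (meson mult_left_mono order_trans)
        also have "\<dots> < D * (4 * r')"
          unfolding D_def using mult_nonneg_nonneg[OF C(1) less_imp_le[OF r']] r' by (simp add: algebra_simps)
        also have "\<dots> = r" using D by (simp add: r'_def)
        finally show ?thesis by (simp add: dist_norm)
      qed
      then show "\<exists>N. \<forall>j\<ge>N. \<forall>k\<ge>N. dist (u j y) (u k y) < r" by blast
    qed
  qed
  define v where "v y = lim (\<lambda>k. u k y)" for y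
  have v: "(\<lambda>k. u k y) \<longlonglongrightarrow> v y" if "y \<in> einterval a b" for y
    using cauchy[OF that] unfolding v_def by (simp add: Cauchy_convergent_iff convergent_LIMSEQ_iff)
  have v_meas: "v \<in> borel_measurable V" "v \<in> borel_measurable M"
    by (rule borel_measurable_LIMSEQ_metric[OF um(1)], rule v, simp add: space_M)
       (rule borel_measurable_LIMSEQ_metric[OF um(2)], rule v, simp add: tr.space_M)
  have bound: "\<exists>S\<ge>0. \<forall>y\<in>A. norm (v y) \<le> S \<and> (\<forall>k. norm (u k y) \<le> S)" if A: "A \<in> rc_borel a b" for A
  proof -
    have "{x0} \<in> rc_borel a b"
      using rc_borel_Icc[OF Icc_subset_einterval[OF x0 x0]] by simp
    from rc_borel_Un[OF A this]
    obtain c d where cd: "A \<union> {x0} \<subseteq> {c..d}" "{c..d} \<subseteq> einterval a b"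
      using rc_borelE by metis
    obtain C where C: "C \<ge> 0" "\<forall>(u, f)\<in>pairs. \<forall>s\<in>{c..d}. \<forall>t\<in>{c..d}. norm (u s) \<le> C * (norm (u t) + H.nrm f)"
      using pairs_bound[OF cd(2)] by blast
    have ub: "norm (u k y) \<le> C * 2" if y: "y \<in> A" for k y
    proof -
      have "y \<in> {c..d}" "x0 \<in> {c..d}" using y cd(1) by auto
      then have "norm (u k y) \<le> C * (norm (u k x0) + H.nrm (f k))"
        using C(2) uf(1) by blast
      also have "\<dots> \<le> C * 2"
      proof (rule mult_left_mono[OF _ C(1)])
        have "1 / real (Suc k) \<le> 1" by simp
        then show "norm (u k x0) + H.nrm (f k) \<le> 2"
          using small(2)[of k] uf(3)[of k] by linarith
      qed
      finally show ?thesis .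
    qed
    have "norm (v y) \<le> C * 2" if y: "y \<in> A" for y
    proof -
      have "y \<in> einterval a b" using y cd by auto
      from tendsto_norm[OF v[OF this]] show ?thesis
        by (rule LIMSEQ_le_const2) (use ub[OF y] in auto)
    qed
    then show ?thesis using ub C(1) by (intro exI[of _ "C * 2"]) auto
  qed
  have int: "set_integrable V A (\<lambda>x. q_density x *v v x)" if A: "A \<in> rc_borel a b" for A
    using bound[OF A] q_times_integrable[OF v_meas(1) A] by blast
  have q_lim: "(\<lambda>k. q_times a b q (u k) A) \<longlonglongrightarrow> q_times a b q v A" if A: "A \<in> rc_borel a b" for A
    unfolding q_times_eq set_lebesgue_integral_def
  proof -
    obtain S where S: "S \<ge> 0" "\<And>y k. y \<in> A \<Longrightarrow> norm (u k y) \<le> S" using bound[OF A] by blast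
    have [measurable]: "A \<in> sets V" using rc_in_sets[OF A] .
    have [measurable]: "v \<in> borel_measurable V" "u k \<in> borel_measurable V" for k using v_meas um by auto
    show "(\<lambda>k. LINT x|V. indicator A x *\<^sub>R (q_density x *v u k x)) \<longlonglongrightarrow> (LINT x|V. indicator A x *\<^sub>R (q_density x *v v x))"
    proof (rule integral_dominated_convergence[where w = "\<lambda>x. S * (indicator A x *\<^sub>R norm (q_density x))"])
      show "integrable V (\<lambda>x. S * (indicator A x *\<^sub>R norm (q_density x)))"
        using norm_q_density_integrable[OF A] by (intro integrable_mult_right) (simp add: set_integrable_def)
      show "AE x in V. (\<lambda>k. indicator A x *\<^sub>R (q_density x *v u k x)) \<longlonglongrightarrow> indicator A x *\<^sub>R (q_density x *v v x)"
        by (rule AE_I2) (intro tendsto_scaleR tendsto_const tendsto_matrix_vector v, simp add: space_M)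
      fix k
      show "AE x in V. norm (indicator A x *\<^sub>R (q_density x *v u k x)) \<le> S * (indicator A x *\<^sub>R norm (q_density x))"
        by (rule AE_I2) (rule norm_indicator_matrix_vector_le[OF S(2)])
    qed measurable
  qed
  define p where "p A = - (Jinv *v q_times a b q v A)" for A
  have bl: "bounded_linear (\<lambda>x :: complex^'n. - (Jinv *v x))"
    by (intro bounded_linear_minus bounded_bilinear.bounded_linear_right[OF bounded_bilinear_matrix_vector])
  have p: "dist0 a b p"
    unfolding p_def[abs_def] q_times_eq
    by (rule dist0_bounded_linear[OF bl dist0_set_integral]) (rule int)
  have prim: "bal_prim a b p v"
    unfolding bal_prim_def
  proof (intro allI impI)
    fix s t :: real assume st: "s < t" "{s..t} \<subseteq> einterval a b"
    have mem: "s \<in> einterval a b" "t \<in> einterval a b" using st by auto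
    have rc: "{s..t} \<in> rc_borel a b" "{s<..<t} \<in> rc_borel a b"
      using st(2) by (auto intro!: rc_borel_in_Icc)
    define P where "P k A = Jinv *v (w_times a b w (f k) A - q_times a b q (u k) A)" for k A
    have P_lim: "(\<lambda>k. P k A) \<longlonglongrightarrow> p A" if A: "A \<in> rc_borel a b" for A
    proof -
      have "(\<lambda>k. real CARD('n) * sqrt (measure M A) * H.nrm (f k)) \<longlonglongrightarrow> 0"
        by (rule tendsto_mult_right_zero) (rule f0)
      then have "(\<lambda>k. w_times a b w (f k) A) \<longlonglongrightarrow> 0"
        by (rule Lim_null_comparison[rotated]) (use norm_w_times_le[OF fw A] in simp)
      then have "(\<lambda>k. P k A) \<longlonglongrightarrow> Jinv *v (0 - q_times a b q v A)"
        unfolding P_def by (intro tendsto_matrix_vector tendsto_const tendsto_diff q_lim A)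
      then show ?thesis
        using matrix_vector_mult_diff_distrib[of Jinv 0 "q_times a b q v A"] by (simp add: p_def)
    qed
    have inc: "u k t - u k s = (1/2) *\<^sub>R (P k {s..t} + P k {s<..<t})" for k
    proof -
      obtain pk where pk: "bal_prim a b pk (u k)" "\<And>A. A \<in> rc_borel a b \<Longrightarrow> J *v pk A + q_times a b q (u k) A = w_times a b w (f k) A"
        using sol_obtain[OF us] by blast
      have "pk A = P k A" if A: "A \<in> rc_borel a b" for A
      proof -
        have "w_times a b w (f k) A - q_times a b q (u k) A = J *v pk A"
          using pk(2)[OF A] by (simp add: algebra_simps)
        then show ?thesis by (simp add: P_def Jinv)
      qed
      moreover have "u k t - u k s = (1/2) *\<^sub>R (pk {s..t} + pk {s<..<t})"
        using pk(1) st unfolding bal_prim_def by blast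
      ultimately show ?thesis using rc by simp
    qed
    have lim: "(\<lambda>k. u k t - u k s) \<longlonglongrightarrow> (1/2) *\<^sub>R (p {s..t} + p {s<..<t})"
      unfolding inc by (intro tendsto_scaleR tendsto_add tendsto_const P_lim rc)
    show "v t - v s = (1/2) *\<^sub>R (p {s..t} + p {s<..<t})"
      by (rule LIMSEQ_unique[OF tendsto_diff[OF v[OF mem(2)] v[OF mem(1)]] lim])
  qed
  have vs: "sol v (\<lambda>A. 0)"
    by (rule solI[OF p prim])
       (simp add: p_def Jinv bounded_linear.linear[OF bounded_bilinear.bounded_linear_right[OF bounded_bilinear_matrix_vector], THEN linear_neg])
  have "(\<integral>\<^sup>+x. ennreal (H.wsq v x) \<partial>M) \<le> (\<integral>\<^sup>+x. liminf (\<lambda>k. ennreal (H.wsq (u k) x)) \<partial>M)"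
  proof (rule nn_integral_mono)
    fix x assume "x \<in> space M"
    then have "(\<lambda>k. u k x) \<longlonglongrightarrow> v x" using v by (simp add: tr.space_M)
    then have "(\<lambda>k. H.wsq (u k) x) \<longlonglongrightarrow> H.wsq v x"
      unfolding H.wsq_def by (intro tendsto_Re tendsto_cinner tendsto_matrix_vector tendsto_const)
    then have "(\<lambda>k. ennreal (H.wsq (u k) x)) \<longlonglongrightarrow> ennreal (H.wsq v x)" by (rule tendsto_ennrealI)
    from lim_imp_Liminf[OF _ this] show "ennreal (H.wsq v x) \<le> liminf (\<lambda>k. ennreal (H.wsq (u k) x))" by simp
  qed
  also have "\<dots> \<le> liminf (\<lambda>k. \<integral>\<^sup>+x. ennreal (H.wsq (u k) x) \<partial>M)"
    by (rule nn_integral_liminf) (use um H.wsq_measurable in simp)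
  also have "\<dots> = liminf (\<lambda>k. ennreal ((H.nrm (u k))\<^sup>2))"
    using uw by (simp add: H.nrm_sq_nn_integral)
  also have "\<dots> = ennreal 0"
  proof (rule lim_imp_Liminf)
    have "(\<lambda>k. (H.nrm (u k))\<^sup>2) \<longlonglongrightarrow> 0\<^sup>2" by (intro tendsto_power u0)
    then show "(\<lambda>k. ennreal ((H.nrm (u k))\<^sup>2)) \<longlonglongrightarrow> ennreal 0" by (intro tendsto_ennrealI) simp
  qed simp
  finally have v0: "(\<integral>\<^sup>+x. ennreal (H.wsq v x) \<partial>M) = 0" by simp
  then have vw: "v \<in> H.wspace" using v_meas by (simp add: H.wspace_def)
  have "H.nrm v = 0" using H.nrm_sq_nn_integral[OF vw] v0 by simp
  then have "v \<in> sol_null a b J q w"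
    using vs w_times_null[OF vw] by (simp add: sol_null_iff)
  moreover have "v x0 = e" using LIMSEQ_unique[OF v[OF x0] ulim] .
  ultimately have "e \<in> N0" using N0I by blast
  then have "cinner e (u k x0) = 0" for k using uf(2)[of k] by (simp add: corth_def)
  moreover have "(\<lambda>k. cinner e (u k x0)) \<longlonglongrightarrow> cinner e e"
    by (intro tendsto_cinner tendsto_const ulim)
  ultimately have "cinner e e = 0" by (simp add: LIMSEQ_const_iff)
  then have "(norm e)\<^sup>2 = 0" by (simp add: norm_sq_cinner)
  then show False using e by simp
qed

lemma evaluation_bound:
  assumes x: "x \<in> einterval a b"
  shows "\<exists>C\<ge>0. \<forall>u f. (u, f) \<in> pairs \<longrightarrow> u x0 \<in> corth N0 \<longrightarrow> norm (u x) \<le> C * (H.nrm u + H.nrm f)"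
proof -
  obtain C0 where C0: "\<forall>u f. (u, f) \<in> pairs \<longrightarrow> u x0 \<in> corth N0 \<longrightarrow> norm (u x0) \<le> C0 * (H.nrm u + H.nrm f)"
    using evaluation_bound_at_x0 by blast
  have sub: "{min x0 x..max x0 x} \<subseteq> einterval a b"
    by (rule Icc_subset_einterval) (use x0 x in \<open>auto simp: min_def max_def\<close>)
  obtain C where C: "C \<ge> 0" "\<forall>(u, f)\<in>pairs. \<forall>s\<in>{min x0 x..max x0 x}. \<forall>t\<in>{min x0 x..max x0 x}. norm (u s) \<le> C * (norm (u t) + H.nrm f)"
    using pairs_bound[OF sub] by blast
  have "norm (u x) \<le> (C * (\<bar>C0\<bar> + 1)) * (H.nrm u + H.nrm f)" if uf: "(u, f) \<in> pairs" "u x0 \<in> corth N0" for u f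
  proof -
    have n: "0 \<le> H.nrm u" "0 \<le> H.nrm f" using uf by (auto simp: pairs_def)
    have mem: "x \<in> {min x0 x..max x0 x}" "x0 \<in> {min x0 x..max x0 x}" by auto
    have "norm (u x) \<le> C * (norm (u x0) + H.nrm f)"
      using C(2) uf(1) mem by blast
    also have "\<dots> \<le> C * ((\<bar>C0\<bar> + 1) * (H.nrm u + H.nrm f))"
    proof (rule mult_left_mono[OF _ C(1)])
      have "norm (u x0) \<le> C0 * (H.nrm u + H.nrm f)" using C0 uf by blast
      also have "\<dots> \<le> \<bar>C0\<bar> * (H.nrm u + H.nrm f)" using n by (intro mult_right_mono) auto
      finally show "norm (u x0) + H.nrm f \<le> (\<bar>C0\<bar> + 1) * (H.nrm u + H.nrm f)"
        using n by (simp add: distrib_right)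
    qed
    finally show ?thesis by (simp add: mult.assoc)
  qed
  then show ?thesis using C(1) by (intro exI[of _ "C * (\<bar>C0\<bar> + 1)"]) auto
qed

end

section \<open>Classes and the evaluation operator\<close>

context weighted_ode
begin

lemma cls_eq: "f \<in> H.wspace \<Longrightarrow> cls a b w f = {g \<in> H.wspace. H.nrm (g - f) = 0}"
proof -
  assume f: "f \<in> H.wspace"
  have "pre_inner a b w (\<lambda>x. g x - f x) (\<lambda>x. g x - f x) = of_real ((H.nrm (g - f))\<^sup>2)" if "g \<in> H.wspace" for g
    using H.ip_self_real[OF H.V_closed(3)[OF that f]] by (simp add: pre_inner_eq fun_diff_def)
  then show ?thesis by (auto simp: cls_def pre_L2_eq)
qed

lemma nrm_zero_sym: "f \<in> H.wspace \<Longrightarrow> g \<in> H.wspace \<Longrightarrow> H.nrm (f - g) = 0 \<Longrightarrow> H.nrm (g - f) = 0"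
  using H.nrm_minus_commute by simp

lemma nrm_zero_trans:
  assumes "f \<in> H.wspace" "g \<in> H.wspace" "h \<in> H.wspace" "H.nrm (f - g) = 0" "H.nrm (g - h) = 0"
  shows "H.nrm (f - h) = 0"
  using H.nrm_triangle_diff[OF assms(1,2,3)] assms H.nrm_nonneg[OF H.V_closed(3)[OF assms(1,3)]] by simp

lemma cls_eq_iff:
  assumes "f \<in> H.wspace" "g \<in> H.wspace"
  shows "cls a b w f = cls a b w g \<longleftrightarrow> H.nrm (f - g) = 0"
proof
  assume "cls a b w f = cls a b w g"
  moreover have "f \<in> cls a b w f" using assms by (simp add: cls_eq)
  ultimately show "H.nrm (f - g) = 0" using assms by (simp add: cls_eq)
next
  assume fg: "H.nrm (f - g) = 0"
  then have gf: "H.nrm (g - f) = 0" using nrm_zero_sym assms by blast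
  show "cls a b w f = cls a b w g"
    unfolding cls_eq[OF assms(1)] cls_eq[OF assms(2)]
    using nrm_zero_trans[OF _ assms(1) assms(2) _ fg] nrm_zero_trans[OF _ assms(2) assms(1) _ gf] by blast
qed

lemma rep_cls:
  assumes f: "f \<in> H.wspace"
  shows "rep (cls a b w f) \<in> H.wspace" "H.nrm (rep (cls a b w f) - f) = 0"
proof -
  have "f \<in> cls a b w f" using f by (simp add: cls_eq)
  then have "rep (cls a b w f) \<in> cls a b w f" unfolding rep_def by (rule someI[of "\<lambda>g. g \<in> cls a b w f" f])
  then show "rep (cls a b w f) \<in> H.wspace" "H.nrm (rep (cls a b w f) - f) = 0"
    by (auto simp: cls_eq[OF f])
qed

lemma nrm_combination_zero:
  assumes "f \<in> H.wspace" "f' \<in> H.wspace" "g \<in> H.wspace" "g' \<in> H.wspace"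
    and "H.nrm (f - f') = 0" "H.nrm (g - g') = 0"
  shows "H.nrm ((f + (\<lambda>x. c *s g x)) - (f' + (\<lambda>x. c *s g' x))) = 0"
proof -
  have "(f + (\<lambda>x. c *s g x)) - (f' + (\<lambda>x. c *s g' x)) = (f - f') + (\<lambda>x. c *s (g - g') x)"
    by (simp add: fun_eq_iff vec_eq_iff algebra_simps)
  then have "H.nrm ((f + (\<lambda>x. c *s g x)) - (f' + (\<lambda>x. c *s g' x)))
      = H.nrm ((f - f') + (\<lambda>x. c *s (g - g') x))" by (simp only:)
  also have "\<dots> \<le> H.nrm (f - f') + H.nrm (\<lambda>x. c *s (g - g') x)"
    by (rule H.nrm_triangle) (intro H.V_closed assms)+
  also have "H.nrm (\<lambda>x. c *s (g - g') x) = cmod c * H.nrm (g - g')"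
    by (rule H.nrm_scale) (intro H.V_closed assms)
  finally have "H.nrm ((f + (\<lambda>x. c *s g x)) - (f' + (\<lambda>x. c *s g' x))) \<le> 0"
    by (simp only: assms(5,6) mult_zero_right add_0)
  moreover have "0 \<le> H.nrm ((f + (\<lambda>x. c *s g x)) - (f' + (\<lambda>x. c *s g' x)))"
    by (rule H.nrm_nonneg) (intro H.V_closed assms)
  ultimately show ?thesis by (rule antisym)
qed

lemma L2_combination:
  assumes f: "f \<in> H.wspace" and g: "g \<in> H.wspace"
  shows "L2_add a b w (cls a b w f) (L2_scale a b w c (cls a b w g)) = cls a b w (f + (\<lambda>x. c *s g x))"
proof -
  let ?f = "rep (cls a b w f)" and ?g = "rep (cls a b w g)"
  have cg: "(\<lambda>x. c *s ?g x) \<in> H.wspace" using rep_cls[OF g] by (intro H.V_closed)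
  let ?h = "rep (cls a b w (\<lambda>x. c *s ?g x))"
  have "H.nrm ((?f + (\<lambda>x. 1 *s ?h x)) - (f + (\<lambda>x. 1 *s (c *s g x)))) = 0"
  proof (rule nrm_combination_zero)
    show gw: "(\<lambda>x. c *s g x) \<in> H.wspace" using g by (intro H.V_closed)
    show "H.nrm (?h - (\<lambda>x. c *s g x)) = 0"
    proof (rule nrm_zero_trans[OF rep_cls(1)[OF cg] cg gw rep_cls(2)[OF cg]])
      show "H.nrm ((\<lambda>x. c *s ?g x) - (\<lambda>x. c *s g x)) = 0"
        using nrm_combination_zero[OF H.wspace_zero H.wspace_zero rep_cls(1)[OF g] g _ rep_cls(2)[OF g], of c]
        by simp
    qed
  qed (use f rep_cls[OF f] rep_cls[OF cg] in auto)
  then have "cls a b w (?f + ?h) = cls a b w (f + (\<lambda>x. c *s g x))"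
    using f g rep_cls[OF f] rep_cls[OF cg] by (subst cls_eq_iff) (auto intro!: H.V_closed)
  then show ?thesis
    by (simp add: L2_add_def L2_scale_def plus_fun_def)
qed

lemma L2_scale_cls:
  assumes g: "g \<in> H.wspace"
  shows "L2_scale a b w c (cls a b w g) = cls a b w (\<lambda>x. c *s g x)"
proof -
  have "H.nrm ((\<lambda>x. c *s rep (cls a b w g) x) - (\<lambda>x. c *s g x)) = 0"
    using nrm_combination_zero[OF H.wspace_zero H.wspace_zero rep_cls(1)[OF g] g _ rep_cls(2)[OF g], of c]
    by simp
  then show ?thesis
    unfolding L2_scale_def using g rep_cls[OF g] by (subst cls_eq_iff) (auto intro!: H.V_closed)
qed

lemma L2_zero_eq: "L2_zero a b w = cls a b w 0"
  by (simp add: L2_zero_def zero_fun_def)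

lemma wip_zero:
  assumes "f \<in> H.wspace" "g \<in> H.wspace" "H.nrm f = 0 \<or> H.nrm g = 0"
  shows "H.wip f g = 0"
  using H.Cauchy_Schwarz[OF assms(1,2)] assms(3) by auto

lemma L2_inner_cls:
  assumes f: "f \<in> H.wspace" and g: "g \<in> H.wspace"
  shows "L2_inner a b w (cls a b w f) (cls a b w g) = H.wip f g"
proof -
  let ?f = "rep (cls a b w f)" and ?g = "rep (cls a b w g)"
  note rf = rep_cls[OF f] and rg = rep_cls[OF g]
  have "H.wip (?f - f) ?g = 0" "H.wip f (?g - g) = 0"
    by (rule wip_zero; use f g rf rg in \<open>auto intro!: H.V_closed\<close>)+
  then show ?thesis
    using f g rf rg by (simp add: L2_inner_def pre_inner_eq H.ip_diff_left H.ip_diff_right)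
qed

lemma L2_eq: "F \<in> L2 a b w \<longleftrightarrow> (\<exists>f\<in>H.wspace. F = cls a b w f)"
  by (auto simp: L2_def pre_L2_eq)

lemma T_max_obtain:
  assumes "(U, F) \<in> T_max a b J q w"
  obtains u f where "(u, f) \<in> pairs" "U = cls a b w u" "F = cls a b w f"
  using assms by (auto simp: T_max_def pre_T_max_eq)

lemma sol_agree:
  assumes u: "sol u r" and eq: "\<And>x. x \<in> einterval a b \<Longrightarrow> u' x = u x"
  shows "sol u' r"
proof -
  obtain p where p: "dist0 a b p" "bal_prim a b p u" "\<And>A. A \<in> rc_borel a b \<Longrightarrow> J *v p A + q_times a b q u A = r A"
    using sol_obtain[OF u] by blast
  show ?thesis
  proof (rule solI[OF p(1)])
    show "bal_prim a b p u'"
      unfolding bal_prim_def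
    proof (intro allI impI)
      fix s t :: real assume st: "s < t" "{s..t} \<subseteq> einterval a b"
      then have "s \<in> einterval a b" "t \<in> einterval a b" by auto
      then have "u' s = u s" "u' t = u t" by (simp_all add: eq)
      then show "u' t - u' s = (1/2) *\<^sub>R (p {s..t} + p {s<..<t})"
        using p(2) st by (simp add: bal_prim_def)
    qed
    fix A assume A: "A \<in> rc_borel a b"
    have "A \<subseteq> einterval a b" using A by (auto simp: rc_borel_def)
    then have "q_times a b q u' A = q_times a b q u A"
      unfolding q_times_eq set_lebesgue_integral_def
      by (intro Bochner_Integration.integral_cong) (auto simp: indicator_def eq)
    then show "J *v p A + q_times a b q u' A = r A" using p(3)[OF A] by simp
  qed
qed

lemma nrm_agree:
  assumes u: "u \<in> H.wspace" and u': "u' \<in> H.wspace" and eq: "\<And>x. x \<in> einterval a b \<Longrightarrow> u' x = u x"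
  shows "H.nrm (u' - u) = 0"
proof -
  have "AE x in M. W x *v (u' - u) x = 0"
    by (rule AE_I2) (simp add: tr.space_M eq)
  then show ?thesis using u u' by (subst H.nrm_eq_0_iff_AE) (auto intro!: H.V_closed)
qed

lemma wspace_agree:
  assumes u: "u \<in> H.wspace" and eq: "\<And>x. x \<in> einterval a b \<Longrightarrow> u' x = u x"
  shows "u' \<in> H.wspace"
proof -
  have "u' \<in> borel_measurable M"
    using H.wspace_measurable[OF u] measurable_cong[of M u' u borel] eq by (simp add: tr.space_M)
  then show ?thesis
    by (rule H.wspaceI[OF _ H.wsq_integrable[OF u]])
       (rule AE_I2, simp add: H.wsq_def tr.space_M eq)
qed

text \<open>The normalization that singles out the representative in the definition of \<open>E\<close>.\<close>

definition normalized :: "(real \<Rightarrow> complex^'n) \<Rightarrow> bool" where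
  "normalized v \<longleftrightarrow> v x0 \<in> corth N0 \<and> (\<forall>x. x \<notin> einterval a b \<longrightarrow> v x = 0)"

text \<open>Elements of \<open>\<L>\<^sub>0\<close> are null vectors, so one of them can be subtracted to remove the component of
  \<open>u x0\<close> in \<open>N0\<close>.\<close>

lemma normalized_exists:
  assumes uf: "(u, f) \<in> pairs"
  shows "\<exists>v. (v, f) \<in> pairs \<and> H.nrm (v - u) = 0 \<and> normalized v"
proof -
  obtain y where y: "y \<in> N0" "u x0 - y \<in> corth N0" using N0_decomposition by blast
  obtain n where n: "n \<in> sol_null a b J q w" "y = n x0"
    using y(1) unfolding N0_def init_null_def by blast
  have nw: "n \<in> H.wspace" "H.nrm n = 0" using sol_null_wspace[OF n(1)] by auto
  have u: "u \<in> H.wspace" "f \<in> H.wspace" "sol u (w_times a b w f)" using uf by (auto simp: pairs_def)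
  define d where "d = u - n"
  have d: "d \<in> H.wspace" unfolding d_def using u nw by (intro H.V_closed)
  have "sol (\<lambda>x. u x + (-1) *s n x) (\<lambda>A. w_times a b w f A + (-1) *s 0)"
    by (rule sol_combination[OF u(3)]) (use n in \<open>simp add: sol_null_iff\<close>)
  then have ds: "sol d (w_times a b w f)" by (simp add: d_def fun_diff_def)
  define v where "v x = (if x \<in> einterval a b then d x else 0)" for x
  have vd: "v x = d x" if "x \<in> einterval a b" for x using that by (simp add: v_def)
  have vw: "v \<in> H.wspace" by (rule wspace_agree[OF d vd])
  have "sol v (w_times a b w f)" by (rule sol_agree[OF ds vd])
  then have "(v, f) \<in> pairs" using vw u by (simp add: pairs_def)
  moreover have "H.nrm (v - u) = 0"
  proof (rule nrm_zero_trans[OF vw d u(1) nrm_agree[OF d vw vd]])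
    have "H.nrm (u - d) = 0" using nw by (simp add: d_def)
    then show "H.nrm (d - u) = 0" by (rule nrm_zero_sym[OF u(1) d])
  qed
  moreover have "normalized v"
    using y(2) n(2) x0 by (simp add: normalized_def v_def d_def)
  ultimately show ?thesis by blast
qed

text \<open>The difference of two representatives lies in the space of homogeneous null solutions, and its value
  at \<open>x0\<close> is both in \<open>N0\<close> and orthogonal to \<open>N0\<close>. Hence this value vanishes, and the difference is zero by
  uniqueness for the initial value problem.\<close>

lemma normalized_unique:
  assumes v: "(v, f) \<in> pairs" "normalized v" and v': "(v', f') \<in> pairs" "normalized v'"
    and eq: "H.nrm (v - v') = 0" "H.nrm (f - f') = 0"
  shows "v = v'"
proof -
  have mem: "v \<in> H.wspace" "v' \<in> H.wspace" "f \<in> H.wspace" "f' \<in> H.wspace"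
    using v v' by (auto simp: pairs_def)
  have "(v + (\<lambda>x. (-1) *s v' x), f + (\<lambda>x. (-1) *s f' x)) \<in> pairs"
    by (rule pairs_combination[OF v(1) v'(1)])
  then have d: "(v - v', f - f') \<in> pairs" by (simp add: fun_diff_def plus_fun_def)
  have s: "sol (v - v') (w_times a b w (f - f'))" using d by (simp add: pairs_def)
  have r0: "w_times a b w (f - f') A = 0" if "A \<in> rc_borel a b" for A
    using w_times_null[OF _ eq(2) that] mem H.V_closed by blast
  have "w_times a b w (v - v') A = 0" if "A \<in> rc_borel a b" for A
    using w_times_null[OF _ eq(1) that] mem H.V_closed by blast
  moreover have "sol (v - v') (\<lambda>A. 0)" by (rule sol_cong[OF s r0])
  ultimately have "v - v' \<in> sol_null a b J q w" by (simp add: sol_null_iff)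
  then have n0: "(v - v') x0 \<in> N0" by (rule N0I)
  have "v x0 + (-1) *s v' x0 \<in> corth N0"
    by (rule corth_combination) (use v(2) v'(2) in \<open>auto simp: normalized_def\<close>)
  then have "cinner ((v - v') x0) ((v - v') x0) = 0" using n0 by (simp add: corth_def)
  then have "(norm ((v - v') x0))\<^sup>2 = 0" by (simp only: norm_sq_cinner) simp
  then have z: "(v - v') x0 = 0" by simp
  have "v x = v' x" for x
  proof (cases "x \<in> einterval a b")
    case True
    have "(v - v') x = 0" by (rule sol_unique[OF s r0 x0 z True])
    then show ?thesis by simp
  next
    case False
    then show ?thesis using v(2) v'(2) by (simp add: normalized_def)
  qed
  then show ?thesis by blast
qed

lemma eval_E_eq:
  assumes v: "(v, f) \<in> pairs" "normalized v"
  shows "eval_E a b J q w x0 (cls a b w v) (cls a b w f) = v"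
  unfolding eval_E_def
proof (rule the_equality)
  have mem: "v \<in> H.wspace" "f \<in> H.wspace" and s: "sol v (w_times a b w f)" using v by (auto simp: pairs_def)
  have "v \<in> cls a b w v" "f \<in> cls a b w f" using mem by (auto simp: cls_eq)
  then show "v \<in> cls a b w v \<and> bv_bal a b v \<and> (\<exists>f\<in>cls a b w f. solves a b J q v (w_times a b w f)) \<and>
      v x0 \<in> corth (init_null a b J q w x0) \<and> (\<forall>x. x \<notin> einterval a b \<longrightarrow> v x = 0)"
    using s v(2) by (auto simp: sol_def normalized_def N0_def)
  fix v'
  assume v': "v' \<in> cls a b w v \<and> bv_bal a b v' \<and> (\<exists>f\<in>cls a b w f. solves a b J q v' (w_times a b w f)) \<and>
      v' x0 \<in> corth (init_null a b J q w x0) \<and> (\<forall>x. x \<notin> einterval a b \<longrightarrow> v' x = 0)"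
  then obtain f' where f': "f' \<in> cls a b w f" "solves a b J q v' (w_times a b w f')" by blast
  have "(v', f') \<in> pairs" "normalized v'"
    using v' f' mem by (auto simp: pairs_def sol_def cls_eq normalized_def N0_def)
  moreover have "H.nrm (v' - v) = 0" "H.nrm (f' - f) = 0"
    using v' f' mem by (auto simp: cls_eq)
  ultimately show "v' = v" using normalized_unique[OF _ _ v] by blast
qed

section \<open>The resolvent\<close>

text \<open>The function \<open>v\<close> is \<open>E\<^sub>z f\<close>, described without choosing representatives of classes: its class solves
  \<open>(T - z) [v] = [f]\<close>.\<close>

definition resolves :: "'n class_rel \<Rightarrow> complex \<Rightarrow> (real \<Rightarrow> complex^'n) \<Rightarrow> (real \<Rightarrow> complex^'n) \<Rightarrow> bool" where
  "resolves T z f v \<longleftrightarrow> f \<in> H.wspace \<and> (v, f + (\<lambda>x. z *s v x)) \<in> pairs \<and>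
     (cls a b w v, cls a b w (f + (\<lambda>x. z *s v x))) \<in> T \<and> normalized v"

lemma resolvesD:
  assumes "resolves T z f v"
  shows "f \<in> H.wspace" "v \<in> H.wspace" "f + (\<lambda>x. z *s v x) \<in> H.wspace"
    "(v, f + (\<lambda>x. z *s v x)) \<in> pairs" "(cls a b w v, cls a b w (f + (\<lambda>x. z *s v x))) \<in> T" "normalized v"
  using assms by (auto simp: resolves_def pairs_def)

lemma T_combination:
  assumes T: "linear_relation a b w T" and mem: "u \<in> H.wspace" "f \<in> H.wspace" "v \<in> H.wspace" "g \<in> H.wspace"
    and "(cls a b w u, cls a b w f) \<in> T" "(cls a b w v, cls a b w g) \<in> T"
  shows "(cls a b w (u + (\<lambda>x. c *s v x)), cls a b w (f + (\<lambda>x. c *s g x))) \<in> T"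
proof -
  have "(L2_scale a b w c (cls a b w v), L2_scale a b w c (cls a b w g)) \<in> T"
    using T assms(7) unfolding linear_relation_def by blast
  then have "(L2_add a b w (cls a b w u) (L2_scale a b w c (cls a b w v)),
      L2_add a b w (cls a b w f) (L2_scale a b w c (cls a b w g))) \<in> T"
    using T assms(6) unfolding linear_relation_def by blast
  then show ?thesis using mem by (simp add: L2_combination)
qed

lemma rel_shiftI: "(U, F) \<in> T \<Longrightarrow> (U, L2_add a b w F (L2_scale a b w (- z) U)) \<in> rel_shift a b w T z"
  unfolding rel_shift_def by blast

text \<open>The triviality of \<open>ker (T - z)\<close>, for an arbitrary representative \<open>g\<close> of the second component.\<close>

lemma resolvent_kernel:
  assumes z: "z \<in> resolvent_set a b w T" and d: "d \<in> H.wspace"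
    and dT: "(cls a b w d, cls a b w g) \<in> T" and g: "g \<in> H.wspace" "H.nrm (g - (\<lambda>x. z *s d x)) = 0"
  shows "H.nrm d = 0"
proof -
  have zd: "(\<lambda>x. z *s d x) \<in> H.wspace" using d by (intro H.V_closed)
  have "L2_add a b w (cls a b w g) (L2_scale a b w (- z) (cls a b w d)) = cls a b w (g + (\<lambda>x. (- z) *s d x))"
    by (rule L2_combination[OF g(1) d])
  also have "g + (\<lambda>x. (- z) *s d x) = g - (\<lambda>x. z *s d x)"
    by (simp add: fun_eq_iff)
  also have "cls a b w (g - (\<lambda>x. z *s d x)) = L2_zero a b w"
    unfolding L2_zero_eq using g zd H.wspace_zero by (subst cls_eq_iff) (auto intro!: H.V_closed simp del: minus_apply)
  finally have "(cls a b w d, L2_zero a b w) \<in> rel_shift a b w T z"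
    using rel_shiftI[OF dT, of z] by (simp only:)
  then have "cls a b w d = L2_zero a b w"
    using z unfolding resolvent_set_def by blast
  then show ?thesis unfolding L2_zero_eq using d H.wspace_zero by (simp add: cls_eq_iff)
qed

lemma resolves_unique:
  assumes T: "linear_relation a b w T" and z: "z \<in> resolvent_set a b w T"
    and v: "resolves T z f v" and v': "resolves T z f' v'" and eq: "H.nrm (f - f') = 0"
  shows "v = v'"
proof -
  note D = resolvesD[OF v] and D' = resolvesD[OF v']
  define g where "g = f + (\<lambda>x. z *s v x)"
  define g' where "g' = f' + (\<lambda>x. z *s v' x)"
  have gw: "g \<in> H.wspace" "g' \<in> H.wspace" using D(3) D'(3) by (auto simp: g_def g'_def)
  have "(cls a b w (v + (\<lambda>x. (-1) *s v' x)), cls a b w (g + (\<lambda>x. (-1) *s g' x))) \<in> T"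
    by (rule T_combination[OF T D(2) gw(1) D'(2) gw(2)]) (use D(5) D'(5) in \<open>simp_all add: g_def g'_def\<close>)
  then have dT: "(cls a b w (v - v'), cls a b w (g - g')) \<in> T" by (simp add: fun_diff_def plus_fun_def)
  have "(g - g') - (\<lambda>x. z *s (v - v') x) = f - f'"
    by (simp add: g_def g'_def fun_eq_iff vec_eq_iff algebra_simps)
  with eq have "H.nrm ((g - g') - (\<lambda>x. z *s (v - v') x)) = 0" by (simp only:)
  then have vv: "H.nrm (v - v') = 0"
    by (intro resolvent_kernel[OF z _ dT] H.V_closed D(2) D'(2) gw)
  have "H.nrm (g - g') = 0"
    unfolding g_def g'_def by (rule nrm_combination_zero[OF D(1) D'(1) D(2) D'(2) eq vv])
  then show ?thesis
    using normalized_unique[OF D(4,6) D'(4,6) vv] by (simp add: g_def g'_def)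
qed

lemma resolves_combination:
  assumes T: "linear_relation a b w T"
    and v: "resolves T z f v" and v': "resolves T z f' v'"
  shows "resolves T z (f + (\<lambda>x. c *s f' x)) (v + (\<lambda>x. c *s v' x))"
proof -
  note D = resolvesD[OF v] and D' = resolvesD[OF v']
  have eq: "(f + (\<lambda>x. c *s f' x)) + (\<lambda>x. z *s (v + (\<lambda>x. c *s v' x)) x)
      = (f + (\<lambda>x. z *s v x)) + (\<lambda>x. c *s (f' + (\<lambda>x. z *s v' x)) x)"
    by (simp add: fun_eq_iff vec_eq_iff algebra_simps)
  have "normalized (v + (\<lambda>x. c *s v' x))"
    using D(6) D'(6) by (auto simp: normalized_def corth_combination)
  then show ?thesis
    unfolding resolves_def eq
    using pairs_combination[OF D(4) D'(4)] T_combination[OF T D(2,3) D'(2,3) D(5) D'(5)] D(1) D'(1)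
    by (auto intro!: H.V_closed)
qed

lemma resolves_exists:
  assumes T: "T \<subseteq> T_max a b J q w" and z: "z \<in> resolvent_set a b w T" and f: "f \<in> H.wspace"
  shows "\<exists>v. resolves T z f v"
proof -
  have "cls a b w f \<in> L2 a b w" using f by (auto simp: L2_eq)
  then have "cls a b w f \<in> Range (rel_shift a b w T z)" using z unfolding resolvent_set_def by simp
  then obtain U F where UF: "(U, F) \<in> T" "cls a b w f = L2_add a b w F (L2_scale a b w (- z) U)"
    unfolding rel_shift_def by blast
  have "(U, F) \<in> T_max a b J q w" using UF(1) T by blast
  then obtain u g where ug: "(u, g) \<in> pairs" and U: "U = cls a b w u" and F: "F = cls a b w g"
    by (rule T_max_obtain)
  have mem: "u \<in> H.wspace" "g \<in> H.wspace" using ug by (auto simp: pairs_def)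
  obtain v where v: "(v, g) \<in> pairs" "H.nrm (v - u) = 0" "normalized v"
    using normalized_exists[OF ug] by blast
  have vw: "v \<in> H.wspace" using v(1) by (auto simp: pairs_def)
  define g' where "g' = f + (\<lambda>x. z *s v x)"
  have g': "g' \<in> H.wspace" unfolding g'_def using f vw by (intro H.V_closed)
  have "cls a b w f = cls a b w (g + (\<lambda>x. (- z) *s u x))"
    using UF(2) mem by (simp add: U F L2_combination)
  note eq = this
  have 1: "H.nrm (f - (g + (\<lambda>x. (- z) *s u x))) = 0"
    by (rule cls_eq_iff[THEN iffD1, OF f _ eq]) (intro H.V_closed mem)
  have "H.nrm ((f + (\<lambda>x. z *s v x)) - ((g + (\<lambda>x. (- z) *s u x)) + (\<lambda>x. z *s u x))) = 0"
    by (rule nrm_combination_zero[OF f _ vw mem(1) 1 v(2)]) (use mem in \<open>intro H.V_closed\<close>)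
  moreover have "(g + (\<lambda>x. (- z) *s u x)) + (\<lambda>x. z *s u x) = g"
    by (simp add: fun_eq_iff vec_eq_iff algebra_simps)
  ultimately have g'g: "H.nrm (g' - g) = 0" by (simp only: g'_def)
  have "sol v (w_times a b w g')"
  proof (rule sol_cong)
    show "sol v (w_times a b w g)" using v(1) by (simp add: pairs_def)
    show "w_times a b w g A = w_times a b w g' A" if "A \<in> rc_borel a b" for A
      using w_times_cong[OF g' mem(2) g'g that] by simp
  qed
  then have "(v, g') \<in> pairs" using vw g' by (simp add: pairs_def)
  moreover have "cls a b w v = U" "cls a b w g' = F"
    unfolding U F using vw mem g' v(2) g'g by (simp_all add: cls_eq_iff)
  ultimately show ?thesis
    using UF(1) v(3) f by (intro exI[of _ v]) (simp add: resolves_def g'_def)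
qed

lemma eval_E_res_eq:
  assumes T: "linear_relation a b w T" and sub: "T \<subseteq> T_max a b J q w" and z: "z \<in> resolvent_set a b w T"
    and v: "resolves T z f v"
  shows "eval_E_res a b J q w x0 T z (cls a b w f) = v"
proof -
  note D = resolvesD[OF v]
  let ?g = "f + (\<lambda>x. z *s v x)"
  have shift: "(cls a b w v, cls a b w f) \<in> rel_shift a b w T z"
  proof -
    have "L2_add a b w (cls a b w ?g) (L2_scale a b w (- z) (cls a b w v)) = cls a b w (?g + (\<lambda>x. (- z) *s v x))"
      by (rule L2_combination[OF D(3,2)])
    also have "?g + (\<lambda>x. (- z) *s v x) = f"
      by (simp add: fun_eq_iff vec_eq_iff algebra_simps)
    finally show ?thesis using rel_shiftI[OF D(5), of z] by (simp only:)
  qed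
  have res: "resolvent a b w T z (cls a b w f) = cls a b w v"
    unfolding resolvent_def
  proof (rule the_equality)
    show "(cls a b w v, cls a b w f) \<in> rel_shift a b w T z" by (rule shift)
    fix U assume "(U, cls a b w f) \<in> rel_shift a b w T z"
    then obtain F where UF: "(U, F) \<in> T" "cls a b w f = L2_add a b w F (L2_scale a b w (- z) U)"
      unfolding rel_shift_def by blast
    have "(U, F) \<in> T_max a b J q w" using UF(1) sub by blast
    then obtain u g where ug: "(u, g) \<in> pairs" and U: "U = cls a b w u" and F: "F = cls a b w g"
      by (rule T_max_obtain)
    have mem: "u \<in> H.wspace" "g \<in> H.wspace" using ug by (auto simp: pairs_def)
    have "cls a b w f = cls a b w (g + (\<lambda>x. (- z) *s u x))"
      using UF(2) mem by (simp add: U F L2_combination)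
    note eq = this
    have 1: "H.nrm (f - (g + (\<lambda>x. (- z) *s u x))) = 0"
      by (rule cls_eq_iff[THEN iffD1, OF D(1) _ eq]) (intro H.V_closed mem)
    have "(cls a b w (v + (\<lambda>x. (-1) *s u x)), cls a b w (?g + (\<lambda>x. (-1) *s g x))) \<in> T"
      by (rule T_combination[OF T D(2,3) mem D(5)]) (use UF(1) in \<open>simp add: U F\<close>)
    then have dT: "(cls a b w (v - u), cls a b w (?g - g)) \<in> T"
      by (simp add: fun_diff_def plus_fun_def)
    have "(?g - g) - (\<lambda>x. z *s (v - u) x) = f - (g + (\<lambda>x. (- z) *s u x))"
      by (simp add: fun_eq_iff vec_eq_iff algebra_simps)
    with 1 have "H.nrm ((?g - g) - (\<lambda>x. z *s (v - u) x)) = 0" by (simp only:)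
    then have "H.nrm (v - u) = 0"
      by (intro resolvent_kernel[OF z _ dT] H.V_closed D mem)
    then show "U = cls a b w v"
      unfolding U using cls_eq_iff[OF D(2) mem(1)] by simp
  qed
  have "L2_add a b w (L2_scale a b w z (cls a b w v)) (cls a b w f) = cls a b w ?g"
  proof -
    have zv: "(\<lambda>x. z *s v x) \<in> H.wspace" using D(2) by (intro H.V_closed)
    have "L2_scale a b w 1 (cls a b w f) = cls a b w f"
      using L2_scale_cls[OF D(1), of 1] by simp
    then have "L2_add a b w (L2_scale a b w z (cls a b w v)) (cls a b w f)
        = L2_add a b w (cls a b w (\<lambda>x. z *s v x)) (L2_scale a b w 1 (cls a b w f))"
      by (simp add: L2_scale_cls[OF D(2)])
    also have "\<dots> = cls a b w ((\<lambda>x. z *s v x) + (\<lambda>x. 1 *s f x))"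
      by (rule L2_combination[OF zv D(1)])
    also have "(\<lambda>x. z *s v x) + (\<lambda>x. 1 *s f x) = ?g" by (simp add: fun_eq_iff)
    finally show ?thesis .
  qed
  then show ?thesis
    unfolding eval_E_res_def res using eval_E_eq[OF D(4,6)] by simp
qed

lemma resolves_symmetric:
  assumes T: "T = rel_adjoint a b w T" and v: "resolves T z f v" and v': "resolves T z f' v'"
  shows "H.wip (f + (\<lambda>x. z *s v x)) v' = H.wip v (f' + (\<lambda>x. z *s v' x))"
proof -
  note D = resolvesD[OF v] and D' = resolvesD[OF v']
  have "(cls a b w v, cls a b w (f + (\<lambda>x. z *s v x))) \<in> rel_adjoint a b w T"
    using D(5) T by blast
  then have "L2_inner a b w (cls a b w (f + (\<lambda>x. z *s v x))) (cls a b w v')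
      = L2_inner a b w (cls a b w v) (cls a b w (f' + (\<lambda>x. z *s v' x)))"
    using D'(5) unfolding rel_adjoint_def by blast
  then show ?thesis using D D' by (simp add: L2_inner_cls)
qed

text \<open>Off the real axis the imaginary part of the symmetry relation gives the bound directly. For real
  \<open>z\<close> the relation says that the resolvent is an everywhere defined symmetric operator.\<close>

lemma resolvent_bounded:
  assumes T: "linear_relation a b w T" and sub: "T \<subseteq> T_max a b J q w" and adj: "T = rel_adjoint a b w T"
    and z: "z \<in> resolvent_set a b w T"
  shows "\<exists>C. \<forall>f v. resolves T z f v \<longrightarrow> H.nrm v \<le> C * H.nrm f"
proof (cases "Im z = 0")
  case True
  define R where "R f = (SOME v. resolves T z f v)" for f
  have R: "resolves T z f (R f)" if "f \<in> H.wspace" for f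
    unfolding R_def by (rule someI_ex[OF resolves_exists[OF sub z that]])
  have "\<exists>C. \<forall>f\<in>H.wspace. H.nrm (R f) \<le> C * H.nrm f"
  proof (rule H.Hellinger_Toeplitz)
    show "R f \<in> H.wspace" if "f \<in> H.wspace" for f using resolvesD(2)[OF R[OF that]] .
    fix f g assume f: "f \<in> H.wspace" and g: "g \<in> H.wspace"
    note D = resolvesD[OF R[OF f]] and D' = resolvesD[OF R[OF g]]
    have cz: "cnj z = z" using True by (simp add: complex_eq_iff)
    have "H.wip f (R g) + cnj z * H.wip (R f) (R g) = H.wip (R f) g + z * H.wip (R f) (R g)"
      using resolves_symmetric[OF adj R[OF f] R[OF g]] D D'
      by (simp add: H.ip_add_left H.ip_add_right H.ip_scale_left H.ip_scale_right H.V_closed)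
    then show "H.wip (R f) g = H.wip f (R g)" by (simp add: cz)
  qed
  then obtain C where C: "\<And>f. f \<in> H.wspace \<Longrightarrow> H.nrm (R f) \<le> C * H.nrm f" by blast
  have "H.nrm v \<le> C * H.nrm f" if v: "resolves T z f v" for f v
  proof -
    have f: "f \<in> H.wspace" using resolvesD(1)[OF v] .
    have "v = R f"
      by (rule resolves_unique[OF T z v R[OF f]]) simp
    then show ?thesis using C[OF f] by simp
  qed
  then show ?thesis by blast
next
  case False
  have "H.nrm v \<le> (1 / \<bar>Im z\<bar>) * H.nrm f" if v: "resolves T z f v" for f v
  proof -
    note D = resolvesD[OF v]
    have "H.wip f v + cnj z * H.wip v v = H.wip v f + z * H.wip v v"
      using resolves_symmetric[OF adj v v] D
      by (simp add: H.ip_add_left H.ip_add_right H.ip_scale_left H.ip_scale_right H.V_closed)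
    moreover have "H.wip f v = cnj (H.wip v f)" by (rule H.ip_commute[OF D(2,1)])
    ultimately have "cnj (H.wip v f) + cnj z * of_real ((H.nrm v)\<^sup>2) = H.wip v f + z * of_real ((H.nrm v)\<^sup>2)"
      by (simp add: H.ip_self_real[OF D(2)])
    from arg_cong[OF this, of Im] have "Im (H.wip v f) = - Im z * (H.nrm v)\<^sup>2" by simp
    then have "\<bar>Im z\<bar> * (H.nrm v)\<^sup>2 = \<bar>Im (H.wip v f)\<bar>" by (simp add: abs_mult)
    also have "\<dots> \<le> H.nrm v * H.nrm f"
      using abs_Im_le_cmod[of "H.wip v f"] H.Cauchy_Schwarz[OF D(2,1)] by linarith
    finally have "H.nrm v * (\<bar>Im z\<bar> * H.nrm v) \<le> H.nrm v * H.nrm f"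
      by (simp add: power2_eq_square mult_ac)
    then have "H.nrm v = 0 \<or> \<bar>Im z\<bar> * H.nrm v \<le> H.nrm f"
      using H.nrm_nonneg[OF D(2)] by (auto simp: mult_le_cancel_left)
    then show ?thesis
      using False H.nrm_nonneg[OF D(1)] by (auto simp: field_simps)
  qed
  then show ?thesis by blast
qed

lemma integrable_vec:
  fixes f :: "real \<Rightarrow> complex^'m"
  assumes "\<And>i. integrable N (\<lambda>x. f x $ i)"
  shows "integrable N f"
proof -
  have bl: "bounded_linear (\<lambda>c. c *s (axis i 1 :: complex^'m))" for i
  proof
    show "\<exists>K. \<forall>c. norm (c *s (axis i 1 :: complex^'m)) \<le> norm c * K"
      by (intro exI[of _ "norm (axis i 1 :: complex^'m)"]) (simp add: vec_norm_scale)
  qed (auto simp: vec_eq_iff algebra_simps)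
  have "integrable N (\<lambda>x. \<Sum>i\<in>UNIV. (f x $ i) *s axis i 1)"
    by (intro Bochner_Integration.integrable_sum integrable_bounded_linear[OF bl] assms)
  then show ?thesis by (simp add: basis_expansion)
qed

text \<open>Each component of \<open>f \<mapsto> (E\<^sub>z f)(x)\<close> is a bounded linear functional; the Riesz vectors of the
  components, conjugated, are the rows of \<open>G\<close>.\<close>

theorem green_function:
  assumes T: "self_adjoint_restriction a b J q w T"
    and x: "x \<in> einterval a b" and z: "z \<in> resolvent_set a b w T"
  shows "\<exists>G :: real \<Rightarrow> complex^'n^'n. (\<forall>j. (\<lambda>y. column j (cadj (G y))) \<in> pre_L2 a b w) \<and>
    (\<forall>F\<in>L2 a b w. \<forall>f\<in>F. eval_E_res a b J q w x0 T z F x = (LINT y|M. G y *v (W y *v f y)))"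
proof -
  have lin: "linear_relation a b w T" and sub: "T \<subseteq> T_max a b J q w" and adj: "T = rel_adjoint a b w T"
    using T by (auto simp: self_adjoint_restriction_def)
  define R where "R f = (SOME v. resolves T z f v)" for f
  have R: "resolves T z f (R f)" if "f \<in> H.wspace" for f
    unfolding R_def by (rule someI_ex[OF resolves_exists[OF sub z that]])
  have R_comb: "R (f + (\<lambda>x. c *s g x)) = R f + (\<lambda>x. c *s R g x)" if f: "f \<in> H.wspace" and g: "g \<in> H.wspace" for f g c
  proof (rule resolves_unique[OF lin z R resolves_combination[OF lin R[OF f] R[OF g]]])
    show "f + (\<lambda>x. c *s g x) \<in> H.wspace" using f g by (intro H.V_closed)
  qed simp
  have R_add: "R (f + g) = R f + R g" if "f \<in> H.wspace" "g \<in> H.wspace" for f g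
    using R_comb[OF that, of 1] by simp
  have R_zero: "R 0 = 0"
  proof -
    have "R 0 = R 0 + R 0" using R_add[OF H.wspace_zero H.wspace_zero] by simp
    then show ?thesis by simp
  qed
  have R_scale: "R (\<lambda>x. c *s g x) = (\<lambda>x. c *s R g x)" if "g \<in> H.wspace" for g c
    using R_comb[OF H.wspace_zero that, of c] by (simp add: R_zero)
  obtain C1 where C1: "\<And>f v. resolves T z f v \<Longrightarrow> H.nrm v \<le> C1 * H.nrm f"
    using resolvent_bounded[OF lin sub adj z] by blast
  obtain C2 where C2: "C2 \<ge> 0" "\<And>u f. (u, f) \<in> pairs \<Longrightarrow> u x0 \<in> corth N0 \<Longrightarrow> norm (u x) \<le> C2 * (H.nrm u + H.nrm f)"
    using evaluation_bound[OF x] by blast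
  have bound: "norm (R f x) \<le> (C2 * (C1 + (1 + cmod z * C1))) * H.nrm f" if f: "f \<in> H.wspace" for f
  proof -
    note D = resolvesD[OF R[OF f]]
    have "H.nrm (f + (\<lambda>x. z *s R f x)) \<le> H.nrm f + cmod z * H.nrm (R f)"
      using H.nrm_triangle[OF f, of "\<lambda>x. z *s R f x"] H.nrm_scale[OF D(2), of z] D(2) by (simp add: H.V_closed)
    also have "\<dots> \<le> H.nrm f + cmod z * (C1 * H.nrm f)"
      using C1[OF R[OF f]] by (intro add_left_mono mult_left_mono) auto
    finally have "H.nrm (R f) + H.nrm (f + (\<lambda>x. z *s R f x)) \<le> (C1 + (1 + cmod z * C1)) * H.nrm f"
      using C1[OF R[OF f]] by (simp add: algebra_simps)
    then have "C2 * (H.nrm (R f) + H.nrm (f + (\<lambda>x. z *s R f x))) \<le> C2 * ((C1 + (1 + cmod z * C1)) * H.nrm f)"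
      using C2(1) by (rule mult_left_mono)
    moreover have "norm (R f x) \<le> C2 * (H.nrm (R f) + H.nrm (f + (\<lambda>x. z *s R f x)))"
      using C2(2)[OF D(4)] D(6) by (simp add: normalized_def)
    ultimately show ?thesis by (simp add: mult.assoc)
  qed
  have "\<exists>g\<in>H.wspace. \<forall>f\<in>H.wspace. R f x $ i = H.wip g f" for i
  proof (rule H.Riesz_representation)
    show "R (f + g) x $ i = R f x $ i + R g x $ i" if "f \<in> H.wspace" "g \<in> H.wspace" for f g
      using R_add[OF that] by simp
    show "R (\<lambda>x. c *s f x) x $ i = c * R f x $ i" if "f \<in> H.wspace" for c f
      using R_scale[OF that] by simp
    show "cmod (R f x $ i) \<le> (C2 * (C1 + (1 + cmod z * C1))) * H.nrm f" if "f \<in> H.wspace" for f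
      by (rule order_trans[OF Finite_Cartesian_Product.norm_nth_le bound[OF that]])
  qed
  then obtain g where g: "\<And>i. g i \<in> H.wspace" "\<And>i f. f \<in> H.wspace \<Longrightarrow> R f x $ i = H.wip (g i) f"
    by metis
  define G where "G y = (\<chi> i j. cnj (g i y $ j))" for y
  have col: "column j (cadj (G y)) = g j y" for j y
    by (simp add: G_def cadj_def column_def vec_eq_iff)
  have comp: "(G y *v u) $ i = cinner (g i y) u" for y u i
    by (simp add: G_def matrix_vector_mult_def cinner_def)
  have repr: "R f x = (LINT y|M. G y *v (W y *v f y))" if f: "f \<in> H.wspace" for f
  proof -
    have int: "integrable M (\<lambda>y. G y *v (W y *v f y))"
      by (rule integrable_vec) (simp add: comp H.wip_integrable[OF g(1) f])
    have "(LINT y|M. G y *v (W y *v f y)) $ i = R f x $ i" for i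
    proof -
      have "(LINT y|M. G y *v (W y *v f y)) $ i = (LINT y|M. (G y *v (W y *v f y)) $ i)"
        by (rule integral_bounded_linear[OF bounded_linear_vec_nth int, symmetric])
      then show ?thesis by (simp add: comp g(2)[OF f] H.wip_def)
    qed
    then show ?thesis by (simp add: vec_eq_iff)
  qed
  have "eval_E_res a b J q w x0 T z F x = (LINT y|M. G y *v (W y *v f y))"
    if F: "F \<in> L2 a b w" and f: "f \<in> F" for F f
  proof -
    obtain h where h: "h \<in> H.wspace" "F = cls a b w h" using F by (auto simp: L2_eq)
    have fw: "f \<in> H.wspace" and "H.nrm (f - h) = 0" using f h by (auto simp: cls_eq)
    then have "F = cls a b w f" using cls_eq_iff[OF fw h(1)] h(2) by simp
    then show ?thesis
      using eval_E_res_eq[OF lin sub z R[OF fw]] repr[OF fw] by simp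
  qed
  moreover have "(\<lambda>y. column j (cadj (G y))) \<in> pre_L2 a b w" for j
    using g(1)[of j] by (simp add: col pre_L2_eq)
  ultimately show ?thesis by blast
qed

end

lemma jump_eq:
  assumes "\<exists>Q. antiderivative a b q Q" "x \<in> einterval a b"
  shows "jump a b q x = q {x}"
  unfolding jump_def Let_def
  using antiderivative_point[OF someI_ex[OF assms(1)] assms(2)] by simp

theorem theorem4p6:
  fixes a b :: ereal
    and J :: "complex^'n^'n"
    and q w :: "real set \<Rightarrow> complex^'n^'n"
    and T :: "'n class_rel"
    and x0 :: real
  assumes "a < b"
    and "invertible J" and "cadj J = - J"
    and "dist0 a b q" and "dist0 a b w"
    and "hermitian_dist a b q" and "nonneg_dist a b w" and "nonzero_dist a b w"
    and "\<forall>x\<in>einterval a b.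
           invertible (2 *\<^sub>R J + jump a b q x) \<and> invertible (2 *\<^sub>R J - jump a b q x)"
    and "self_adjoint_restriction a b J q w T"
    and "x0 \<in> einterval a b"
    and "\<exists>Q. antiderivative a b q Q \<and> isCont Q x0"
    and "\<exists>W. antiderivative a b w W \<and> isCont W x0"
  shows "\<forall>x\<in>einterval a b. \<forall>z\<in>resolvent_set a b w T.
           \<exists>G :: real \<Rightarrow> complex^'n^'n.
             (\<forall>j. (\<lambda>y. column j (cadj (G y))) \<in> pre_L2 a b w) \<and>
             (\<forall>F\<in>L2 a b w. \<forall>f\<in>F.
                eval_E_res a b J q w x0 T z F x =
                  (LINT y|tr_measure a b w. G y *v (w_density a b w y *v f y)))"
proof -
  have jump: "jump a b q x = q {x}" if "x \<in> einterval a b" for x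
    by (rule jump_eq[OF _ that]) (use assms(12) in blast)
  interpret weighted_ode a b J q w x0
    by unfold_locales (use assms jump in auto)
  show ?thesis
    using green_function[OF assms(10)] by blast
qed

end
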